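(* Let $1\le p<n$ and $k>0$. For any $A=UR^2U^T$ in $S^+(p,n)$ (with $U\in V_{n,p}$, $R\in P_p$) and any direction $(\Delta,D)\in\mathcal H_{(U,R^2)}$, the curve $$\gamma_A(t)=U(t)R^2(t)U(t)^T,\qquad U(t)=UV^T\cos(\Gamma t)V+X\sin(\Gamma t)V,\qquad R^2(t)=R\exp(tR^{-1}DR^{-1})R,$$ where $X\Gamma V=\Delta$ is the compact singular value decomposition of $\Delta$, can be extended from $t=-\infty$ to $t=\infty$ as a curve in $S^+(p,n)$. Moreover, the Riemannian manifold $(S^+(p,n),g)$ is geodesically complete.
   Context: $S^+(p,n)$ is the set of real symmetric positive semidefinite $n\times n$ matrices of rank $p$; $V_{n,p}=\{U\in\mathbb R^{n\times p}:U^TU=I_p\}$; $P_p$ is the set of symmetric positive definite $p\times p$ matrices; $\mathrm{Sym}(p)$ is the space of symmetric $p\times p$ matrices; $\exp$ is the matrix exponential. Every $A\in S^+(p,n)$ is $A=UR^2U^T$ with $(U,R^2)\in V_{n,p}\times P_p$, $R\in P_p$, uniquely up to $(U,R^2)\mapsto(UO,O^TR^2O)$, $O\in O(p)$, so $S^+(p,n)\cong(V_{n,p}\times P_p)/O(p)$. Tangent vectors at $A$ are represented, via the differential of the quotient map, by elements of the horizontal space $\mathcal H_{(U,R^2)}=\{(\Delta,D):\Delta=U_\perp B,\ B\in\mathbb R^{(n-p)\times p},\ D=RD_0R,\ D_0\in\mathrm{Sym}(p)\}$, where $U_\perp\in V_{n,n-p}$, $U^TU_\perp=0$. The Riemannian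 metric $g$ is $g_{(U,R^2)}((\Delta_1,D_1),(\Delta_2,D_2))=\mathrm{Tr}(\Delta_1^T\Delta_2)+k\,\mathrm{Tr}(R^{-1}D_1R^{-2}D_2R^{-1})$. Convention for the singular value decomposition $X\Gamma V=\Delta$: $V\in O(p)$, $\Gamma$ is the $p\times p$ diagonal matrix of singular values of $\Delta$, and $X\in\mathbb R^{n\times p}$ has orthonormal columns at the positions of nonzero singular values (columns at zero singular values play no role, since they are multiplied by $\sin(0)=0$, and may be taken to be $0$). Geodesically complete means that every maximal geodesic is defined for all $t\in\mathbb R$. *)

theory Defs
  imports "HOL-Analysis.Analysis"
begin

section \<open>Riemannian geodesics on embedded submanifolds of Euclidean spaces\<close>

text \<open>\<open>Ck_on k S f\<close> is meant for open \<open>S\<close> and finite-dimensional domains, where it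
  says that \<open>f\<close> is of class $C^k$ on \<open>S\<close>.\<close>

primrec Ck_on ::
  "nat \<Rightarrow> 'a::real_normed_vector set \<Rightarrow> ('a \<Rightarrow> 'b::real_normed_vector) \<Rightarrow> bool" where
  "Ck_on 0 S f \<longleftrightarrow> continuous_on S f"
| "Ck_on (Suc k) S f \<longleftrightarrow>
     (\<forall>x\<in>S. f differentiable (at x)) \<and> (\<forall>v. Ck_on k S (\<lambda>x. frechet_derivative f (at x) v))"

definition smooth_on :: "'a::real_normed_vector set \<Rightarrow> ('a \<Rightarrow> 'b::real_normed_vector) \<Rightarrow> bool" where
  "smooth_on S f \<longleftrightarrow> (\<forall>k. Ck_on k S f)"

text \<open>Local parametrizations (inverses of charts) of an embedded submanifold \<open>M\<close> whose
  dimension is \<open>CARD('d)\<close>.\<close>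

definition local_parametrization ::
  "'a::euclidean_space set \<Rightarrow> (real^'d) set \<Rightarrow> (real^'d \<Rightarrow> 'a) \<Rightarrow> bool" where
  "local_parametrization M W \<phi> \<longleftrightarrow>
     open W \<and> smooth_on W \<phi> \<and> (\<forall>x\<in>W. inj (frechet_derivative \<phi> (at x))) \<and>
     \<phi> ` W \<subseteq> M \<and> openin (top_of_set M) (\<phi> ` W) \<and> (\<exists>\<psi>. homeomorphism W (\<phi> ` W) \<phi> \<psi>)"

definition partial :: "'d \<Rightarrow> (real^'d \<Rightarrow> 'b::real_normed_vector) \<Rightarrow> real^'d \<Rightarrow> 'b" where
  "partial i f x = frechet_derivative f (at x) (axis i 1)"

text \<open>In the following, \<open>g A a b\<close> is the value of a Riemannian metric at the point \<open>A\<close> on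
  the tangent vectors \<open>a\<close>, \<open>b\<close>, both regarded as elements of the ambient space.\<close>

definition metric_coeffs ::
  "('a::euclidean_space \<Rightarrow> 'a \<Rightarrow> 'a \<Rightarrow> real) \<Rightarrow> (real^'d \<Rightarrow> 'a) \<Rightarrow> real^'d \<Rightarrow> real^'d^'d" where
  "metric_coeffs g \<phi> x = (\<chi> i j. g (\<phi> x) (partial i \<phi> x) (partial j \<phi> x))"

definition christoffel :: "(real^'d \<Rightarrow> real^'d^'d) \<Rightarrow> 'd \<Rightarrow> 'd \<Rightarrow> 'd \<Rightarrow> real^'d \<Rightarrow> real" where
  "christoffel G m i j x =
     (1/2) * (\<Sum>l\<in>UNIV. matrix_inv (G x) $ m $ l *
       (partial i (\<lambda>y. G y $ j $ l) x + partial j (\<lambda>y. G y $ i $ l) x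
        - partial l (\<lambda>y. G y $ i $ j) x))"

text \<open>A geodesic has vanishing covariant acceleration for the Levi-Civita connection,
  i.e. it satisfies the geodesic equation in all local coordinates. The type argument fixes
  the coordinate space \<open>real^'d\<close>.\<close>

definition geodesic ::
  "'d::finite itself \<Rightarrow> 'a::euclidean_space set \<Rightarrow> ('a \<Rightarrow> 'a \<Rightarrow> 'a \<Rightarrow> real) \<Rightarrow>
   real set \<Rightarrow> (real \<Rightarrow> 'a) \<Rightarrow> bool" where
  "geodesic _ M g I \<gamma> \<longleftrightarrow>
     open I \<and> is_interval I \<and> I \<noteq> {} \<and> \<gamma> ` I \<subseteq> M \<and> smooth_on I \<gamma> \<and>
     (\<forall>(W :: (real^'d) set) \<phi>. local_parametrization M W \<phi> \<longrightarrow>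
       (let x = inv_into W \<phi> \<circ> \<gamma> in
        \<exists>x' x''. \<forall>t\<in>I. \<gamma> t \<in> \<phi> ` W \<longrightarrow>
          (x has_vector_derivative x' t) (at t) \<and>
          (x' has_vector_derivative x'' t) (at t) \<and>
          (\<forall>m. x'' t $ m +
             (\<Sum>i\<in>UNIV. \<Sum>j\<in>UNIV.
               christoffel (metric_coeffs g \<phi>) m i j (x t) * x' t $ i * x' t $ j) = 0)))"

definition maximal_geodesic ::
  "'d::finite itself \<Rightarrow> 'a::euclidean_space set \<Rightarrow> ('a \<Rightarrow> 'a \<Rightarrow> 'a \<Rightarrow> real) \<Rightarrow>
   real set \<Rightarrow> (real \<Rightarrow> 'a) \<Rightarrow> bool" where
  "maximal_geodesic d M g I \<gamma> \<longleftrightarrow>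
     geodesic d M g I \<gamma> \<and>
     (\<forall>J \<delta>. geodesic d M g J \<delta> \<and> I \<subseteq> J \<and> (\<forall>t\<in>I. \<delta> t = \<gamma> t) \<longrightarrow> J = I)"

definition geodesically_complete ::
  "'d::finite itself \<Rightarrow> 'a::euclidean_space set \<Rightarrow> ('a \<Rightarrow> 'a \<Rightarrow> 'a \<Rightarrow> real) \<Rightarrow> bool" where
  "geodesically_complete d M g \<longleftrightarrow> (\<forall>I \<gamma>. maximal_geodesic d M g I \<gamma> \<longrightarrow> I = UNIV)"


section \<open>Matrices\<close>

definition sym_matrices :: "(real^'n^'n) set" where
  "sym_matrices = {A. transpose A = A}"

definition spd_matrices :: "(real^'n^'n) set" where
  "spd_matrices = {A \<in> sym_matrices. \<forall>x. x \<noteq> 0 \<longrightarrow> 0 < x \<bullet> (A *v x)}"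

definition psd_rank :: "nat \<Rightarrow> (real^'n^'n) set" where
  "psd_rank p = {A \<in> sym_matrices. (\<forall>x. 0 \<le> x \<bullet> (A *v x)) \<and> rank A = p}"

text \<open>\<open>real^'p^'n\<close> is the type of matrices with \<open>CARD('n)\<close> rows and \<open>CARD('p)\<close> columns.\<close>

definition stiefel :: "(real^'p^'n) set" where
  "stiefel = {U. transpose U ** U = mat 1}"

definition matrix_exp :: "real^'n^'n \<Rightarrow> real^'n^'n" where
  "matrix_exp A = (\<Sum>i. (1 / fact i) *\<^sub>R (((**) A ^^ i) (mat 1)))"

definition diag :: "real^'p \<Rightarrow> real^'p^'p" where
  "diag s = (\<chi> i j. if i = j then s $ i else 0)"

text \<open>\<open>s\<close> lists the singular values. The columns of \<open>X\<close> belonging to zero singular values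
  are left arbitrary.\<close>

definition compact_svd :: "real^'p^'n \<Rightarrow> real^'p^'n \<Rightarrow> real^'p \<Rightarrow> real^'p^'p \<Rightarrow> bool" where
  "compact_svd \<Delta> X s V \<longleftrightarrow>
     X ** diag s ** V = \<Delta> \<and> orthogonal_matrix V \<and> (\<forall>i. 0 \<le> s $ i) \<and>
     (\<forall>i j. s $ i \<noteq> 0 \<and> s $ j \<noteq> 0 \<longrightarrow> column i X \<bullet> column j X = (if i = j then 1 else 0))"


section \<open>The quotient geometry of positive semidefinite matrices of fixed rank\<close>

text \<open>Index types of cardinality \<open>n - p\<close> and \<open>p (n - p) + p (p + 1) / 2\<close> (the dimension of the
  manifold), where \<open>n = CARD('n)\<close> and \<open>p = CARD('p)\<close>. As types are nonempty, \<open>codim\<close> is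
  meaningful only if \<open>p < n\<close>.\<close>

typedef ('n, 'p) codim = "{..<max 1 (CARD('n::finite) - CARD('p::finite))}"
  by (rule exI[of _ "0::nat"]) simp

typedef ('n, 'p) psd_coord =
  "{..<CARD('p::finite) * (CARD('n::finite) - CARD('p)) + CARD('p) * (CARD('p) + 1) div 2}"
proof -
  have "0 < CARD('p) * (CARD('p) + 1) div 2"
    using mult_le_mono[of 1 "CARD('p)" 2 "CARD('p) + 1"] by (simp add: Suc_leI div_greater_zero_iff)
  then show ?thesis
    by (intro exI[of _ 0]) (simp only: lessThan_iff add_pos_pos trans_less_add2)
qed

instance codim :: (finite, finite) finite
  by standard (simp add: type_definition.univ[OF type_definition_codim])

instance psd_coord :: (finite, finite) finite
  by standard (simp add: type_definition.univ[OF type_definition_psd_coord])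

lemma card_codim:
  "CARD('p::finite) < CARD('n::finite) \<Longrightarrow> CARD(('n, 'p) codim) = CARD('n) - CARD('p)"
  by (simp add: type_definition.card[OF type_definition_codim])

lemma card_psd_coord:
  "CARD(('n::finite, 'p::finite) psd_coord) =
     CARD('p) * (CARD('n) - CARD('p)) + CARD('p) * (CARD('p) + 1) div 2"
  by (simp add: type_definition.card[OF type_definition_psd_coord])

definition quotient_map :: "(real^'p^'n) \<times> (real^'p^'p) \<Rightarrow> real^'n^'n" where
  "quotient_map = (\<lambda>(U, S). U ** S ** transpose U)"

definition horizontal :: "real^'p^'n \<Rightarrow> real^'p^'p \<Rightarrow> ((real^'p^'n) \<times> (real^'p^'p)) set" where
  "horizontal U R =
     {(Uperp ** B, R ** D0 ** R) | (Uperp :: real^('n, 'p) codim^'n) B D0.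
        Uperp \<in> stiefel \<and> transpose U ** Uperp = 0 \<and> D0 \<in> sym_matrices}"

definition horizontal_metric ::
  "real \<Rightarrow> real^'p^'p \<Rightarrow> (real^'p^'n) \<times> (real^'p^'p) \<Rightarrow> (real^'p^'n) \<times> (real^'p^'p) \<Rightarrow> real" where
  "horizontal_metric k R = (\<lambda>(\<Delta>1, D1) (\<Delta>2, D2).
     trace (transpose \<Delta>1 ** \<Delta>2) +
     k * trace (matrix_inv R ** D1 ** (matrix_inv R ** matrix_inv R) ** D2 ** matrix_inv R))"

text \<open>The metric on the quotient: tangent vectors \<open>a\<close>, \<open>b\<close> at \<open>A\<close> are represented by
  horizontal vectors through the differential of the quotient map. The value does not depend
  on the factorization \<open>A = U ** R ** R ** transpose U\<close> that is chosen.\<close>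

definition psd_metric ::
  "'p::finite itself \<Rightarrow> real \<Rightarrow> real^'n^'n \<Rightarrow> real^'n^'n \<Rightarrow> real^'n^'n \<Rightarrow> real" where
  "psd_metric _ k A a b =
     (THE c. \<exists>(U :: real^'p^'n) R \<xi> \<eta>.
        U \<in> stiefel \<and> R \<in> spd_matrices \<and> A = quotient_map (U, R ** R) \<and>
        \<xi> \<in> horizontal U R \<and> \<eta> \<in> horizontal U R \<and>
        a = frechet_derivative quotient_map (at (U, R ** R)) \<xi> \<and>
        b = frechet_derivative quotient_map (at (U, R ** R)) \<eta> \<and>
        c = horizontal_metric k R \<xi> \<eta>)"

definition U_curve ::
  "real^'p^'n \<Rightarrow> real^'p^'n \<Rightarrow> real^'p \<Rightarrow> real^'p^'p \<Rightarrow> real \<Rightarrow> real^'p^'n" where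
  "U_curve U X s V t =
     U ** transpose V ** diag (\<chi> i. cos (s $ i * t)) ** V + X ** diag (\<chi> i. sin (s $ i * t)) ** V"

definition R2_curve :: "real^'p^'p \<Rightarrow> real^'p^'p \<Rightarrow> real \<Rightarrow> real^'p^'p" where
  "R2_curve R D t = R ** matrix_exp (t *\<^sub>R (matrix_inv R ** D ** matrix_inv R)) ** R"

definition psd_curve ::
  "real^'p^'n \<Rightarrow> real^'p^'p \<Rightarrow> real^'p^'p \<Rightarrow> real^'p^'n \<Rightarrow> real^'p \<Rightarrow> real^'p^'p \<Rightarrow>
   real \<Rightarrow> real^'n^'n" where
  "psd_curve U R D X s V t =
     U_curve U X s V t ** R2_curve R D t ** transpose (U_curve U X s V t)"

end

theory Submission
  imports Defs
begin

text \<open>Let \<open>A = U S U\<^sup>T\<close> with orthonormal frame \<open>U\<close> and positive definite \<open>S\<close>. A curve \<open>U(t) S(t) U(t)\<^sup>T\<close> stays in the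
  manifold as long as the frame stays orthonormal and \<open>S\<close> positive definite. For the curve of the theorem the
  frame stays orthonormal since \<open>U\<^sup>T \<Delta> = 0\<close> (\<open>U_curve_in_stiefel\<close>), and \<open>R exp(t M) R\<close> with symmetric \<open>M\<close> is
  positive definite for all \<open>t\<close>.

  These curves are in general not geodesics, so completeness needs a separate argument. It consists in
  integrating the geodesic equation explicitly. The manifold is a bundle over the Grassmannian whose fibres are
  cones of positive definite matrices. A velocity \<open>a\<close> at \<open>A\<close>, with pseudoinverse \<open>B\<close> of \<open>A\<close> and \<open>P = A B\<close>, splits
  into \<open>X = (1 - P) a B\<close>, which turns the range of \<open>A\<close>, and \<open>W = B a P\<close>, which moves \<open>A\<close> in its fibre. The metric is
  \<open>\<bar>X\<bar>\<^sup>2 + k Tr (W W)\<close>, and along a curve the geodesic equation is the system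

    \<open>X' = X X\<^sup>T - X\<^sup>T X + X L\<close>,  \<open>W' = X W + W X\<^sup>T\<close>,  where  \<open>L = 2 k (W\<^sup>T - W)\<close>

  (\<open>euler_lagrange_zero_iff\<close>). The term \<open>X L\<close> comes from the curvature of the horizontal distribution. The system
  conserves the skew matrix \<open>K = X - X\<^sup>T - L\<close>, and it implies \<open>L' = K L - L K\<close>. Hence its solution with initial
  values \<open>A0\<close>, \<open>X0\<close>, \<open>W0\<close>, \<open>L0\<close> at time 0 is

    \<open>A(t) = Q A0 exp(t W0) Q\<^sup>T\<close>,  where  \<open>Q = exp(t K) exp(t L0)\<close> is orthogonal,

  which is defined for all \<open>t\<close> (\<open>geodesic_flow\<close>). Conversely, undoing the rotation \<open>Q\<close> along any geodesic leaves
  quantities with zero derivative, so every geodesic is a restriction of such a solution (\<open>geodesic_eq_flow\<close>), and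
  a maximal one is defined on the whole line.

  To connect the system with the geodesic equation in coordinates, the metric is extended to the polynomial
  expression \<open>psd_form\<close> in \<open>A\<close>, its pseudoinverse and arbitrary ambient matrices. For metrics given in this way the
  equation with Christoffel symbols in every local parametrization is equivalent to an Euler-Lagrange equation in
  the ambient space, paired with all tangent vectors (\<open>geodesic_iff_euler_lagrange\<close>). This uses that the
  pseudoinverse is differentiable along the manifold (\<open>pinv_has_derivative\<close>) and that every point has a local
  parametrization whose differential reaches all tangent vectors (\<open>ex_local_parametrization\<close>).\<close>

section \<open>Matrix algebra\<close>

lemma matrix_add_rdistrib: "(B + C) ** A = B ** A + C ** (A :: 'a::ring_1^_^_)"
  by (simp add: matrix_matrix_mult_def vec_eq_iff distrib_right sum.distrib)

lemma matrix_mul_sub_ldistrib: "A ** (B - C) = A ** B - A ** (C :: 'a::ring_1^_^_)"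
  by (simp add: matrix_matrix_mult_def vec_eq_iff right_diff_distrib sum_subtractf)

lemma matrix_mul_sub_rdistrib: "(B - C) ** A = B ** A - C ** (A :: 'a::ring_1^_^_)"
  by (simp add: matrix_matrix_mult_def vec_eq_iff left_diff_distrib sum_subtractf)

lemma matrix_mul_lminus: "(- A) ** B = - (A ** (B :: 'a::ring_1^_^_))"
  by (simp add: matrix_matrix_mult_def vec_eq_iff sum_negf)

lemma matrix_mul_rminus: "A ** (- B) = - (A ** (B :: 'a::ring_1^_^_))"
  by (simp add: matrix_matrix_mult_def vec_eq_iff sum_negf)

lemma matrix_mul_lzero [simp]: "0 ** A = (0 :: 'a::ring_1^_^_)"
  by (simp add: matrix_matrix_mult_def vec_eq_iff)

lemma matrix_mul_rzero [simp]: "A ** 0 = (0 :: 'a::ring_1^_^_)"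
  by (simp add: matrix_matrix_mult_def vec_eq_iff)

lemma matrix_mul_scaleR_left: "(c *\<^sub>R A) ** B = c *\<^sub>R (A ** (B :: real^_^_))"
  by (simp add: matrix_matrix_mult_def vec_eq_iff sum_distrib_left mult.assoc)

lemma matrix_mul_scaleR_right: "A ** (c *\<^sub>R B) = c *\<^sub>R (A ** (B :: real^_^_))"
  by (simp add: matrix_matrix_mult_def vec_eq_iff sum_distrib_left mult_ac)

lemma transpose_add: "transpose (A + B) = transpose A + transpose B"
  by (simp add: transpose_def vec_eq_iff)

lemma transpose_diff: "transpose (A - B) = transpose A - transpose B"
  by (simp add: transpose_def vec_eq_iff)

lemma transpose_uminus: "transpose (- A) = - transpose A"
  by (simp add: transpose_def vec_eq_iff)

lemma transpose_zero [simp]: "transpose 0 = 0"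
  by (simp add: transpose_def vec_eq_iff)

lemmas transpose_simps =
  transpose_add transpose_diff transpose_uminus transpose_scalar matrix_transpose_mul

lemmas matrix_distribs =
  matrix_add_ldistrib matrix_add_rdistrib matrix_mul_sub_ldistrib matrix_mul_sub_rdistrib
  matrix_mul_lminus matrix_mul_rminus matrix_mul_scaleR_left matrix_mul_scaleR_right

lemma linear_transpose: "linear (transpose :: real^'m^'n \<Rightarrow> _)"
  by (rule linearI) (simp_all add: transpose_simps)

lemma bounded_linear_transpose: "bounded_linear (transpose :: real^'m^'n \<Rightarrow> _)"
  by (rule linear_conv_bounded_linear[THEN iffD1, OF linear_transpose])

lemma bounded_linear_trace: "bounded_linear (trace :: real^'n^'n \<Rightarrow> real)"
  by (rule linear_conv_bounded_linear[THEN iffD1])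
     (rule linearI, simp_all add: trace_def sum.distrib sum_distrib_left)

lemma trace_scaleR: "trace (c *\<^sub>R A) = c * trace (A :: real^'n^'n)"
  by (simp add: trace_def sum_distrib_left)

lemma trace_uminus: "trace (- A) = - trace (A :: real^'n^'n)"
  by (simp add: trace_def sum_negf)

lemma trace_transpose: "trace (transpose A) = trace (A :: real^'n^'n)"
  by (simp add: trace_def transpose_def)

lemma bounded_bilinear_matrix_mul:
  "bounded_bilinear ((**) :: real^'m^'n \<Rightarrow> real^'k^'m \<Rightarrow> real^'k^'n)"
  unfolding bilinear_conv_bounded_bilinear[symmetric] bilinear_def
  by (auto intro!: linearI simp: matrix_distribs)

lemma bounded_bilinear_matrix_vector_mul:
  "bounded_bilinear ((*v) :: real^'m^'n \<Rightarrow> real^'m \<Rightarrow> real^'n)"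
  unfolding bilinear_conv_bounded_bilinear[symmetric] bilinear_def
  by (auto intro!: linearI simp: matrix_vector_mult_add_rdistrib scaleR_matrix_vector_assoc
      matrix_vector_right_distrib matrix_vector_mult_scaleR)

lemmas has_vector_derivative_matrix_mul =
  bounded_bilinear.has_vector_derivative[OF bounded_bilinear_matrix_mul]
lemmas has_derivative_matrix_mul =
  bounded_bilinear.FDERIV[OF bounded_bilinear_matrix_mul]
lemmas has_vector_derivative_transpose =
  bounded_linear.has_vector_derivative[OF bounded_linear_transpose]
lemmas tendsto_matrix_mul =
  bounded_bilinear.tendsto[OF bounded_bilinear_matrix_mul]
lemmas continuous_on_matrix_mul =
  bounded_bilinear.continuous_on[OF bounded_bilinear_matrix_mul]
lemma trace_inner: "trace (transpose A ** B) = A \<bullet> (B :: real^'m^'n)"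
  unfolding trace_def matrix_matrix_mult_def transpose_def inner_vec_def
  by simp (rule sum.swap)

lemma has_vector_derivative_matrixI:
  fixes f :: "real \<Rightarrow> real^'m^'n"
  assumes "\<And>i j. ((\<lambda>t. f t $ i $ j) has_vector_derivative f' $ i $ j) (at t)"
  shows "(f has_vector_derivative f') (at t)"
  using assms unfolding has_vector_derivative_def
  by (auto simp: has_derivative_componentwise_within[where 'b="real^'m^'n"] Basis_vec_def
      inner_axis simp del: has_derivative_componentwise_within)

section \<open>Smooth maps\<close>

lemma Ck_on_cong:
  assumes "open S" and "\<And>x. x \<in> S \<Longrightarrow> f x = g x" and "Ck_on k S f"
  shows "Ck_on k S g"
  using assms(2,3)
proof (induction k arbitrary: f g)
  case 0
  then show ?case using continuous_on_cong by (metis Ck_on.simps(1))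
next
  case (Suc k)
  have *: "(g has_derivative frechet_derivative f (at x)) (at x)" if "x \<in> S" for x
  proof (rule has_derivative_transform_within_open[OF _ assms(1) that])
    show "(f has_derivative frechet_derivative f (at x)) (at x)"
      using Suc.prems that by (simp add: frechet_derivative_works[symmetric])
  qed (use Suc.prems in auto)
  then have "frechet_derivative f (at x) = frechet_derivative g (at x)" if "x \<in> S" for x
    using frechet_derivative_at that by blast
  then have "Ck_on k S (\<lambda>x. frechet_derivative g (at x) v)" for v
    using Suc.IH[of "\<lambda>x. frechet_derivative f (at x) v"] Suc.prems(2) by simp
  then show ?case using * by (auto simp: differentiable_def)
qed

text \<open>The recursion of \<^const>\<open>Ck_on\<close> with any representative of the derivative in place of
  \<^const>\<open>frechet_derivative\<close>.\<close>

lemma Ck_on_SucI: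
  assumes "open S" and "\<And>x. x \<in> S \<Longrightarrow> (f has_derivative f' x) (at x)"
    and "\<And>v. Ck_on k S (\<lambda>x. f' x v)"
  shows "Ck_on (Suc k) S f"
proof -
  have "frechet_derivative f (at x) = f' x" if "x \<in> S" for x
    using frechet_derivative_at[OF assms(2)[OF that]] by simp
  then have "Ck_on k S (\<lambda>x. frechet_derivative f (at x) v)" for v
    using Ck_on_cong[OF assms(1) _ assms(3)[of v]] by simp
  then show ?thesis using assms(2) by (auto simp: differentiable_def)
qed

lemma Ck_on_SucD: "Ck_on (Suc k) S f \<Longrightarrow> Ck_on k S f"
proof (induction k arbitrary: f)
  case 0
  then show ?case
    by (auto simp: continuous_on_eq_continuous_within
        intro: differentiable_imp_continuous_within differentiable_at_withinI)
next
  case (Suc k)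
  then show ?case by (metis Ck_on.simps(2))
qed

lemma Ck_on_has_derivative:
  "Ck_on (Suc k) S f \<Longrightarrow> x \<in> S \<Longrightarrow> (f has_derivative frechet_derivative f (at x)) (at x)"
  by (simp add: frechet_derivative_works[symmetric])

lemma Ck_on_const: "open S \<Longrightarrow> Ck_on k S (\<lambda>x. c)"
proof (induction k arbitrary: c)
  case (Suc k)
  show ?case
    by (rule Ck_on_SucI[where f' = "\<lambda>x v. 0"]) (use Suc in auto)
qed simp

lemma Ck_on_bounded_linear:
  assumes "open S" "bounded_linear L"
  shows "Ck_on k S f \<Longrightarrow> Ck_on k S (\<lambda>x. L (f x))"
proof (induction k arbitrary: f)
  case 0
  then show ?case using bounded_linear.continuous_on[OF assms(2)] by simp
next
  case (Suc k)
  show ?case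
  proof (rule Ck_on_SucI[OF assms(1)])
    show "((\<lambda>x. L (f x)) has_derivative (\<lambda>v. L (frechet_derivative f (at x) v))) (at x)"
      if "x \<in> S" for x
      by (rule bounded_linear.has_derivative[OF assms(2) Ck_on_has_derivative[OF Suc.prems that]])
  qed (use Suc in auto)
qed

lemma Ck_on_add:
  assumes "open S"
  shows "Ck_on k S f \<Longrightarrow> Ck_on k S g \<Longrightarrow> Ck_on k S (\<lambda>x. f x + g x)"
proof (induction k arbitrary: f g)
  case 0
  then show ?case by (simp add: continuous_on_add)
next
  case (Suc k)
  show ?case
  proof (rule Ck_on_SucI[OF assms])
    show "((\<lambda>x. f x + g x) has_derivative
        (\<lambda>w. frechet_derivative f (at x) w + frechet_derivative g (at x) w)) (at x)" if "x \<in> S" for x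
      using Suc.prems that by (intro has_derivative_add Ck_on_has_derivative)
  qed (use Suc in auto)
qed

lemma Ck_on_bilinear:
  assumes S: "open S" and b: "bounded_bilinear b"
  shows "Ck_on k S f \<Longrightarrow> Ck_on k S g \<Longrightarrow> Ck_on k S (\<lambda>x. b (f x) (g x))"
proof (induction k arbitrary: f g)
  case 0
  then show ?case using bounded_bilinear.continuous_on[OF b] by simp
next
  case (Suc k)
  show ?case
  proof (rule Ck_on_SucI[OF S])
    show "((\<lambda>x. b (f x) (g x)) has_derivative
        (\<lambda>v. b (f x) (frechet_derivative g (at x) v) + b (frechet_derivative f (at x) v) (g x))) (at x)"
      if "x \<in> S" for x
      by (rule bounded_bilinear.FDERIV[OF b]) (use Suc.prems that in \<open>auto intro: Ck_on_has_derivative\<close>)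
    show "Ck_on k S (\<lambda>x. b (f x) (frechet_derivative g (at x) v) + b (frechet_derivative f (at x) v) (g x))"
      for v
    proof (rule Ck_on_add[OF S])
      show "Ck_on k S (\<lambda>x. b (f x) (frechet_derivative g (at x) v))"
        using Suc.IH[OF Ck_on_SucD[OF Suc.prems(1)]] Suc.prems(2) by simp
      show "Ck_on k S (\<lambda>x. b (frechet_derivative f (at x) v) (g x))"
        using Suc.IH[OF _ Ck_on_SucD[OF Suc.prems(2)]] Suc.prems(1) by simp
    qed
  qed
qed

lemma smooth_on_const: "open S \<Longrightarrow> smooth_on S (\<lambda>x. c)"
  by (simp add: smooth_on_def Ck_on_const)

lemma smooth_on_linear_image:
  "open S \<Longrightarrow> bounded_linear L \<Longrightarrow> smooth_on S f \<Longrightarrow> smooth_on S (\<lambda>x. L (f x))"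
  by (simp add: smooth_on_def Ck_on_bounded_linear)

lemma smooth_on_matrix_mul:
  fixes f :: "'a::real_normed_vector \<Rightarrow> real^'m^'n" and g :: "'a \<Rightarrow> real^'k^'m"
  shows "open S \<Longrightarrow> smooth_on S f \<Longrightarrow> smooth_on S g \<Longrightarrow> smooth_on S (\<lambda>x. f x ** g x)"
  by (simp add: smooth_on_def Ck_on_bilinear[OF _ bounded_bilinear_matrix_mul])

lemma smooth_on_transpose:
  fixes f :: "'a::real_normed_vector \<Rightarrow> real^'m^'n"
  shows "open S \<Longrightarrow> smooth_on S f \<Longrightarrow> smooth_on S (\<lambda>x. transpose (f x))"
  by (rule smooth_on_linear_image[OF _ bounded_linear_transpose])

lemma smooth_on_bounded_linear:
  assumes "open S" "bounded_linear L"
  shows "smooth_on S L"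
  unfolding smooth_on_def
proof
  fix k
  show "Ck_on k S L"
  proof (cases k)
    case 0
    then show ?thesis using assms by (simp add: linear_continuous_on)
  next
    case (Suc j)
    show ?thesis unfolding Suc
      by (rule Ck_on_SucI[where f' = "\<lambda>x. L"])
         (use assms in \<open>auto intro: Ck_on_const bounded_linear_imp_has_derivative\<close>)
  qed
qed

text \<open>Derivatives of a solution of a linear differential equation are again linear images of the
  solution, so no further regularity has to be supplied.\<close>

lemma smooth_on_linear_ode:
  fixes f :: "real \<Rightarrow> 'a::real_normed_vector"
  assumes "bounded_linear L" "\<And>t. (f has_vector_derivative L (f t)) (at t)"
  shows "smooth_on UNIV f"
  unfolding smooth_on_def
proof
  fix k
  show "Ck_on k UNIV f"
  proof (induction k)
    case 0
    show ?case
      using assms(2) by (auto intro: continuous_at_imp_continuous_on has_vector_derivative_continuous)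
  next
    case (Suc k)
    show ?case
    proof (rule Ck_on_SucI)
      show "(f has_derivative (\<lambda>h. h *\<^sub>R L (f t))) (at t)" for t
        using assms(2) by (simp add: has_vector_derivative_def)
      have "bounded_linear (\<lambda>x. v *\<^sub>R L x)" for v
        using bounded_linear_compose[OF bounded_linear_scaleR_right assms(1)] .
      then show "Ck_on k UNIV (\<lambda>t. v *\<^sub>R L (f t))" for v
        using Ck_on_bounded_linear Suc by blast
    qed simp
  qed
qed

lemma smooth_on_add:
  "open S \<Longrightarrow> smooth_on S f \<Longrightarrow> smooth_on S g \<Longrightarrow> smooth_on S (\<lambda>x. f x + g x)"
  by (simp add: smooth_on_def Ck_on_add)

lemma smooth_on_imp_has_derivative:
  "smooth_on S f \<Longrightarrow> x \<in> S \<Longrightarrow> (f has_derivative frechet_derivative f (at x)) (at x)"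
  using Ck_on_has_derivative[of 0 S f] by (auto simp: smooth_on_def)

lemma smooth_on_frechet_derivative: "smooth_on S f \<Longrightarrow> smooth_on S (\<lambda>x. frechet_derivative f (at x) v)"
  by (metis Ck_on.simps(2) smooth_on_def)

lemma smooth_on_imp_continuous_on: "smooth_on S f \<Longrightarrow> continuous_on S f"
  by (metis Ck_on.simps(1) smooth_on_def)

section \<open>The matrix exponential\<close>

abbreviation matrix_pow :: "real^'n^'n \<Rightarrow> nat \<Rightarrow> real^'n^'n" where
  "matrix_pow A i \<equiv> ((**) A ^^ i) (mat 1)"

lemma matrix_pow_scaleR: "matrix_pow (t *\<^sub>R A) i = t ^ i *\<^sub>R matrix_pow A i"
  by (induction i) (simp_all add: matrix_distribs)

lemma matrix_pow_commute: "matrix_pow A i ** A = A ** matrix_pow A i"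
  by (induction i) (simp_all add: matrix_mul_assoc[symmetric])

lemma matrix_pow_bound:
  fixes A :: "real^'n^'n"
  shows "\<exists>K\<ge>0. \<exists>C\<ge>0. \<forall>i. norm (matrix_pow A i) \<le> C * K ^ i"
proof -
  obtain K where K: "K > 0" "\<And>(A::real^'n^'n) (B::real^'n^'n). norm (A ** B) \<le> norm A * norm B * K"
    using bounded_bilinear.pos_bounded[OF bounded_bilinear_matrix_mul] by blast
  have "norm (matrix_pow A i) \<le> norm (mat 1 :: real^'n^'n) * (norm A * K) ^ i" for i
  proof (induction i)
    case (Suc i)
    have "norm (matrix_pow A (Suc i)) \<le> (norm A * K) * norm (matrix_pow A i)"
      using K(2)[of A "matrix_pow A i"] by (simp add: mult_ac)
    also have "\<dots> \<le> (norm A * K) * (norm (mat 1 :: real^'n^'n) * (norm A * K) ^ i)"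
      using Suc K(1) by (intro mult_left_mono) auto
    finally show ?case by (simp add: mult_ac)
  qed simp
  then show ?thesis using K(1) by (intro exI[of _ "norm A * K"] conjI exI[of _ "norm (mat 1 :: real^'n^'n)"]) auto
qed

lemma summable_matrix_exp: "summable (\<lambda>i. (1 / fact i) *\<^sub>R matrix_pow A i)"
proof -
  obtain K C where KC: "K \<ge> 0" "C \<ge> 0" "\<And>i. norm (matrix_pow A i) \<le> C * K ^ i"
    using matrix_pow_bound by metis
  show ?thesis
  proof (rule summable_comparison_test')
    show "summable (\<lambda>i. C * (inverse (fact i) * K ^ i))"
      by (intro summable_mult summable_exp)
    show "norm ((1 / fact i) *\<^sub>R matrix_pow A i) \<le> C * (inverse (fact i) * K ^ i)" for i
      using KC(3)[of i] by (simp add: field_simps)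
  qed
qed

lemma matrix_exp_commute: "matrix_exp A ** A = A ** matrix_exp A"
proof -
  have 1: "bounded_linear (\<lambda>X. X ** A)" and 2: "bounded_linear (\<lambda>X. A ** X)"
    using bounded_bilinear.bounded_linear_left[OF bounded_bilinear_matrix_mul]
      bounded_bilinear.bounded_linear_right[OF bounded_bilinear_matrix_mul] by auto
  show ?thesis
    unfolding matrix_exp_def bounded_linear.suminf[OF 1 summable_matrix_exp]
      bounded_linear.suminf[OF 2 summable_matrix_exp]
    by (simp add: matrix_distribs matrix_pow_commute)
qed

lemma matrix_exp_zero [simp]: "matrix_exp (0 :: real^'n^'n) = mat 1"
proof -
  have "(\<lambda>i. (1 / fact i) *\<^sub>R matrix_pow (0::real^'n^'n) i) = (\<lambda>i. if i = 0 then mat 1 else 0)"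
  proof
    fix i
    show "(1 / fact i) *\<^sub>R matrix_pow (0::real^'n^'n) i = (if i = 0 then mat 1 else 0)"
      by (cases i) auto
  qed
  then show ?thesis unfolding matrix_exp_def
    using sums_unique[OF sums_single[of 0 "\<lambda>i. mat 1 :: real^'n^'n"]] by simp
qed

lemma matrix_exp_transpose: "transpose (matrix_exp A) = matrix_exp (transpose A)"
proof -
  have "transpose (matrix_pow A i) = matrix_pow (transpose A) i" for i
    by (induction i) (simp_all add: transpose_simps matrix_pow_commute)
  then show ?thesis
    unfolding matrix_exp_def
    by (simp add: bounded_linear.suminf[OF bounded_linear_transpose summable_matrix_exp] transpose_simps)
qed

text \<open>The entries of \<open>t \<mapsto> exp (t A)\<close> are power series in \<open>t\<close>, so they may be differentiated term by term.\<close>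

lemma matrix_exp_has_vector_derivative:
  fixes A :: "real^'n^'n"
  shows "((\<lambda>t. matrix_exp (t *\<^sub>R A)) has_vector_derivative A ** matrix_exp (t *\<^sub>R A)) (at t)"
proof -
  have entry: "matrix_exp (t *\<^sub>R B) $ i $ j = (\<Sum>n. (matrix_pow B n $ i $ j / fact n) * t ^ n)"
    "summable (\<lambda>n. (matrix_pow B n $ i $ j / fact n) * t ^ n)" for B :: "real^'n^'n" and t i j
  proof -
    have bl: "bounded_linear (\<lambda>X :: real^'n^'n. X $ i $ j)"
      by (intro bounded_linear_compose[OF bounded_linear_vec_nth bounded_linear_vec_nth])
    have "(\<lambda>n. ((1 / fact n) *\<^sub>R matrix_pow (t *\<^sub>R B) n) $ i $ j)
        = (\<lambda>n. (matrix_pow B n $ i $ j / fact n) * t ^ n)"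
      unfolding matrix_pow_scaleR by (simp add: mult_ac)
    then show "matrix_exp (t *\<^sub>R B) $ i $ j = (\<Sum>n. (matrix_pow B n $ i $ j / fact n) * t ^ n)"
      "summable (\<lambda>n. (matrix_pow B n $ i $ j / fact n) * t ^ n)"
      unfolding matrix_exp_def bounded_linear.suminf[OF bl summable_matrix_exp]
      using bounded_linear.summable[OF bl summable_matrix_exp[of "t *\<^sub>R B"]] by simp_all
  qed
  have deriv: "((\<lambda>t. matrix_exp (t *\<^sub>R A) $ i $ j) has_vector_derivative
      (A ** matrix_exp (t *\<^sub>R A)) $ i $ j) (at t)" for i j
  proof -
    let ?c = "\<lambda>n. matrix_pow A n $ i $ j / fact n"
    have "((\<lambda>t. \<Sum>n. ?c n * t ^ n) has_field_derivative (\<Sum>n. diffs ?c n * t ^ n)) (at t)"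
      by (rule termdiffs_strong_converges_everywhere) (rule entry(2))
    moreover have "(\<Sum>n. diffs ?c n * t ^ n) = (A ** matrix_exp (t *\<^sub>R A)) $ i $ j"
    proof -
      have dn: "diffs ?c n * t ^ n = (\<Sum>l\<in>UNIV. A $ i $ l * ((matrix_pow A n $ l $ j / fact n) * t ^ n))" for n
      proof -
        have "diffs ?c n = (A ** matrix_pow A n) $ i $ j / fact n"
          by (simp add: diffs_def field_simps del: of_nat_Suc)
        then show ?thesis
          unfolding matrix_matrix_mult_def by (simp add: sum_divide_distrib sum_distrib_right mult.assoc)
      qed
      have "(\<Sum>n. diffs ?c n * t ^ n)
          = (\<Sum>l\<in>UNIV. \<Sum>n. A $ i $ l * ((matrix_pow A n $ l $ j / fact n) * t ^ n))"
        by (simp only: dn) (rule suminf_sum, rule summable_mult, rule entry(2))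
      also have "\<dots> = (\<Sum>l\<in>UNIV. A $ i $ l * matrix_exp (t *\<^sub>R A) $ l $ j)"
        by (intro sum.cong refl) (simp only: entry(1) suminf_mult[OF entry(2)])
      finally show ?thesis by (simp add: matrix_matrix_mult_def)
    qed
    ultimately show ?thesis
      by (simp add: entry(1)[abs_def] has_real_derivative_iff_has_vector_derivative)
  qed
  show ?thesis by (rule has_vector_derivative_matrixI) (rule deriv)
qed

lemma matrix_exp_scaleR_commute: "matrix_exp (s *\<^sub>R A) ** A = A ** matrix_exp (s *\<^sub>R A)"
  using matrix_exp_commute[of "s *\<^sub>R A"] by (cases "s = 0") (auto simp: matrix_distribs)

text \<open>The product \<open>exp (r A) exp ((c - r) A)\<close> does not depend on \<open>r\<close>.\<close>

lemma matrix_exp_add: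
  fixes A :: "real^'n^'n"
  shows "matrix_exp ((s + t) *\<^sub>R A) = matrix_exp (s *\<^sub>R A) ** matrix_exp (t *\<^sub>R A)"
proof -
  let ?f = "\<lambda>r. matrix_exp (r *\<^sub>R A) ** matrix_exp ((s + t - r) *\<^sub>R A)"
  have d: "((\<lambda>r. matrix_exp ((s + t - r) *\<^sub>R A)) has_vector_derivative
      - (A ** matrix_exp ((s + t - r) *\<^sub>R A))) (at r)" for r
  proof -
    have "((\<lambda>r. s + t - r) has_vector_derivative - 1) (at r)" by (auto intro!: derivative_eq_intros)
    from vector_diff_chain_at[OF this matrix_exp_has_vector_derivative[of A "s + t - r"]]
    show ?thesis by (simp add: o_def)
  qed
  have "(?f has_vector_derivative 0) (at r)" for r
    by (rule has_vector_derivative_eq_rhs[OF has_vector_derivative_matrix_mul[OF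
          matrix_exp_has_vector_derivative d]])
       (simp only: matrix_distribs matrix_mul_assoc matrix_exp_scaleR_commute add.left_inverse)
  then obtain c where c: "\<And>r. ?f r = c"
    using has_vector_derivative_zero_constant[of UNIV ?f] by auto
  show ?thesis using c[of 0] c[of s] by simp
qed

lemma matrix_exp_inverse: "matrix_exp (t *\<^sub>R A) ** matrix_exp (- t *\<^sub>R A) = mat 1"
  using matrix_exp_add[of t "- t" A] by simp

section \<open>Symmetric and positive definite matrices\<close>

(* keeps products with a transpose in the form needed for associativity *)
declare transpose_matrix_vector [simp del]

lemma matrix_mul_reassoc: "X ** Y = Z \<Longrightarrow> X ** (Y ** V) = Z ** V"
  by (metis matrix_mul_assoc)

lemma inner_transpose_matrix_vector: "x \<bullet> (A *v y) = (transpose A *v x) \<bullet> (y :: real^'m)"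
  for A :: "real^'m^'n"
  by (metis dot_lmul_matrix transpose_matrix_vector)

lemma quadratic_nonneg_imp_linear_zero:
  fixes b c :: real
  assumes "\<And>t. 0 \<le> t * b + t\<^sup>2 * c"
  shows "b = 0"
proof (rule ccontr)
  assume b: "b \<noteq> 0"
  define m where "m = \<bar>c\<bar> + 1"
  have m: "m > 0" "c < m" by (auto simp: m_def)
  have "(- b / m) * b + (- b / m)\<^sup>2 * c = b\<^sup>2 * (c - m) / m\<^sup>2"
    using m by (simp add: field_simps power2_eq_square)
  also have "\<dots> < 0" using b m by (simp add: divide_less_0_iff mult_less_0_iff)
  finally show False using assms[of "- b / m"] by simp
qed

text \<open>A maximizer of the Rayleigh quotient on an invariant subspace is an eigenvector, and its
  orthogonal complement in the subspace is again invariant.\<close>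

lemma selfadjoint_orthonormal_eigenbasis:
  fixes f :: "'a::euclidean_space \<Rightarrow> 'a"
  assumes f: "linear f" and sa: "\<And>x y. f x \<bullet> y = x \<bullet> f y"
  shows "subspace V \<Longrightarrow> f ` V \<subseteq> V \<Longrightarrow>
    \<exists>B. B \<subseteq> V \<and> pairwise orthogonal B \<and> (\<forall>b\<in>B. norm b = 1) \<and> span B = V \<and>
        (\<forall>b\<in>B. \<exists>l. f b = l *\<^sub>R b)"
proof (induction "dim V" arbitrary: V rule: less_induct)
  case less
  show ?case
  proof (cases "V \<subseteq> {0}")
    case True
    then have "V = {0}" using less.prems subspace_0 by auto
    then show ?thesis by (intro exI[of _ "{}"]) auto
  next
    case False
    let ?S = "V \<inter> sphere 0 1"
    obtain w where w: "w \<in> V" "w \<noteq> 0" using False by auto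
    then have "(1 / norm w) *\<^sub>R w \<in> ?S" using less.prems(1) by (simp add: subspace_scale)
    then have "?S \<noteq> {}" by blast
    moreover have "compact ?S"
      by (simp add: closed_Int_compact closed_subspace less.prems(1))
    moreover have "continuous_on ?S (\<lambda>x. x \<bullet> f x)"
      using f by (intro continuous_intros linear_continuous_on linear_conv_bounded_linear[THEN iffD1])
    ultimately obtain v where v: "v \<in> ?S" and max: "\<And>y. y \<in> ?S \<Longrightarrow> y \<bullet> f y \<le> v \<bullet> f v"
      using continuous_attains_sup[of ?S "\<lambda>x. x \<bullet> f x"] by blast
    define l where "l = v \<bullet> f v"
    have le: "u \<bullet> f u \<le> l * (u \<bullet> u)" if "u \<in> V" for u
    proof (cases "u = 0")
      case True
      then show ?thesis using f by (simp add: linear_0)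
    next
      case False
      have "(1 / norm u) *\<^sub>R u \<in> ?S"
        using False that less.prems(1) by (simp add: subspace_scale)
      from max[OF this] False show ?thesis
        unfolding l_def by (simp add: linear_scale[OF f] field_simps power2_norm_eq_inner[symmetric] power2_eq_square)
    qed
    have vv: "v \<in> V" "v \<bullet> v = 1" using v by (auto simp: norm_eq_1)
    have orth: "y \<bullet> f v = 0" if y: "y \<in> V" "y \<bullet> v = 0" for y
    proof -
      have "0 \<le> t * (- 2 * (y \<bullet> f v)) + t\<^sup>2 * (l * (y \<bullet> y) - y \<bullet> f y)" for t
      proof -
        have "v + t *\<^sub>R y \<in> V" using y vv less.prems(1) by (simp add: subspace_add subspace_scale)
        from le[OF this] show ?thesis
          using y(2) vv(2) sa[of v y] unfolding l_def
          by (simp add: linear_add[OF f] linear_scale[OF f] inner_simps power2_eq_square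
              inner_commute algebra_simps)
      qed
      then show ?thesis using quadratic_nonneg_imp_linear_zero by fastforce
    qed
    have eig: "f v = l *\<^sub>R v"
    proof -
      let ?y = "f v - l *\<^sub>R v"
      have yV: "?y \<in> V" using less.prems vv by (auto simp: subspace_diff subspace_scale)
      have yv: "?y \<bullet> v = 0" using vv by (simp add: inner_simps l_def inner_commute)
      have "?y \<bullet> ?y = ?y \<bullet> f v - l * (?y \<bullet> v)" by (simp add: inner_simps)
      also have "\<dots> = 0" using orth[OF yV yv] yv by simp
      finally show ?thesis by simp
    qed
    define V' where "V' = {y \<in> V. y \<bullet> v = 0}"
    have sub: "subspace V'"
      using less.prems(1) unfolding V'_def subspace_def by (auto simp: inner_simps)
    have inv: "f ` V' \<subseteq> V'"
      using less.prems(2) eig by (auto simp: V'_def sa)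
    have "v \<notin> V'" "V' \<subseteq> V" using vv by (simp_all add: V'_def)
    then have "V' \<subset> V" using vv(1) by blast
    then have "dim V' < dim V"
      using sub less.prems(1) by (metis dim_subset less_le subspace_dim_equal psubsetE order_refl)
    from less.hyps[OF this sub inv] obtain B where B: "B \<subseteq> V'" "pairwise orthogonal B"
      "\<forall>b\<in>B. norm b = 1" "span B = V'" "\<forall>b\<in>B. \<exists>l. f b = l *\<^sub>R b" by blast
    have "span (insert v B) = V"
    proof
      show "span (insert v B) \<subseteq> V"
        using B(1) vv less.prems(1) by (intro span_minimal) (auto simp: V'_def)
      show "V \<subseteq> span (insert v B)"
      proof
        fix x assume x: "x \<in> V"
        have "x - (x \<bullet> v) *\<^sub>R v \<in> V'"
          using x vv less.prems(1) by (simp add: V'_def subspace_diff subspace_scale inner_simps)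
        then show "x \<in> span (insert v B)" using B(4) by (auto simp: span_insert)
      qed
    qed
    moreover have "pairwise orthogonal (insert v B)"
      using B(1,2) by (auto simp: pairwise_insert V'_def orthogonal_def inner_commute)
    ultimately show ?thesis
      using B vv eig by (intro exI[of _ "insert v B"]) (auto simp: V'_def norm_eq_1)
  qed
qed

lemma ex_stiefel_columns:
  fixes B :: "(real^'n) set"
  assumes B: "pairwise orthogonal B" "\<forall>b\<in>B. norm b = 1" and card: "card B = CARD('p::finite)"
  shows "\<exists>U :: real^'p^'n. U \<in> stiefel \<and> range (\<lambda>j. column j U) = B"
proof -
  have "finite B" using card by (metis card.infinite zero_less_card_finite less_irrefl)
  then obtain f :: "'p \<Rightarrow> real^'n" where f: "bij_betw f UNIV B"
    using finite_same_card_bij[of "UNIV :: 'p set" B] card by auto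
  let ?U = "(\<chi> i j. f j $ i) :: real^'p^'n"
  have col: "column j ?U = f j" for j by (simp add: column_def vec_eq_iff)
  have "f i \<bullet> f j = (if i = j then 1 else 0)" for i j
  proof (cases "i = j")
    case True
    have "f j \<in> B" using f by (auto simp: bij_betw_def)
    then show ?thesis using True B(2) by (simp add: norm_eq_1)
  next
    case False
    then have "f i \<noteq> f j" "f i \<in> B" "f j \<in> B" using f by (auto simp: bij_betw_def inj_def)
    then show ?thesis using B(1) False by (simp add: pairwise_def orthogonal_def)
  qed
  then have "?U \<in> stiefel"
    by (simp add: stiefel_def matrix_mult_transpose_dot_column col mat_def vec_eq_iff)
  moreover have "range (\<lambda>j. column j ?U) = B" using f by (simp add: col bij_betw_def)
  ultimately show ?thesis by blast
qed

lemma range_matrix_eq_span_columns: "range ((*v) A) = span (columns (A :: real^'m^'n))"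
proof
  show "range ((*v) A) \<subseteq> span (columns A)"
    using matrix_vector_mult_in_columnspace by blast
  have "subspace (range ((*v) A))"
    by (rule linear_subspace_image) (auto simp: subspace_UNIV)
  then show "span (columns A) \<subseteq> range ((*v) A)"
    by (intro span_minimal) (auto simp: columns_image_basis)
qed

lemma ex_stiefel_range:
  fixes V :: "(real^'n) set"
  assumes "subspace V" "dim V = CARD('p::finite)"
  shows "\<exists>U :: real^'p^'n. U \<in> stiefel \<and> range ((*v) U) = V"
proof -
  obtain B where B: "B \<subseteq> V" "pairwise orthogonal B" "\<And>x. x \<in> B \<Longrightarrow> norm x = 1"
    "independent B" "card B = dim V" "span B = V"
    using orthonormal_basis_subspace[OF assms(1)] by metis
  then obtain U :: "real^'p^'n" where U: "U \<in> stiefel" "range (\<lambda>j. column j U) = B"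
    using ex_stiefel_columns[of B] assms(2) by metis
  have "columns U = B" using U(2) by (auto simp: columns_def)
  then have "range ((*v) U) = V"
    using B(6) by (simp add: range_matrix_eq_span_columns)
  then show ?thesis using U(1) by blast
qed

lemma stiefelD: "U \<in> stiefel \<Longrightarrow> transpose U ** U = mat 1"
  by (simp add: stiefel_def)


lemma norm_stiefel_vector: "U \<in> stiefel \<Longrightarrow> norm (U *v z) = norm z"
  for U :: "real^'p^'n"
  by (simp add: norm_eq_sqrt_inner inner_transpose_matrix_vector matrix_vector_mul_assoc stiefelD)

lemma stiefel_projector_range: "U \<in> stiefel \<Longrightarrow> x \<in> range ((*v) U) \<Longrightarrow> (U ** transpose U) *v x = x"
  for U :: "real^'p^'n"
  by (auto simp: matrix_vector_mul_assoc stiefelD matrix_mul_assoc[symmetric])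

lemma stiefel_projector_absorb:
  fixes U :: "real^'p^'n" and A :: "real^'m^'n"
  assumes "U \<in> stiefel" "range ((*v) A) \<subseteq> range ((*v) U)"
  shows "U ** (transpose U ** A) = A"
proof -
  have "(U ** transpose U) *v (A *v x) = A *v x" for x
    using assms by (intro stiefel_projector_range) auto
  then show ?thesis by (simp add: matrix_eq matrix_vector_mul_assoc matrix_mul_assoc)
qed

text \<open>An orthonormal basis of the orthogonal complement of the range.\<close>

lemma ex_stiefel_complement:
  fixes U :: "real^'p^'n"
  assumes U: "U \<in> stiefel" and card: "CARD('p) < CARD('n)"
  shows "\<exists>V :: real^('n, 'p) codim^'n. V \<in> stiefel \<and> transpose U ** V = 0 \<and> transpose V ** U = 0 \<and>
    U ** transpose U + V ** transpose V = mat 1"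
proof -
  let ?R = "range ((*v) U)"
  have sR: "subspace ?R" by (rule linear_subspace_image) (auto simp: subspace_UNIV)
  have "inj ((*v) U)"
  proof (rule injI)
    fix x y assume "U *v x = U *v y"
    then have "norm (U *v (x - y)) = 0" by (simp add: matrix_vector_mult_diff_distrib)
    then show "x = y" by (simp add: norm_stiefel_vector[OF U])
  qed
  then have dR: "dim ?R = CARD('p)"
    using full_rank_injective[of U] rank_dim_range[of U] by simp
  let ?N = "{y :: real^'n. \<forall>x\<in>?R. orthogonal x y}"
  have sN: "subspace ?N"
    by (auto simp: subspace_def orthogonal_def inner_simps)
  have "dim {y \<in> UNIV. \<forall>x\<in>?R. orthogonal x y} + dim ?R = dim (UNIV :: (real^'n) set)"
    by (rule dim_subspace_orthogonal_to_vectors) (use sR in auto)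
  then have "dim ?N = CARD(('n, 'p) codim)"
    using dR card by (simp add: card_codim)
  then obtain V :: "real^('n, 'p) codim^'n" where V: "V \<in> stiefel" "range ((*v) V) = ?N"
    using ex_stiefel_range[OF sN] by blast
  have UV: "transpose U ** V = 0"
  proof -
    have "(transpose U ** V) *v x = 0" for x
    proof -
      have "V *v x \<in> ?N" using V(2) by blast
      then have "y \<bullet> (transpose U *v (V *v x)) = 0" for y
        by (auto simp: orthogonal_def inner_transpose_matrix_vector)
      then show ?thesis by (metis inner_eq_zero_iff matrix_vector_mul_assoc)
    qed
    then show ?thesis by (simp add: matrix_eq)
  qed
  have VU: "transpose V ** U = 0"
    using arg_cong[OF UV, of transpose] by (simp add: transpose_simps)
  have "(U ** transpose U + V ** transpose V) *v x = x" for x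
  proof -
    let ?y = "x - U *v (transpose U *v x)"
    have "transpose U *v ?y = 0"
      by (simp add: matrix_vector_mult_diff_distrib matrix_vector_mul_assoc matrix_mul_assoc stiefelD[OF U])
    then have "?y \<in> range ((*v) V)"
      unfolding V(2) by (auto simp: orthogonal_def inner_commute[of "U *v _"] inner_transpose_matrix_vector)
    from stiefel_projector_range[OF V(1) this]
    have "V *v (transpose V *v ?y) = ?y" by (simp add: matrix_vector_mul_assoc)
    moreover have "transpose V *v ?y = transpose V *v x"
      using VU by (simp add: matrix_vector_mult_diff_distrib matrix_vector_mul_assoc matrix_mul_assoc)
    ultimately have "V *v (transpose V *v x) = ?y" by simp
    then show ?thesis
      by (simp add: matrix_vector_mult_add_rdistrib matrix_vector_mul_assoc[symmetric])
  qed
  then have "U ** transpose U + V ** transpose V = mat 1" by (simp add: matrix_eq)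
  then show ?thesis using V(1) UV VU by blast
qed

lemma matrix_inv_spd:
  assumes "S \<in> spd_matrices"
  shows "S ** matrix_inv S = mat 1" "matrix_inv S ** S = mat 1" "transpose (matrix_inv S) = matrix_inv S"
proof -
  have "\<forall>x. S *v x = 0 \<longrightarrow> x = 0"
    using assms by (auto simp: spd_matrices_def)
  then have "invertible S" 
    using matrix_left_invertible_ker[of S] by (meson invertible_left_inverse)
  then show 1: "S ** matrix_inv S = mat 1" "matrix_inv S ** S = mat 1"
    unfolding invertible_def matrix_inv_def by (metis (mono_tags, lifting) someI_ex)+
  have "transpose (matrix_inv S) ** S = mat 1"
    using arg_cong[OF 1(1), of transpose] assms
    by (simp add: transpose_simps spd_matrices_def sym_matrices_def)
  then show "transpose (matrix_inv S) = matrix_inv S"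
    by (metis 1(1) matrix_mul_assoc matrix_mul_lid matrix_mul_rid)
qed

lemma matrix_inv_unique: "A ** B = mat 1 \<Longrightarrow> matrix_inv A = B" for A :: "real^'n^'n"
proof -
  assume 1: "A ** B = mat 1"
  then have 2: "B ** A = mat 1" by (simp add: matrix_left_right_inverse)
  have "A ** matrix_inv A = mat 1 \<and> matrix_inv A ** A = mat 1"
    unfolding matrix_inv_def using 1 2 by (metis (mono_tags, lifting) someI_ex)
  then show ?thesis by (metis 2 matrix_mul_assoc matrix_mul_lid matrix_mul_rid)
qed

lemma spd_transpose: "S \<in> spd_matrices \<Longrightarrow> transpose S = S"
  by (simp add: spd_matrices_def sym_matrices_def)

lemma spd_congruence:
  fixes S G :: "real^'p^'p"
  assumes "S \<in> spd_matrices" "H ** G = mat 1"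
  shows "transpose G ** S ** G \<in> spd_matrices"
proof -
  have "G *v x \<noteq> 0" if "x \<noteq> 0" for x
    using assms(2) that by (metis matrix_vector_mul_assoc matrix_vector_mul_lid matrix_vector_mult_0_right)
  then show ?thesis
    using assms(1) unfolding spd_matrices_def sym_matrices_def
    by (auto simp: transpose_simps matrix_mul_assoc[symmetric] matrix_vector_mul_assoc[symmetric]
        inner_transpose_matrix_vector[of _ "transpose G"])
qed

text \<open>The left inverse \<open>H\<close> recovers \<open>S\<close> by compression, so the rank cannot drop.\<close>

lemma conj_in_psd_rank:
  fixes U :: "real^'p^'n"
  assumes U: "H ** U = mat 1" and S: "S \<in> spd_matrices"
  shows "U ** S ** transpose U \<in> psd_rank CARD('p)"
proof -
  have "0 \<le> x \<bullet> ((U ** S ** transpose U) *v x)" for x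
  proof -
    have "x \<bullet> ((U ** S ** transpose U) *v x) = (transpose U *v x) \<bullet> (S *v (transpose U *v x))"
      by (simp add: matrix_vector_mul_assoc[symmetric] inner_transpose_matrix_vector[of x U])
    then show ?thesis using S unfolding spd_matrices_def
      by (cases "transpose U *v x = 0") (auto intro: less_imp_le)
  qed
  moreover have "rank (U ** S ** transpose U) = CARD('p)"
  proof (rule antisym)
    have "rank (U ** S ** transpose U) \<le> rank U"
      by (metis matrix_mul_assoc rank_mul_le_left)
    also have "\<dots> \<le> CARD('p)" using rank_bound[of U] by simp
    finally show "rank (U ** S ** transpose U) \<le> CARD('p)" .
    have Ut: "transpose U ** transpose H = mat 1"
      using arg_cong[OF U, of transpose] by (simp add: transpose_simps)
    have "H ** (U ** S ** transpose U) ** (transpose H ** matrix_inv S) = mat 1"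
      using matrix_inv_spd[OF S]
      by (simp add: matrix_mul_assoc[symmetric] matrix_mul_reassoc[OF U] matrix_mul_reassoc[OF Ut])
    then have "CARD('p) = rank (H ** (U ** S ** transpose U) ** (transpose H ** matrix_inv S))"
      by (simp add: rank_I)
    also have "\<dots> \<le> rank (U ** S ** transpose U)"
      by (meson le_trans rank_mul_le_left rank_mul_le_right)
    finally show "CARD('p) \<le> rank (U ** S ** transpose U)" .
  qed
  ultimately show ?thesis
    using S by (simp add: psd_rank_def sym_matrices_def spd_matrices_def transpose_simps matrix_mul_assoc)
qed

lemma stiefel_conj_in_psd_rank:
  fixes U :: "real^'p^'n"
  assumes "U \<in> stiefel" "S \<in> spd_matrices"
  shows "U ** S ** transpose U \<in> psd_rank CARD('p)"
  by (rule conj_in_psd_rank[OF stiefelD[OF assms(1)] assms(2)])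

text \<open>Otherwise \<open>y\<close> could be perturbed to make the form negative.\<close>

lemma psd_null:
  fixes A :: "real^'n^'n"
  assumes "transpose A = A" "\<And>x. 0 \<le> x \<bullet> (A *v x)" "y \<bullet> (A *v y) = 0"
  shows "A *v y = 0"
proof -
  have "z \<bullet> (A *v y) = 0" for z
  proof -
    have sym: "y \<bullet> (A *v z) = z \<bullet> (A *v y)"
      using assms(1) inner_transpose_matrix_vector[of y A z] by (simp add: inner_commute)
    have "0 \<le> t * (2 * (z \<bullet> (A *v y))) + t\<^sup>2 * (z \<bullet> (A *v z))" for t
      using assms(2)[of "y + t *\<^sub>R z"] assms(3) sym
      by (simp add: matrix_vector_right_distrib matrix_vector_mult_scaleR inner_simps power2_eq_square
          algebra_simps)
    then show ?thesis using quadratic_nonneg_imp_linear_zero by fastforce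
  qed
  then show ?thesis by (metis inner_eq_zero_iff)
qed

lemma diag_mul: "diag a ** diag b = diag (\<chi> i. a $ i * b $ i)"
  by (simp add: matrix_matrix_mult_def diag_def vec_eq_iff mult_delta_left mult_delta_right)

lemma transpose_diag: "transpose (diag a) = diag a"
  by (auto simp: transpose_def diag_def vec_eq_iff)

text \<open>The square root has the same eigenvectors and the square roots of the eigenvalues.\<close>

lemma spd_sqrt:
  fixes S :: "real^'p^'p"
  assumes S: "S \<in> spd_matrices"
  shows "\<exists>R\<in>spd_matrices. R ** R = S"
proof -
  have symm: "(S *v x) \<bullet> y = x \<bullet> (S *v y)" for x y
    using spd_transpose[OF S] inner_transpose_matrix_vector[of x S y] by simp
  obtain B where B: "pairwise orthogonal B" "\<forall>b\<in>B. norm b = 1" "span B = (UNIV :: (real^'p) set)"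
    "\<forall>b\<in>B. \<exists>l. S *v b = l *\<^sub>R b"
    using selfadjoint_orthonormal_eigenbasis[of "(*v) S" UNIV] symm by (auto simp: subspace_UNIV)
  have "independent B"
    using B(1,2) by (intro pairwise_orthogonal_independent) auto
  then have "card B = CARD('p)"
    using B(3) by (metis dim_span_eq_card_independent dim_UNIV DIM_cart DIM_real mult.right_neutral)
  then obtain Q :: "real^'p^'p" where Q: "Q \<in> stiefel" "range (\<lambda>j. column j Q) = B"
    using ex_stiefel_columns[OF B(1,2)] by blast
  have QQ: "transpose Q ** Q = mat 1" "Q ** transpose Q = mat 1"
    using stiefelD[OF Q(1)] matrix_left_right_inverse by auto
  have "\<forall>j. \<exists>l. S *v column j Q = l *\<^sub>R column j Q" using B(4) Q(2) by blast
  then obtain d where d: "\<And>j. S *v column j Q = d j *\<^sub>R column j Q" by metis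
  have pos: "d j > 0" for j
  proof -
    have n: "norm (column j Q) = 1" using B(2) Q(2) by blast
    then have "column j Q \<noteq> 0" by auto
    then have "0 < column j Q \<bullet> (S *v column j Q)"
      using S by (auto simp: spd_matrices_def)
    then show ?thesis using n by (simp add: d norm_eq_1)
  qed
  have SQ: "S ** Q = Q ** diag (\<chi> j. d j)"
  proof -
    have "(S ** Q) $ i $ j = (S *v column j Q) $ i" for i j
      by (simp add: matrix_matrix_mult_def matrix_vector_mult_def column_def)
    then show ?thesis
      by (simp add: vec_eq_iff d) (simp add: matrix_matrix_mult_def diag_def column_def if_distrib mult.commute cong: if_cong)
  qed
  let ?D = "diag (\<chi> j. sqrt (d j)) :: real^'p^'p"
  have "?D \<in> spd_matrices"
  proof -
    have "transpose ?D = ?D" by (rule transpose_diag)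
    moreover have "0 < x \<bullet> (?D *v x)" if "x \<noteq> 0" for x
    proof -
      have "?D *v x = (\<chi> i. sqrt (d i) * x $ i)"
        by (simp add: matrix_vector_mult_def diag_def if_distrib if_distribR cong: if_cong)
      then have "x \<bullet> (?D *v x) = (\<Sum>i\<in>UNIV. sqrt (d i) * (x $ i)\<^sup>2)"
        by (simp add: inner_vec_def power2_eq_square mult_ac)
      also have "\<dots> > 0"
      proof -
        obtain i where "x $ i \<noteq> 0" using \<open>x \<noteq> 0\<close> by (metis vec_eq_iff zero_index)
        then show ?thesis
          using pos by (intro sum_pos2[where i = i]) (auto simp: less_imp_le)
      qed
      finally show ?thesis .
    qed
    ultimately show ?thesis by (simp add: spd_matrices_def sym_matrices_def)
  qed
  then have "transpose (transpose Q) ** ?D ** transpose Q \<in> spd_matrices"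
    by (rule spd_congruence) (rule QQ)
  moreover have DD: "?D ** ?D = diag (\<chi> j. d j)"
    using pos by (simp add: diag_mul less_imp_le)
  then have "(Q ** ?D ** transpose Q) ** (Q ** ?D ** transpose Q) = Q ** diag (\<chi> j. d j) ** transpose Q"
    by (simp add: matrix_mul_assoc[symmetric] matrix_mul_reassoc[OF QQ(1)] matrix_mul_reassoc[OF DD])
  then have "(Q ** ?D ** transpose Q) ** (Q ** ?D ** transpose Q) = S"
    by (simp only: SQ[symmetric] matrix_mul_assoc[symmetric] QQ(2) matrix_mul_rid)
  ultimately show ?thesis by auto
qed

text \<open>The frame \<open>U\<close> is an orthonormal basis of the range of \<open>A\<close>, and \<open>S\<close> is the compression of \<open>A\<close> to it.\<close>

lemma psd_rank_factorization:
  fixes A :: "real^'n^'n"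
  assumes A: "A \<in> psd_rank CARD('p::finite)"
  shows "\<exists>(U :: real^'p^'n) S. U \<in> stiefel \<and> S \<in> spd_matrices \<and> A = U ** S ** transpose U"
proof -
  have At: "transpose A = A" and psd: "\<And>x. 0 \<le> x \<bullet> (A *v x)" and rk: "rank A = CARD('p)"
    using A by (auto simp: psd_rank_def sym_matrices_def)
  have "subspace (range ((*v) A))" by (rule linear_subspace_image) (auto simp: subspace_UNIV)
  moreover have "dim (range ((*v) A)) = CARD('p)" using rk by (simp add: rank_dim_range)
  ultimately obtain U :: "real^'p^'n" where U: "U \<in> stiefel" "range ((*v) U) = range ((*v) A)"
    using ex_stiefel_range by blast
  have UA: "U ** (transpose U ** A) = A" using stiefel_projector_absorb[OF U(1), of A] U(2) by simp
  have AU: "A ** (U ** transpose U) = A"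
    using arg_cong[OF UA, of transpose] by (simp add: transpose_simps At matrix_mul_assoc)
  let ?S = "transpose U ** A ** U"
  have "0 < x \<bullet> (?S *v x)" if "x \<noteq> 0" for x
  proof -
    have eq: "x \<bullet> (?S *v x) = (U *v x) \<bullet> (A *v (U *v x))"
      by (simp add: matrix_vector_mul_assoc[symmetric] inner_transpose_matrix_vector[of x "transpose U"])
    have "A *v (U *v x) \<noteq> 0"
    proof
      assume 0: "A *v (U *v x) = 0"
      obtain z where z: "U *v x = A *v z" using U(2) by (metis rangeE rangeI)
      have "(A *v z) \<bullet> (A *v z) = z \<bullet> (A *v (A *v z))"
        using inner_transpose_matrix_vector[of z A "A *v z"] At by simp
      then have "U *v x = 0" using 0 z by simp
      then show False using norm_stiefel_vector[OF U(1), of x] that by simp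
    qed
    then have "(U *v x) \<bullet> (A *v (U *v x)) \<noteq> 0" using psd_null[OF At psd] by blast
    then show ?thesis using eq psd[of "U *v x"] by linarith
  qed
  then have "?S \<in> spd_matrices"
    by (simp add: spd_matrices_def sym_matrices_def transpose_simps At matrix_mul_assoc)
  moreover have "A = U ** ?S ** transpose U"
    using UA AU by (simp add: matrix_mul_assoc[symmetric])
  ultimately show ?thesis using U(1) by blast
qed

section \<open>The horizontal curves stay in the manifold\<close>

lemma spd_mat_1: "mat 1 \<in> spd_matrices"
  by (auto simp: spd_matrices_def sym_matrices_def)

lemma matrix_exp_spd:
  fixes M :: "real^'p^'p"
  assumes "transpose M = M"
  shows "matrix_exp M \<in> spd_matrices"
proof -
  let ?H = "matrix_exp ((1/2) *\<^sub>R M)"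
  have "matrix_exp M = ?H ** ?H" using matrix_exp_add[of "1/2" "1/2" M] by simp
  moreover have "transpose ?H = ?H" using assms by (simp add: matrix_exp_transpose transpose_scalar)
  ultimately have "matrix_exp M = transpose ?H ** mat 1 ** ?H" by simp
  moreover have "matrix_exp ((- 1/2) *\<^sub>R M) ** ?H = mat 1"
    using matrix_exp_inverse[of "-1/2" M] by simp
  ultimately show ?thesis using spd_congruence[OF spd_mat_1] by metis
qed

lemma matrix_mul_diag_entry: "(A ** diag a) $ i $ j = A $ i $ j * a $ j"
  by (simp add: matrix_matrix_mult_def diag_def mult_delta_right)

lemma diag_matrix_mul_entry: "(diag a ** A) $ i $ j = a $ i * A $ i $ j"
  by (simp add: matrix_matrix_mult_def diag_def mult_delta_left)

text \<open>Horizontality makes the frame \<open>U V\<^sup>T\<close> orthogonal to the columns of \<open>X\<close> with nonzero singular value,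
  and those columns are orthonormal. The remaining columns are multiplied by \<open>sin 0\<close>. Hence the Gram
  matrix of the curve is \<open>V\<^sup>T (cos\<^sup>2 + sin\<^sup>2) V\<close>.\<close>

lemma U_curve_in_stiefel:
  fixes U \<Delta> X :: "real^'p^'n"
  assumes U: "U \<in> stiefel" and h: "transpose U ** \<Delta> = 0" and svd: "compact_svd \<Delta> X s V"
  shows "U_curve U X s V t \<in> stiefel"
proof -
  have V: "transpose V ** V = mat 1" "V ** transpose V = mat 1"
    and XsV: "X ** diag s ** V = \<Delta>"
    and X: "\<And>i j. s $ i \<noteq> 0 \<Longrightarrow> s $ j \<noteq> 0 \<Longrightarrow> column i X \<bullet> column j X = (if i = j then 1 else 0)"
    using svd by (auto simp: compact_svd_def orthogonal_matrix_def)
  define c where "c = diag (\<chi> i. cos (s $ i * t))"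
  define d where "d = diag (\<chi> i. sin (s $ i * t))"
  define Z where "Z = U ** transpose V"
  have ZZ: "transpose Z ** Z = mat 1"
    using V by (simp add: Z_def transpose_simps matrix_mul_assoc[symmetric] matrix_mul_reassoc[OF stiefelD[OF U]])
  have "transpose Z ** X ** diag s = V ** (transpose U ** \<Delta>) ** transpose V"
    unfolding XsV[symmetric] using V by (simp add: Z_def transpose_simps matrix_mul_assoc[symmetric])
  then have "(transpose Z ** X ** diag s) = 0" by (simp add: h)
  then have "(transpose Z ** X) $ i $ j * s $ j = 0" for i j
    by (metis matrix_mul_diag_entry zero_index)
  then have "(transpose Z ** X) $ i $ j * sin (s $ j * t) = 0" for i j
    by (metis mult_eq_0_iff mult_zero_left sin_zero)
  then have ZX: "transpose Z ** X ** d = 0"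
    by (simp add: vec_eq_iff d_def matrix_mul_diag_entry)
  have XZ: "d ** (transpose X ** Z) = 0"
    using arg_cong[OF ZX, of transpose] by (simp add: transpose_simps d_def transpose_diag)
  have "(d ** (transpose X ** X) ** d) $ i $ j = (d ** d) $ i $ j" for i j
  proof (cases "s $ i \<noteq> 0 \<and> s $ j \<noteq> 0")
    case True
    then show ?thesis
      using X[of i j] by (auto simp: d_def diag_mul matrix_mul_diag_entry diag_matrix_mul_entry
          matrix_mult_transpose_dot_column) (auto simp: diag_def)
  next
    case False
    then show ?thesis
      by (auto simp: d_def diag_mul matrix_mul_diag_entry diag_matrix_mul_entry) (auto simp: diag_def)
  qed
  then have XX: "d ** (transpose X ** X) ** d = d ** d" by (simp add: vec_eq_iff)
  have cd: "c ** c + d ** d = mat 1"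
    by (simp add: c_def d_def diag_mul) (simp add: diag_def mat_def vec_eq_iff power2_eq_square[symmetric])
  have Ut: "U_curve U X s V t = (Z ** c + X ** d) ** V"
    by (simp add: U_curve_def Z_def c_def d_def matrix_distribs matrix_mul_assoc)
  have "transpose (Z ** c + X ** d) ** (Z ** c + X ** d)
     = c ** (transpose Z ** Z) ** c + d ** (transpose X ** X) ** d
       + c ** (transpose Z ** X ** d) + d ** (transpose X ** Z) ** c"
    by (simp add: transpose_simps matrix_distribs c_def d_def transpose_diag matrix_mul_assoc[symmetric])
  also have "\<dots> = mat 1" by (simp add: ZZ XX ZX XZ cd)
  finally show ?thesis
    using V(1) by (simp add: stiefel_def Ut transpose_simps matrix_mul_assoc[symmetric])
      (metis matrix_mul_assoc matrix_mul_rid)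
qed

text \<open>Together the two curves solve a linear differential equation.\<close>

lemma smooth_on_diag_trig:
  "smooth_on UNIV (\<lambda>t. diag (\<chi> i. cos (s $ i * t)))" (is "smooth_on UNIV ?c")
  "smooth_on UNIV (\<lambda>t. diag (\<chi> i. sin (s $ i * t)))" (is "smooth_on UNIV ?d")
proof -
  have c: "(?c has_vector_derivative - (diag s ** ?d t)) (at t)" for t
  proof (rule has_vector_derivative_matrixI)
    fix i j
    show "((\<lambda>t. ?c t $ i $ j) has_vector_derivative (- (diag s ** ?d t)) $ i $ j) (at t)"
      unfolding has_real_derivative_iff_has_vector_derivative[symmetric] diag_mul
      by (cases "i = j") (auto simp: diag_def intro!: derivative_eq_intros)
  qed
  have d: "(?d has_vector_derivative diag s ** ?c t) (at t)" for t
  proof (rule has_vector_derivative_matrixI)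
    fix i j
    show "((\<lambda>t. ?d t $ i $ j) has_vector_derivative (diag s ** ?c t) $ i $ j) (at t)"
      unfolding has_real_derivative_iff_has_vector_derivative[symmetric] diag_mul
      by (cases "i = j") (auto simp: diag_def intro!: derivative_eq_intros)
  qed
  let ?L = "\<lambda>z. (- (diag s ** snd z), diag s ** fst z)"
  have L: "bounded_linear ?L"
    by (intro bounded_linear_Pair bounded_linear_minus
        bounded_linear_compose[OF bounded_bilinear.bounded_linear_right[OF bounded_bilinear_matrix_mul]]
        bounded_linear_fst bounded_linear_snd)
  have "((\<lambda>t. (?c t, ?d t)) has_vector_derivative ?L (?c t, ?d t)) (at t)" for t
    using has_vector_derivative_Pair[OF c d] by simp
  then have sm: "smooth_on UNIV (\<lambda>t. (?c t, ?d t))"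
    by (rule smooth_on_linear_ode[OF L])
  show "smooth_on UNIV ?c" using smooth_on_linear_image[OF _ bounded_linear_fst sm] by simp
  show "smooth_on UNIV ?d" using smooth_on_linear_image[OF _ bounded_linear_snd sm] by simp
qed

lemma smooth_on_matrix_exp: "smooth_on UNIV (\<lambda>t. matrix_exp (t *\<^sub>R A))"
  by (rule smooth_on_linear_ode[OF bounded_bilinear.bounded_linear_right[OF bounded_bilinear_matrix_mul]])
     (rule matrix_exp_has_vector_derivative)

lemma horizontalD:
  fixes U \<Delta> :: "real^'p^'n"
  assumes "(\<Delta>, D) \<in> horizontal U R"
  shows "transpose U ** \<Delta> = 0" "\<exists>D0. transpose D0 = D0 \<and> D = R ** D0 ** R"
  using assms by (auto simp: horizontal_def sym_matrices_def matrix_mul_assoc)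

lemma psd_curve_smooth: "smooth_on UNIV (psd_curve U R D X s V)"
proof -
  have "smooth_on UNIV (U_curve U X s V)"
    unfolding U_curve_def[abs_def]
    by (intro smooth_on_add smooth_on_matrix_mul smooth_on_const smooth_on_diag_trig open_UNIV)
  moreover have "smooth_on UNIV (R2_curve R D)"
    unfolding R2_curve_def[abs_def]
    by (intro smooth_on_matrix_mul smooth_on_const smooth_on_matrix_exp open_UNIV)
  ultimately show ?thesis
    unfolding psd_curve_def[abs_def] by (intro smooth_on_matrix_mul smooth_on_transpose open_UNIV)
qed

lemma psd_curve_in_psd_rank:
  fixes U \<Delta> X :: "real^'p^'n"
  assumes U: "U \<in> stiefel" and R: "R \<in> spd_matrices" and h: "(\<Delta>, D) \<in> horizontal U R"
    and svd: "compact_svd \<Delta> X s V"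
  shows "psd_curve U R D X s V t \<in> psd_rank CARD('p)"
proof -
  obtain D0 where D0: "transpose D0 = D0" "D = R ** D0 ** R" using horizontalD(2)[OF h] by blast
  have M: "matrix_inv R ** D ** matrix_inv R = D0"
    using matrix_inv_spd[OF R] by (simp add: D0(2) matrix_mul_assoc) (simp add: matrix_mul_assoc[symmetric])
  have "transpose R ** matrix_exp (t *\<^sub>R D0) ** R \<in> spd_matrices"
    using D0(1) matrix_inv_spd(2)[OF R]
    by (intro spd_congruence matrix_exp_spd) (auto simp: transpose_scalar)
  then have "R2_curve R D t \<in> spd_matrices"
    by (simp add: R2_curve_def M spd_transpose[OF R])
  with U_curve_in_stiefel[OF U horizontalD(1)[OF h] svd] show ?thesis
    unfolding psd_curve_def by (rule stiefel_conj_in_psd_rank)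
qed

section \<open>The pseudoinverse on matrices of fixed rank\<close>

text \<open>The group inverse. On symmetric matrices it is the Moore-Penrose pseudoinverse.\<close>

definition pinv :: "real^'n^'n \<Rightarrow> real^'n^'n" where
  "pinv A = (THE B. A ** B ** A = A \<and> B ** A ** B = B \<and> A ** B = B ** A)"

lemma pinv_eqI:
  fixes A :: "real^'n^'n"
  assumes B: "A ** B ** A = A" "B ** A ** B = B" "A ** B = B ** A"
  shows "pinv A = B"
  unfolding pinv_def
proof (rule the_equality)
  fix C assume "A ** C ** A = A \<and> C ** A ** C = C \<and> A ** C = C ** A"
  then have C: "A ** C ** A = A" "C ** A ** C = C" "A ** C = C ** A" by blast+
  have "A ** B = A ** C ** A ** B" by (simp only: C(1))
  also have "\<dots> = C ** A ** (A ** B)" by (simp only: C(3) matrix_mul_assoc)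
  also have "\<dots> = C ** A ** (B ** A)" by (simp only: B(3))
  also have "\<dots> = C ** (A ** B ** A)" by (simp only: matrix_mul_assoc)
  also have "\<dots> = A ** C" by (simp only: B(1) C(3))
  finally have AB: "A ** B = A ** C" .
  have "C = C ** (A ** C)" by (simp only: C(2) matrix_mul_assoc)
  also have "\<dots> = C ** A ** B" by (simp only: AB[symmetric] matrix_mul_assoc)
  also have "\<dots> = A ** B ** B" by (simp only: C(3)[symmetric] AB)
  also have "\<dots> = B" by (simp only: B(2,3))
  finally show "C = B" .
qed (use B in auto)

lemma pinv_stiefel_conj:
  fixes U :: "real^'p^'n"
  assumes U: "U \<in> stiefel" and S: "S \<in> spd_matrices"
  shows "pinv (U ** S ** transpose U) = U ** matrix_inv S ** transpose U"
  by (rule pinv_eqI)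
     (simp_all add: matrix_mul_assoc[symmetric] matrix_mul_reassoc[OF stiefelD[OF U]]
       matrix_mul_reassoc[OF matrix_inv_spd(1)[OF S]] matrix_mul_reassoc[OF matrix_inv_spd(2)[OF S]]
       matrix_inv_spd[OF S])

lemma pinv_psd_rank:
  fixes A :: "real^'n^'n"
  assumes A: "A \<in> psd_rank CARD('p::finite)"
  shows "A ** pinv A ** A = A" "pinv A ** A ** pinv A = pinv A" "A ** pinv A = pinv A ** A"
    "transpose (pinv A) = pinv A" "transpose A = A"
proof -
  obtain U :: "real^'p^'n" and S where US: "U \<in> stiefel" "S \<in> spd_matrices" "A = U ** S ** transpose U"
    using psd_rank_factorization[OF A] by blast
  note simps = US(3) pinv_stiefel_conj[OF US(1,2)]
  show "A ** pinv A ** A = A" "pinv A ** A ** pinv A = pinv A" "A ** pinv A = pinv A ** A"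
    "transpose (pinv A) = pinv A" "transpose A = A"
    unfolding simps
    by (simp_all add: matrix_mul_assoc[symmetric] matrix_mul_reassoc[OF stiefelD[OF US(1)]]
       matrix_mul_reassoc[OF matrix_inv_spd(1)[OF US(2)]] matrix_mul_reassoc[OF matrix_inv_spd(2)[OF US(2)]]
       matrix_inv_spd[OF US(2)] transpose_simps spd_transpose[OF US(2)])
qed

lemma spd_imp_psd_rank: "S \<in> spd_matrices \<Longrightarrow> S \<in> psd_rank CARD('p)" for S :: "real^'p^'p"
  using stiefel_conj_in_psd_rank[of "mat 1 :: real^'p^'p" S] by (simp add: stiefel_def)

lemma pinv_spd: "S \<in> spd_matrices \<Longrightarrow> pinv S = matrix_inv S" for S :: "real^'p^'p"
  by (rule pinv_eqI) (simp_all add: matrix_inv_spd)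

lemma spd_coercive:
  fixes S :: "real^'p^'p"
  assumes S: "S \<in> spd_matrices"
  shows "\<exists>c>0. \<forall>x. c * (norm x)\<^sup>2 \<le> x \<bullet> (S *v x)"
proof -
  have "continuous_on (sphere 0 1) (\<lambda>x. x \<bullet> (S *v x))"
    by (intro continuous_intros linear_continuous_on matrix_vector_mul_bounded_linear)
  moreover have "sphere (0 :: real^'p) 1 \<noteq> {}" by simp
  ultimately obtain v where v: "v \<in> sphere 0 1" "\<And>y. y \<in> sphere 0 1 \<Longrightarrow> v \<bullet> (S *v v) \<le> y \<bullet> (S *v y)"
    using continuous_attains_inf[of "sphere 0 1" "\<lambda>x. x \<bullet> (S *v x)"] by (metis compact_sphere)
  define c where "c = v \<bullet> (S *v v)"
  have "v \<noteq> 0" using v by auto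
  then have "c > 0" using S by (auto simp: c_def spd_matrices_def)
  moreover have "c * (norm x)\<^sup>2 \<le> x \<bullet> (S *v x)" for x
  proof (cases "x = 0")
    case False
    then have "(1 / norm x) *\<^sub>R x \<in> sphere 0 1" by simp
    from v(2)[OF this] False show ?thesis
      by (simp add: c_def matrix_vector_mult_scaleR field_simps power2_eq_square)
  qed simp
  ultimately show ?thesis by blast
qed

text \<open>The range of \<open>A ** U\<close> has dimension \<open>p\<close>, so it is the whole range of \<open>A\<close>. The difference of the
  two sides is a Schur complement.\<close>

lemma psd_rank_schur:
  fixes A :: "real^'n^'n" and U :: "real^'p^'n"
  assumes A: "A \<in> psd_rank CARD('p)" and S: "transpose U ** A ** U \<in> spd_matrices"
  shows "A = A ** U ** matrix_inv (transpose U ** A ** U) ** transpose U ** A"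
proof -
  let ?S = "transpose U ** A ** U"
  have "rank ?S = CARD('p)"
    using spd_imp_psd_rank[OF S] by (simp add: psd_rank_def)
  then have "CARD('p) \<le> rank (A ** U)"
    by (metis matrix_mul_assoc rank_mul_le_right)
  then have "rank A \<le> rank (A ** U)" using A by (simp add: psd_rank_def)
  moreover have "range ((*v) (A ** U)) \<subseteq> range ((*v) A)"
    by (auto simp: matrix_vector_mul_assoc[symmetric])
  moreover have "subspace (range ((*v) (A ** U)))" "subspace (range ((*v) A))"
    by (rule linear_subspace_image; simp)+
  ultimately have ran: "range ((*v) (A ** U)) = range ((*v) A)"
    by (metis rank_dim_range subspace_dim_equal)
  have "A *v x = (A ** U ** matrix_inv ?S ** transpose U ** A) *v x" for x
  proof -
    obtain z where z: "A *v x = (A ** U) *v z" using ran by (metis rangeE rangeI)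
    then have "transpose U *v (A *v x) = ?S *v z" by (simp add: matrix_vector_mul_assoc matrix_mul_assoc)
    then have "matrix_inv ?S *v (transpose U *v (A *v x)) = z"
      by (simp add: matrix_vector_mul_assoc matrix_inv_spd[OF S])
    then have "(A ** U) *v (matrix_inv ?S *v (transpose U *v (A *v x))) = A *v x"
      using z by simp
    then show ?thesis by (simp add: matrix_vector_mul_assoc matrix_mul_assoc)
  qed
  then show ?thesis by (simp add: matrix_eq)
qed

lemma norm_matrix_le:
  fixes A :: "real^'m^'n"
  assumes "\<And>x. norm (A *v x) \<le> C * norm x"
  shows "norm A \<le> real CARD('n) * (real CARD('m) * C)"
proof -
  have "\<bar>A $ i $ j\<bar> \<le> C" for i j
  proof -
    have "\<bar>A $ i $ j\<bar> = \<bar>(A *v axis j 1) $ i\<bar>" by (simp add: matrix_vector_mult_basis column_def)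
    also have "\<dots> \<le> norm (A *v axis j 1)" by (rule component_le_norm_cart)
    also have "\<dots> \<le> C" using assms[of "axis j 1"] by simp
    finally show ?thesis .
  qed
  then have "norm (A $ i) \<le> (\<Sum>j\<in>(UNIV :: 'm set). C)" for i
    by (intro order_trans[OF norm_le_l1_cart] sum_mono)
  then have "(\<Sum>i\<in>UNIV. norm (A $ i)) \<le> (\<Sum>i\<in>(UNIV :: 'n set). real CARD('m) * C)"
    by (intro sum_mono) simp
  moreover have "norm A \<le> (\<Sum>i\<in>UNIV. norm (A $ i))"
    unfolding norm_vec_def[of A] by (rule L2_set_le_sum) simp
  ultimately show ?thesis by simp
qed

lemma compression_coercive_nearby:
  fixes A0 :: "real^'n^'n" and U :: "real^'p^'n"
  assumes S: "transpose U ** A0 ** U \<in> spd_matrices"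
  shows "\<exists>c>0. \<exists>e>0. \<forall>A. norm (A - A0) < e \<longrightarrow>
     (\<forall>x. c * (norm x)\<^sup>2 \<le> x \<bullet> ((transpose U ** A ** U) *v x))"
proof -
  obtain c where c: "c > 0" "\<And>x. c * (norm x)\<^sup>2 \<le> x \<bullet> ((transpose U ** A0 ** U) *v x)"
    using spd_coercive[OF S] by blast
  obtain K where K: "K > 0" "\<And>(M :: real^'n^'n) x. norm (M *v x) \<le> norm M * norm x * K"
    using bounded_bilinear.pos_bounded[OF bounded_bilinear_matrix_vector_mul] by blast
  obtain L where L: "L > 0" "\<And>x. norm (U *v x) \<le> norm x * L"
    using bounded_linear.pos_bounded[OF matrix_vector_mul_bounded_linear[of U]] by blast
  (* the perturbation of the quadratic form is then at most half of its lower bound *)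
  define e where "e = c / (2 * K * L\<^sup>2)"
  have e: "e > 0" using c K L by (simp add: e_def)
  have "(c / 2) * (norm x)\<^sup>2 \<le> x \<bullet> ((transpose U ** A ** U) *v x)" if A: "norm (A - A0) < e" for A x
  proof -
    have "\<bar>(U *v x) \<bullet> ((A - A0) *v (U *v x))\<bar> \<le> norm (U *v x) * (norm (A - A0) * norm (U *v x) * K)"
      using Cauchy_Schwarz_ineq2[of "U *v x" "(A - A0) *v (U *v x)"] K(2)[of "A - A0" "U *v x"]
      by (meson mult_left_mono norm_ge_zero order_trans)
    also have "\<dots> = (norm (U *v x))\<^sup>2 * (norm (A - A0) * K)" by (simp add: power2_eq_square)
    also have "\<dots> \<le> (norm x * L)\<^sup>2 * (e * K)"
      using A K(1) L by (intro mult_mono power_mono mult_right_mono) auto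
    also have "\<dots> = (c / 2) * (norm x)\<^sup>2" using K L by (simp add: e_def field_simps)
    finally have "(U *v x) \<bullet> ((A - A0) *v (U *v x)) \<ge> - ((c / 2) * (norm x)\<^sup>2)" by linarith
    moreover have "(U *v x) \<bullet> (B *v (U *v x)) = x \<bullet> ((transpose U ** B ** U) *v x)" for B :: "real^'n^'n"
      by (simp add: matrix_vector_mul_assoc[symmetric] inner_transpose_matrix_vector[of x "transpose U"])
    ultimately show ?thesis using c(2)[of x]
      by (simp add: matrix_vector_mult_diff_rdistrib inner_diff_right)
  qed
  then show ?thesis using c(1) e by (intro exI[of _ "c/2"] exI[of _ e] conjI) auto
qed

text \<open>The rank is constant, so every vector \<open>x\<close> in the range of a nearby \<open>A\<close> is \<open>A u\<close> with \<open>u\<close> in the range of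
  \<open>A0\<close>. There \<open>A\<close> is coercive, which gives \<open>c \<bar>u\<bar> \<le> \<bar>x\<bar>\<close>, and then \<open>\<bar>x\<bar>\<^sup>2 = A x \<bullet> u\<close> bounds \<open>A\<close> from below on its
  range.\<close>

lemma pinv_locally_bounded:
  fixes A0 :: "real^'n^'n"
  assumes A0: "A0 \<in> psd_rank CARD('p::finite)"
  shows "\<exists>C. \<exists>e>0. \<forall>A\<in>psd_rank CARD('p). norm (A - A0) < e \<longrightarrow> norm (pinv A) \<le> C"
proof -
  obtain U :: "real^'p^'n" and S where US: "U \<in> stiefel" "S \<in> spd_matrices" "A0 = U ** S ** transpose U"
    using psd_rank_factorization[OF A0] by blast
  have "transpose U ** A0 ** U = S"
    by (simp add: US(3) matrix_mul_assoc[symmetric] matrix_mul_reassoc[OF stiefelD[OF US(1)]] stiefelD[OF US(1)])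
  then obtain c e where ce: "c > 0" "e > 0" "\<And>A x. norm (A - A0) < e \<Longrightarrow>
     c * (norm x)\<^sup>2 \<le> x \<bullet> ((transpose U ** A ** U) *v x)"
    using compression_coercive_nearby[of U A0] US(2) by metis
  have "norm (pinv A) \<le> real CARD('n) * (real CARD('n) * (1 / c))"
    if A: "A \<in> psd_rank CARD('p)" "norm (A - A0) < e" for A
  proof (rule norm_matrix_le)
    fix y
    note B = pinv_psd_rank[OF A(1)]
    have "transpose U ** A ** U \<in> spd_matrices"
    proof -
      have "0 < x \<bullet> ((transpose U ** A ** U) *v x)" if "x \<noteq> 0" for x
      proof -
        have "0 < c * (norm x)\<^sup>2" using ce(1) that by simp
        then show ?thesis using ce(3)[OF A(2), of x] by linarith
      qed
      then show ?thesis
        by (auto simp: spd_matrices_def sym_matrices_def transpose_simps B matrix_mul_assoc)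
    qed
    from psd_rank_schur[OF A(1) this]
    have AA: "A = A ** U ** (matrix_inv (transpose U ** A ** U) ** transpose U ** A)"
      by (simp add: matrix_mul_assoc)
    define x where "x = pinv A *v y"
    have xA: "x = A *v (pinv A *v (pinv A *v y))"
      using B(2,3) by (simp add: x_def matrix_vector_mul_assoc matrix_mul_assoc)
    obtain z where z: "x = A *v (U *v z)"
      using xA AA by (metis matrix_vector_mul_assoc)
    define u where "u = U *v z"
    have nu: "norm u = norm z" by (simp add: u_def norm_stiefel_vector[OF US(1)])
    have "c * (norm u)\<^sup>2 \<le> z \<bullet> ((transpose U ** A ** U) *v z)" using ce(3)[OF A(2), of z] nu by simp
    also have "\<dots> = u \<bullet> x"
      by (simp add: z u_def matrix_vector_mul_assoc[symmetric] inner_transpose_matrix_vector[of z "transpose U"])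
    also have "\<dots> \<le> norm u * norm x" by (rule norm_cauchy_schwarz)
    finally have "norm u * (c * norm u) \<le> norm u * norm x" by (simp add: power2_eq_square mult_ac)
    then have cu: "c * norm u \<le> norm x"
      by (cases "norm u = 0") (auto simp: mult_le_cancel_left)
    have "(norm x)\<^sup>2 = (A *v x) \<bullet> u"
      using inner_transpose_matrix_vector[of x A u] B(5)
      by (simp add: power2_norm_eq_inner) (metis u_def z)
    also have "\<dots> \<le> norm (A *v x) * norm u" by (rule norm_cauchy_schwarz)
    finally have "c * (norm x)\<^sup>2 \<le> norm (A *v x) * (c * norm u)"
      using ce(1) by (simp add: mult_ac)
    also have "\<dots> \<le> norm (A *v x) * norm x" using cu by (intro mult_left_mono) auto
    finally have "norm x * (c * norm x) \<le> norm x * norm (A *v x)" by (simp add: power2_eq_square mult_ac)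
    then have 1: "c * norm x \<le> norm (A *v x)"
      by (cases "norm x = 0") (auto simp: mult_le_cancel_left)
    have "(norm (A *v x))\<^sup>2 = y \<bullet> (A *v x)"
    proof -
      have "(A *v x) \<bullet> (A *v x) = ((A ** pinv A) *v y) \<bullet> ((A ** pinv A) *v y)"
        by (simp add: x_def matrix_vector_mul_assoc)
      also have "\<dots> = y \<bullet> ((A ** pinv A ** (A ** pinv A)) *v y)"
        using inner_transpose_matrix_vector[of y "A ** pinv A" "(A ** pinv A) *v y"] B
        by (simp add: transpose_simps matrix_vector_mul_assoc)
      also have "A ** pinv A ** (A ** pinv A) = A ** pinv A"
        using B(1) by (simp add: matrix_mul_assoc)
      finally show ?thesis by (simp add: x_def matrix_vector_mul_assoc power2_norm_eq_inner)
    qed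
    also have "\<dots> \<le> norm y * norm (A *v x)" by (rule norm_cauchy_schwarz)
    finally have "norm (A *v x) \<le> norm y"
      by (cases "norm (A *v x) = 0") (auto simp: power2_eq_square mult_le_cancel_right)
    with 1 show "norm (pinv A *v y) \<le> 1 / c * norm y"
      using ce(1) by (simp add: x_def field_simps)
  qed
  then show ?thesis using ce(2) by blast
qed

text \<open>Wedin's identity. Since it is exact, local boundedness of the pseudoinverse implies continuity, and
  continuity implies differentiability.\<close>

lemma pinv_difference:
  fixes A0 A :: "real^'n^'n"
  assumes A0: "A0 \<in> psd_rank CARD('p::finite)" and A: "A \<in> psd_rank CARD('p)"
  shows "pinv A - pinv A0 = - (pinv A ** ((A - A0) ** pinv A0))
     + pinv A ** pinv A ** ((A - A0) ** (mat 1 - A0 ** pinv A0))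
     + (mat 1 - A ** pinv A) ** ((A - A0) ** (pinv A0 ** pinv A0))"
proof -
  note a = pinv_psd_rank[OF A0] and b = pinv_psd_rank[OF A]
  have A0': "A0 ** (pinv A0 ** pinv A0) = pinv A0" "A0 ** (A0 ** pinv A0) = A0"
    using a by (metis matrix_mul_assoc)+
  have A': "pinv A ** (pinv A ** A) = pinv A" "pinv A ** (A ** A) = A"
    using b by (metis matrix_mul_assoc)+
  have A'': "pinv A ** (pinv A ** (A ** V)) = pinv A ** V" "pinv A ** (A ** (A ** V)) = A ** V"
    "A ** (pinv A ** V) = pinv A ** (A ** V)" for V
    using A' b(3) by (metis matrix_mul_assoc)+
  show ?thesis
    by (simp add: matrix_distribs matrix_mul_assoc[symmetric] A0' A' A'' b(3))
qed

text \<open>A product is differentiable at a zero of a differentiable factor as soon as the other factor is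
  continuous there.\<close>

lemma has_derivative_bilinear_vanishing:
  assumes b: "bounded_bilinear b" and u: "(u has_derivative u') (at a within S)" "u a = 0"
    and F: "(F \<longlongrightarrow> F a) (at a within S)"
  shows "((\<lambda>x. b (F x) (u x)) has_derivative (\<lambda>h. b (F a) (u' h))) (at a within S)"
proof -
  have bl: "bounded_linear u'" using u(1) has_derivative_bounded_linear by blast
  obtain B where B: "B > 0" "\<And>h. norm (u' h) \<le> norm h * B"
    using bounded_linear.pos_bounded[OF bl] by blast
  obtain K where K: "K > 0" "\<And>x y. norm (b x y) \<le> norm x * norm y * K"
    using bounded_bilinear.pos_bounded[OF b] by blast
  let ?q = "\<lambda>y. (u y - u a - u' (y - a)) /\<^sub>R norm (y - a)"
  let ?r = "\<lambda>y. u' (y - a) /\<^sub>R norm (y - a)"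
  have q: "(?q \<longlongrightarrow> 0) (at a within S)" using u(1) by (simp add: has_derivative_at_within)
  have "((\<lambda>y. b (F y) (?q y)) \<longlongrightarrow> 0) (at a within S)"
    using bounded_bilinear.tendsto[OF b F q] by (simp add: bounded_bilinear.zero_right[OF b])
  moreover have "((\<lambda>y. b (F y - F a) (?r y)) \<longlongrightarrow> 0) (at a within S)"
  proof (rule Lim_null_comparison)
    have "((\<lambda>y. norm (F y - F a) * (B * K)) \<longlongrightarrow> 0 * (B * K)) (at a within S)"
      by (intro tendsto_mult tendsto_const tendsto_norm_zero LIM_zero F)
    then show "((\<lambda>y. norm (F y - F a) * (B * K)) \<longlongrightarrow> 0) (at a within S)" by simp
    have "norm (b (F y - F a) (?r y)) \<le> norm (F y - F a) * (B * K)" for y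
    proof -
      have "norm (?r y) \<le> B"
        using B(2)[of "y - a"] B(1) by (cases "y = a") (auto simp: field_simps linear_0[OF bounded_linear.linear[OF bl]])
      then have "norm (F y - F a) * norm (?r y) * K \<le> norm (F y - F a) * B * K"
        using K(1) by (intro mult_right_mono mult_left_mono) auto
      then show ?thesis using K(2)[of "F y - F a" "?r y"] by (simp add: mult_ac)
    qed
    then show "\<forall>\<^sub>F y in at a within S. norm (b (F y - F a) (?r y)) \<le> norm (F y - F a) * (B * K)"
      by simp
  qed
  ultimately have "((\<lambda>y. b (F y) (?q y) + b (F y - F a) (?r y)) \<longlongrightarrow> 0) (at a within S)"
    using tendsto_add by fastforce
  moreover have "b (F y) (?q y) + b (F y - F a) (?r y)
      = (b (F y) (u y) - b (F a) (u a) - b (F a) (u' (y - a))) /\<^sub>R norm (y - a)" for y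
    by (simp add: u(2) bounded_bilinear.diff_left[OF b] bounded_bilinear.diff_right[OF b]
        bounded_bilinear.scaleR_right[OF b] bounded_bilinear.zero_right[OF b] scaleR_diff_right)
  ultimately show ?thesis
    unfolding has_derivative_at_within
    using bounded_linear_compose[OF bounded_bilinear.bounded_linear_right[OF b] bl]
    by simp
qed

abbreviation pinv_deriv :: "real^'n^'n \<Rightarrow> real^'n^'n \<Rightarrow> real^'n^'n" where
  "pinv_deriv A c \<equiv> - (pinv A ** (c ** pinv A))
     + pinv A ** pinv A ** (c ** (mat 1 - A ** pinv A))
     + (mat 1 - A ** pinv A) ** (c ** (pinv A ** pinv A))"

lemma pinv_has_derivative:
  fixes A :: "real^'n^'n"
  assumes A: "A \<in> psd_rank CARD('p::finite)"
  shows "(pinv has_derivative pinv_deriv A) (at A within psd_rank CARD('p))"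
proof -
  let ?M = "psd_rank CARD('p) :: (real^'n^'n) set"
  obtain C e where C: "e > 0" "\<And>A'. A' \<in> ?M \<Longrightarrow> norm (A' - A) < e \<Longrightarrow> norm (pinv A') \<le> C"
    using pinv_locally_bounded[OF A] by metis
  have ev: "\<forall>\<^sub>F A' in at A within ?M. A' \<in> ?M \<and> norm (A' - A) < e"
    unfolding eventually_at using C(1) by (auto simp: dist_norm)
  note bb = bounded_bilinear_matrix_mul
  have small: "((\<lambda>A'. (A' - A) ** G) \<longlongrightarrow> 0) (at A within ?M)" for G :: "real^'n^'n"
  proof -
    have "((\<lambda>A'. (A' - A) ** G) \<longlongrightarrow> (A - A) ** G) (at A within ?M)"
      by (intro tendsto_matrix_mul tendsto_intros)
    then show ?thesis by simp
  qed
  have bdd: "Bfun pinv (at A within ?M)"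
    by (rule BfunI[of _ C]) (use ev C(2) in \<open>auto elim: eventually_mono\<close>)
  have null: "((\<lambda>A'. pinv A' ** g A') \<longlongrightarrow> 0) (at A within ?M)"
    if "(g \<longlongrightarrow> 0) (at A within ?M)" for g :: "real^'n^'n \<Rightarrow> real^'n^'n"
    using bounded_bilinear.Bfun_prod_Zfun[OF bb bdd, of g] that by (simp add: tendsto_Zfun_iff)
  have null': "((\<lambda>A'. A' ** g A') \<longlongrightarrow> 0) (at A within ?M)"
    if "(g \<longlongrightarrow> 0) (at A within ?M)" for g :: "real^'n^'n \<Rightarrow> real^'n^'n"
    using tendsto_matrix_mul[OF tendsto_ident_at that] by simp
  have "((\<lambda>A'. pinv A + (- (pinv A' ** ((A' - A) ** pinv A))
     + pinv A' ** (pinv A' ** ((A' - A) ** (mat 1 - A ** pinv A)))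
     + ((A' - A) ** (pinv A ** pinv A) - A' ** (pinv A' ** ((A' - A) ** (pinv A ** pinv A))))))
     \<longlongrightarrow> pinv A + (- 0 + 0 + (0 - 0))) (at A within ?M)"
    by (intro tendsto_add tendsto_minus tendsto_diff tendsto_const null null' small)
  then have "(pinv \<longlongrightarrow> pinv A + (- 0 + 0 + (0 - 0))) (at A within ?M)"
  proof (rule Lim_transform_eventually)
    show "\<forall>\<^sub>F A' in at A within ?M. pinv A + (- (pinv A' ** ((A' - A) ** pinv A))
     + pinv A' ** (pinv A' ** ((A' - A) ** (mat 1 - A ** pinv A)))
     + ((A' - A) ** (pinv A ** pinv A) - A' ** (pinv A' ** ((A' - A) ** (pinv A ** pinv A))))) = pinv A'"
      using ev
    proof (rule eventually_mono)
      fix A' assume A': "A' \<in> ?M \<and> norm (A' - A) < e"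
      have "(mat 1 - A' ** pinv A') ** X = X - A' ** (pinv A' ** X)" for X
        by (simp add: matrix_distribs matrix_mul_assoc)
      note eq = pinv_difference[OF A conjunct1[OF A'], unfolded this matrix_mul_assoc[symmetric]]
      show "pinv A + (- (pinv A' ** ((A' - A) ** pinv A))
     + pinv A' ** (pinv A' ** ((A' - A) ** (mat 1 - A ** pinv A)))
     + ((A' - A) ** (pinv A ** pinv A) - A' ** (pinv A' ** ((A' - A) ** (pinv A ** pinv A))))) = pinv A'"
        using eq by (simp only: eq_diff_eq add.commute[of "pinv A"] matrix_mul_assoc[symmetric] diff_eq_eq)
    qed
  qed
  then have lim: "(pinv \<longlongrightarrow> pinv A) (at A within ?M)" by simp
  have ident: "((\<lambda>A'. A' - A) has_derivative (\<lambda>h. h)) (at A within ?M)"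
    by (auto intro!: derivative_eq_intros)
  have vanish: "((\<lambda>A'. F A' ** ((A' - A) ** G)) has_derivative (\<lambda>h. F A ** (h ** G))) (at A within ?M)"
    if "(F \<longlongrightarrow> F A) (at A within ?M)" for F and G :: "real^'n^'n"
    by (rule has_derivative_bilinear_vanishing[OF bb _ _ that])
       (auto intro!: derivative_eq_intros bounded_linear.has_derivative[OF bounded_bilinear.bounded_linear_left[OF bb]] ident)
  have "((\<lambda>A'. pinv A + (- (pinv A' ** ((A' - A) ** pinv A))
     + pinv A' ** pinv A' ** ((A' - A) ** (mat 1 - A ** pinv A))
     + (mat 1 - A' ** pinv A') ** ((A' - A) ** (pinv A ** pinv A)))) has_derivative
     (\<lambda>c. 0 + pinv_deriv A c)) (at A within ?M)"
    by (intro has_derivative_add has_derivative_const has_derivative_minus vanish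
        tendsto_matrix_mul tendsto_diff tendsto_const lim tendsto_ident_at)
  then have "((\<lambda>A'. pinv A + (- (pinv A' ** ((A' - A) ** pinv A))
     + pinv A' ** pinv A' ** ((A' - A) ** (mat 1 - A ** pinv A))
     + (mat 1 - A' ** pinv A') ** ((A' - A) ** (pinv A ** pinv A)))) has_derivative
     pinv_deriv A) (at A within ?M)" by simp
  then show ?thesis
    by (rule has_derivative_transform[OF A, rotated])
       (use pinv_difference[OF A] in \<open>simp add: algebra_simps\<close>)
qed


section \<open>The metric in terms of the pseudoinverse\<close>

text \<open>For symmetric \<open>A\<close> this is the orthogonal projection onto the kernel.\<close>

definition coproj :: "real^'n^'n \<Rightarrow> real^'n^'n" where
  "coproj A = mat 1 - A ** pinv A"

text \<open>The velocities of curves of symmetric matrices of fixed rank have no block on the kernel.\<close>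

definition tangent :: "real^'n^'n \<Rightarrow> real^'n^'n \<Rightarrow> bool" where
  "tangent A b \<longleftrightarrow> transpose b = b \<and> coproj A ** b ** coproj A = 0"

text \<open>The metric without reference to a factorization. Writing its first term as an inner product makes
  the form symmetric for arbitrary ambient matrices \<open>a\<close>, \<open>b\<close>.\<close>

definition psd_form :: "real \<Rightarrow> real^'n^'n \<Rightarrow> real^'n^'n \<Rightarrow> real^'n^'n \<Rightarrow> real" where
  "psd_form k A a b =
     (pinv A ** a ** coproj A) \<bullet> (pinv A ** b ** coproj A) + k * trace (pinv A ** a ** pinv A ** b)"

lemma coproj_stiefel_conj:
  fixes U :: "real^'p^'n"
  assumes U: "U \<in> stiefel" and S: "S \<in> spd_matrices"
  shows "coproj (U ** S ** transpose U) = mat 1 - U ** transpose U"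
  unfolding coproj_def pinv_stiefel_conj[OF U S]
  by (simp add: matrix_mul_assoc[symmetric] matrix_mul_reassoc[OF stiefelD[OF U]]
      matrix_mul_reassoc[OF matrix_inv_spd(1)[OF S]])

lemma quotient_map_derivative:
  "frechet_derivative quotient_map (at (U, S)) (\<Delta>, D) =
     \<Delta> ** S ** transpose U + U ** D ** transpose U + U ** S ** transpose \<Delta>"
  for U :: "real^'p^'n"
proof -
  have "(quotient_map has_derivative (\<lambda>(\<Delta>, D). \<Delta> ** S ** transpose U + U ** D ** transpose U + U ** S ** transpose \<Delta>))
      (at (U, S))"
    unfolding quotient_map_def case_prod_beta'
  proof (rule has_derivative_eq_rhs)
    show "((\<lambda>x. fst x ** snd x ** transpose (fst x)) has_derivative
        (\<lambda>h. fst (U, S) ** snd (U, S) ** transpose (fst h) +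
          (fst (U, S) ** snd h + fst h ** snd (U, S)) ** transpose (fst (U, S)))) (at (U, S))"
      by (intro has_derivative_matrix_mul bounded_linear.has_derivative[OF bounded_linear_transpose]
          has_derivative_fst has_derivative_snd has_derivative_ident)
  qed (simp add: matrix_distribs fun_eq_iff)
  from fun_cong[OF frechet_derivative_at[OF this], of "(\<Delta>, D)"] show ?thesis by simp
qed

text \<open>The two blocks of the horizontal vector are recovered from its image \<open>a\<close> at \<open>A = U R\<^sup>2 U\<^sup>T\<close>: with \<open>B = pinv A\<close>,
  the block of \<open>B a\<close> off the range is \<open>U \<Delta>\<^sup>T\<close>, and \<open>B a B\<close> is \<open>U R\<^sup>-\<^sup>2 D R\<^sup>-\<^sup>2 U\<^sup>T\<close>.\<close>

lemma psd_form_horizontal: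
  fixes U \<Delta>1 \<Delta>2 :: "real^'p^'n"
  assumes U: "U \<in> stiefel" and R: "R \<in> spd_matrices"
    and h: "(\<Delta>1, D1) \<in> horizontal U R" "(\<Delta>2, D2) \<in> horizontal U R"
  shows "horizontal_metric k R (\<Delta>1, D1) (\<Delta>2, D2) =
    psd_form k (quotient_map (U, R ** R))
      (frechet_derivative quotient_map (at (U, R ** R)) (\<Delta>1, D1))
      (frechet_derivative quotient_map (at (U, R ** R)) (\<Delta>2, D2))"
proof -
  define Q where "Q = matrix_inv R"
  note Rt = spd_transpose[OF R]
  have RQ: "R ** Q = mat 1" "Q ** R = mat 1" "transpose Q = Q"
    using matrix_inv_spd[OF R] by (auto simp: Q_def)
  note UU = stiefelD[OF U]
  have U1: "transpose U ** \<Delta>1 = 0" "transpose U ** \<Delta>2 = 0"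
    using horizontalD(1)[OF h(1)] horizontalD(1)[OF h(2)] by auto
  then have U2: "transpose \<Delta>1 ** U = 0" "transpose \<Delta>2 ** U = 0"
    by (metis matrix_transpose_mul transpose_transpose transpose_zero)+
  have RR: "R ** R \<in> spd_matrices"
    using spd_congruence[OF spd_mat_1 RQ(2)] by (simp add: Rt)
  have inv: "matrix_inv (R ** R) = Q ** Q"
    by (rule matrix_inv_unique) (simp add: matrix_mul_assoc[symmetric] matrix_mul_reassoc[OF RQ(1)] RQ)
  have B: "pinv (quotient_map (U, R ** R)) = U ** (Q ** Q) ** transpose U"
    using pinv_stiefel_conj[OF U RR] by (simp add: quotient_map_def inv)
  have c: "coproj (quotient_map (U, R ** R)) = mat 1 - U ** transpose U"
    using coproj_stiefel_conj[OF U RR] by (simp add: quotient_map_def)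
  note re = matrix_mul_reassoc[OF UU] matrix_mul_reassoc[OF RQ(1)] matrix_mul_reassoc[OF RQ(2)]
    matrix_mul_reassoc[OF U1(1)] matrix_mul_reassoc[OF U1(2)]
    matrix_mul_reassoc[OF U2(1)] matrix_mul_reassoc[OF U2(2)] UU RQ U1 U2
  let ?a = "frechet_derivative quotient_map (at (U, R ** R)) (\<Delta>1, D1)"
  let ?b = "frechet_derivative quotient_map (at (U, R ** R)) (\<Delta>2, D2)"
  let ?A = "quotient_map (U, R ** R)"
  have "pinv ?A ** ?a ** coproj ?A = U ** transpose \<Delta>1" "pinv ?A ** ?b ** coproj ?A = U ** transpose \<Delta>2"
    unfolding B c quotient_map_derivative
    by (simp_all add: matrix_distribs matrix_mul_assoc[symmetric] re)
  then have "(pinv ?A ** ?a ** coproj ?A) \<bullet> (pinv ?A ** ?b ** coproj ?A) = trace (\<Delta>1 ** transpose \<Delta>2)"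
    by (simp add: trace_inner[symmetric] transpose_simps matrix_mul_assoc[symmetric] re)
  also have "\<dots> = trace (transpose \<Delta>2 ** \<Delta>1)" by (rule trace_mul_sym)
  finally have 1: "(pinv ?A ** ?a ** coproj ?A) \<bullet> (pinv ?A ** ?b ** coproj ?A) = trace (transpose \<Delta>1 ** \<Delta>2)"
    by (simp add: trace_inner inner_commute)
  have 2: "pinv ?A ** ?a ** pinv ?A ** ?b
      = U ** (Q ** Q ** D1 ** Q ** Q ** D2 ** transpose U + Q ** Q ** D1 ** transpose \<Delta>2)"
    unfolding B c quotient_map_derivative
    by (simp add: matrix_distribs matrix_mul_assoc[symmetric] re)
  have "trace (pinv ?A ** ?a ** pinv ?A ** ?b)
      = trace ((Q ** Q ** D1 ** Q ** Q ** D2 ** transpose U + Q ** Q ** D1 ** transpose \<Delta>2) ** U)"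
    unfolding 2 by (rule trace_mul_sym)
  also have "\<dots> = trace (Q ** (Q ** D1 ** Q ** Q ** D2))"
    by (simp add: matrix_distribs matrix_mul_assoc[symmetric] re)
  also have "\<dots> = trace (Q ** D1 ** (Q ** Q) ** D2 ** Q)"
    by (subst trace_mul_sym) (simp add: matrix_mul_assoc)
  finally show ?thesis
    by (simp add: horizontal_metric_def psd_form_def 1 Q_def)
qed

lemma tangent_ex_horizontal:
  fixes U :: "real^'p^'n"
  assumes U: "U \<in> stiefel" and R: "R \<in> spd_matrices" and card: "CARD('p) < CARD('n)"
    and a: "tangent (quotient_map (U, R ** R)) a"
  shows "\<exists>\<xi>\<in>horizontal U R. a = frechet_derivative quotient_map (at (U, R ** R)) \<xi>"
proof -
  define Q where "Q = matrix_inv R"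
  note Rt = spd_transpose[OF R]
  have RQ: "R ** Q = mat 1" "Q ** R = mat 1" "transpose Q = Q"
    using matrix_inv_spd[OF R] by (auto simp: Q_def)
  note UU = stiefelD[OF U]
  obtain V :: "real^('n, 'p) codim^'n" where V: "V \<in> stiefel" "transpose U ** V = 0" "transpose V ** U = 0"
    "U ** transpose U + V ** transpose V = mat 1" using ex_stiefel_complement[OF U card] by blast
  have RR: "R ** R \<in> spd_matrices"
    using spd_congruence[OF spd_mat_1 RQ(2)] by (simp add: Rt)
  have c: "coproj (quotient_map (U, R ** R)) = V ** transpose V"
    using coproj_stiefel_conj[OF U RR] V(4)[symmetric] by (simp add: quotient_map_def)
  have at: "transpose a = a" and a0: "V ** (transpose V ** (a ** (V ** transpose V))) = 0"
    using a unfolding tangent_def c by (auto simp: matrix_mul_assoc)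
  define \<xi> where "\<xi> = (V ** (transpose V ** a ** U ** Q ** Q), R ** (Q ** (transpose U ** a ** U) ** Q) ** R)"
  have "\<xi> \<in> horizontal U R"
  proof -
    have "Q ** (transpose U ** a ** U) ** Q \<in> sym_matrices"
      by (simp add: sym_matrices_def transpose_simps RQ at matrix_mul_assoc)
    then show ?thesis unfolding \<xi>_def horizontal_def using V(1,2) by blast
  qed
  moreover have "a = frechet_derivative quotient_map (at (U, R ** R)) \<xi>"
  proof -
    have "a = (U ** transpose U + V ** transpose V) ** a ** (U ** transpose U + V ** transpose V)"
      by (simp add: V(4))
    also have "\<dots> = V ** transpose V ** a ** U ** transpose U + U ** transpose U ** a ** U ** transpose U
       + U ** transpose U ** a ** V ** transpose V"
      by (simp add: matrix_distribs matrix_mul_assoc[symmetric] a0)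
    also have "\<dots> = frechet_derivative quotient_map (at (U, R ** R)) \<xi>"
      unfolding \<xi>_def quotient_map_derivative
      by (simp add: transpose_simps RQ Rt at matrix_mul_assoc[symmetric] matrix_mul_reassoc[OF RQ(1)] matrix_mul_reassoc[OF RQ(2)])
    finally show ?thesis .
  qed
  ultimately show ?thesis by blast
qed

text \<open>Every factorization and every pair of horizontal representatives gives the same value, so the
  definite description is resolved.\<close>

lemma psd_metric_eq_psd_form:
  fixes A :: "real^'n^'n"
  assumes A: "A \<in> psd_rank CARD('p::finite)" and card: "CARD('p) < CARD('n)"
    and t: "tangent A a" "tangent A b"
  shows "psd_metric TYPE('p) k A a b = psd_form k A a b"
  unfolding psd_metric_def
proof (rule the_equality)
  obtain U :: "real^'p^'n" and S where US: "U \<in> stiefel" "S \<in> spd_matrices" "A = U ** S ** transpose U"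
    using psd_rank_factorization[OF A] by blast
  obtain R where R: "R \<in> spd_matrices" "R ** R = S" using spd_sqrt[OF US(2)] by blast
  have AR: "A = quotient_map (U, R ** R)" by (simp add: quotient_map_def US(3) R(2))
  obtain \<xi> \<eta> where h: "\<xi> \<in> horizontal U R" "\<eta> \<in> horizontal U R"
    "a = frechet_derivative quotient_map (at (U, R ** R)) \<xi>"
    "b = frechet_derivative quotient_map (at (U, R ** R)) \<eta>"
    using tangent_ex_horizontal[OF US(1) R(1) card] t unfolding AR by metis
  then have "psd_form k A a b = horizontal_metric k R \<xi> \<eta>"
    using psd_form_horizontal[OF US(1) R(1), of "fst \<xi>" "snd \<xi>" "fst \<eta>" "snd \<eta>" k] AR by simp
  then show "\<exists>(U :: real^'p^'n) R \<xi> \<eta>. U \<in> stiefel \<and> R \<in> spd_matrices \<and> A = quotient_map (U, R ** R) \<and>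
      \<xi> \<in> horizontal U R \<and> \<eta> \<in> horizontal U R \<and>
      a = frechet_derivative quotient_map (at (U, R ** R)) \<xi> \<and>
      b = frechet_derivative quotient_map (at (U, R ** R)) \<eta> \<and>
      psd_form k A a b = horizontal_metric k R \<xi> \<eta>"
    using US(1) R(1) AR h by blast
next
  fix c
  assume "\<exists>(U :: real^'p^'n) R \<xi> \<eta>. U \<in> stiefel \<and> R \<in> spd_matrices \<and> A = quotient_map (U, R ** R) \<and>
      \<xi> \<in> horizontal U R \<and> \<eta> \<in> horizontal U R \<and>
      a = frechet_derivative quotient_map (at (U, R ** R)) \<xi> \<and>
      b = frechet_derivative quotient_map (at (U, R ** R)) \<eta> \<and>
      c = horizontal_metric k R \<xi> \<eta>"
  then show "c = psd_form k A a b"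
    using psd_form_horizontal by (metis surj_pair)
qed

section \<open>Second derivatives\<close>

text \<open>The second difference of \<open>g\<close> over a small parallelogram is a value of a mixed derivative.\<close>

lemma double_mean_value:
  fixes g gu guv :: "'a::real_normed_vector \<Rightarrow> real"
  assumes h: "h > 0" and W: "\<And>a b. 0 \<le> a \<Longrightarrow> a \<le> h \<Longrightarrow> 0 \<le> b \<Longrightarrow> b \<le> h \<Longrightarrow> x + a *\<^sub>R u + b *\<^sub>R v \<in> W"
    and gu: "\<And>y. y \<in> W \<Longrightarrow> ((\<lambda>s. g (y + s *\<^sub>R u)) has_real_derivative gu y) (at 0)"
    and guv: "\<And>y. y \<in> W \<Longrightarrow> ((\<lambda>s. gu (y + s *\<^sub>R v)) has_real_derivative guv y) (at 0)"
  shows "\<exists>a b. 0 < a \<and> a < h \<and> 0 < b \<and> b < h \<and>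
    g (x + h *\<^sub>R u + h *\<^sub>R v) - g (x + h *\<^sub>R u) - g (x + h *\<^sub>R v) + g x = h * h * guv (x + a *\<^sub>R u + b *\<^sub>R v)"
proof -
  have 1: "((\<lambda>s. g (x + s *\<^sub>R u + b *\<^sub>R v)) has_real_derivative gu (x + a *\<^sub>R u + b *\<^sub>R v)) (at a)"
    if "0 \<le> a" "a \<le> h" "0 \<le> b" "b \<le> h" for a b
    using gu[OF W[OF that]] DERIV_shift[of "\<lambda>s. g (x + s *\<^sub>R u + b *\<^sub>R v)" _ 0 a]
    by (simp add: algebra_simps)
  have 2: "((\<lambda>s. gu (x + a *\<^sub>R u + s *\<^sub>R v)) has_real_derivative guv (x + a *\<^sub>R u + b *\<^sub>R v)) (at b)"
    if "0 \<le> a" "a \<le> h" "0 \<le> b" "b \<le> h" for a b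
    using guv[OF W[OF that]] DERIV_shift[of "\<lambda>s. gu (x + a *\<^sub>R u + s *\<^sub>R v)" _ 0 b]
    by (simp add: algebra_simps)
  have "\<exists>a. 0 < a \<and> a < h \<and> (g (x + h *\<^sub>R u + h *\<^sub>R v) - g (x + h *\<^sub>R u + 0 *\<^sub>R v)) - (g (x + 0 *\<^sub>R u + h *\<^sub>R v) - g (x + 0 *\<^sub>R u + 0 *\<^sub>R v))
      = (h - 0) * (gu (x + a *\<^sub>R u + h *\<^sub>R v) - gu (x + a *\<^sub>R u + 0 *\<^sub>R v))"
    by (rule MVT2[OF h, of "\<lambda>a. g (x + a *\<^sub>R u + h *\<^sub>R v) - g (x + a *\<^sub>R u + 0 *\<^sub>R v)"
          "\<lambda>a. gu (x + a *\<^sub>R u + h *\<^sub>R v) - gu (x + a *\<^sub>R u + 0 *\<^sub>R v)"])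
       (intro DERIV_diff 1, use h in auto)
  then obtain a where a: "0 < a" "a < h"
    "g (x + h *\<^sub>R u + h *\<^sub>R v) - g (x + h *\<^sub>R u) - g (x + h *\<^sub>R v) + g x
      = h * (gu (x + a *\<^sub>R u + h *\<^sub>R v) - gu (x + a *\<^sub>R u + 0 *\<^sub>R v))"
    by (auto simp: algebra_simps)
  have "\<exists>b. 0 < b \<and> b < h \<and> gu (x + a *\<^sub>R u + h *\<^sub>R v) - gu (x + a *\<^sub>R u + 0 *\<^sub>R v) = (h - 0) * guv (x + a *\<^sub>R u + b *\<^sub>R v)"
    by (rule MVT2[OF h, of "\<lambda>b. gu (x + a *\<^sub>R u + b *\<^sub>R v)" "\<lambda>b. guv (x + a *\<^sub>R u + b *\<^sub>R v)"])
       (intro 2, use a in auto)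
  then obtain b where b: "0 < b" "b < h"
    "gu (x + a *\<^sub>R u + h *\<^sub>R v) - gu (x + a *\<^sub>R u + 0 *\<^sub>R v) = h * guv (x + a *\<^sub>R u + b *\<^sub>R v)" by auto
  show ?thesis
    using a(1,2) b(1,2) a(3)[unfolded b(3)] by (intro exI[of _ a] exI[of _ b]) (simp add: mult.assoc)
qed

text \<open>The second difference is symmetric in \<open>u\<close> and \<open>v\<close>, and it approximates both mixed derivatives.\<close>

lemma mixed_derivatives_equal:
  fixes g gu gv guv gvu :: "'a::real_normed_vector \<Rightarrow> real"
  assumes W: "open W" "x \<in> W"
    and gu: "\<And>y. y \<in> W \<Longrightarrow> ((\<lambda>s. g (y + s *\<^sub>R u)) has_real_derivative gu y) (at 0)"
    and gv: "\<And>y. y \<in> W \<Longrightarrow> ((\<lambda>s. g (y + s *\<^sub>R v)) has_real_derivative gv y) (at 0)"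
    and guv: "\<And>y. y \<in> W \<Longrightarrow> ((\<lambda>s. gu (y + s *\<^sub>R v)) has_real_derivative guv y) (at 0)"
    and gvu: "\<And>y. y \<in> W \<Longrightarrow> ((\<lambda>s. gv (y + s *\<^sub>R u)) has_real_derivative gvu y) (at 0)"
    and cont: "continuous_on W guv" "continuous_on W gvu"
  shows "guv x = gvu x"
proof (rule ccontr)
  assume ne: "guv x \<noteq> gvu x"
  define e where "e = \<bar>guv x - gvu x\<bar> / 2"
  have e: "e > 0" using ne by (simp add: e_def)
  obtain d0 where d0: "d0 > 0" "ball x d0 \<subseteq> W" using W open_contains_ball by blast
  have "isCont guv x" "isCont gvu x" using cont W by (auto simp: continuous_on_eq_continuous_at)
  then obtain d1 d2 where d1: "d1 > 0" "\<And>y. dist y x < d1 \<Longrightarrow> dist (guv y) (guv x) < e"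
    and d2: "d2 > 0" "\<And>y. dist y x < d2 \<Longrightarrow> dist (gvu y) (gvu x) < e"
    using e unfolding continuous_at_eps_delta by metis
  define d where "d = min d0 (min d1 d2)"
  have d: "d > 0" "d \<le> d0" "d \<le> d1" "d \<le> d2" using d0 d1 d2 by (auto simp: d_def)
  (* the parallelogram spanned by h u and h v at x then stays within distance d of x *)
  define h where "h = d / (2 * (norm u + norm v + 1))"
  have h: "h > 0" using d by (simp add: h_def add_nonneg_pos)
  have small: "dist (x + a *\<^sub>R u + b *\<^sub>R v) x < d" if "0 \<le> a" "a \<le> h" "0 \<le> b" "b \<le> h" for a b
  proof -
    have "dist (x + a *\<^sub>R u + b *\<^sub>R v) x = norm (a *\<^sub>R u + b *\<^sub>R v)" by (simp add: dist_norm)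
    also have "\<dots> \<le> h * norm u + h * norm v"
      using that by (intro norm_triangle_le add_mono) (auto intro: mult_right_mono)
    also have "\<dots> \<le> h * (norm u + norm v + 1)" using h by (simp add: algebra_simps)
    also have "\<dots> = d / 2"
      unfolding h_def by (simp add: divide_simps) (smt (verit) norm_ge_zero)
    finally show ?thesis using d(1) by linarith
  qed
  have inW: "x + a *\<^sub>R u + b *\<^sub>R v \<in> W" if "0 \<le> a" "a \<le> h" "0 \<le> b" "b \<le> h" for a b
    using small[OF that] d0(2) d(2) by (auto simp: ball_def dist_commute)
  have inW': "x + a *\<^sub>R v + b *\<^sub>R u \<in> W" if "0 \<le> a" "a \<le> h" "0 \<le> b" "b \<le> h" for a b
    using inW[OF that(3,4,1,2)] by (simp add: algebra_simps)
  obtain a b where ab: "0 < a" "a < h" "0 < b" "b < h"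
    "g (x + h *\<^sub>R u + h *\<^sub>R v) - g (x + h *\<^sub>R u) - g (x + h *\<^sub>R v) + g x = h * h * guv (x + a *\<^sub>R u + b *\<^sub>R v)"
    using double_mean_value[where g = g and gu = gu and guv = guv and u = u and v = v, OF h inW gu guv] by blast
  obtain a' b' where ab': "0 < a'" "a' < h" "0 < b'" "b' < h"
    "g (x + h *\<^sub>R v + h *\<^sub>R u) - g (x + h *\<^sub>R v) - g (x + h *\<^sub>R u) + g x = h * h * gvu (x + a' *\<^sub>R v + b' *\<^sub>R u)"
    using double_mean_value[where g = g and gu = gv and guv = gvu and u = v and v = u, OF h inW' gv gvu] by blast
  have "h * h * guv (x + a *\<^sub>R u + b *\<^sub>R v) = h * h * gvu (x + b' *\<^sub>R u + a' *\<^sub>R v)"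
    using ab(5) ab'(5) by (simp add: algebra_simps)
  then have eq: "guv (x + a *\<^sub>R u + b *\<^sub>R v) = gvu (x + b' *\<^sub>R u + a' *\<^sub>R v)" using h by simp
  have "dist (guv (x + a *\<^sub>R u + b *\<^sub>R v)) (guv x) < e"
    using small[of a b] ab d by (intro d1(2)) auto
  moreover have "dist (gvu (x + b' *\<^sub>R u + a' *\<^sub>R v)) (gvu x) < e"
    using small[of b' a'] ab' d by (intro d2(2)) auto
  ultimately have "\<bar>guv x - gvu x\<bar> < 2 * e" using eq by (simp add: dist_real_def)
  then show False by (simp add: e_def)
qed

abbreviation D1 :: "('a::real_normed_vector \<Rightarrow> 'b::real_normed_vector) \<Rightarrow> 'a \<Rightarrow> 'a \<Rightarrow> 'b" where
  "D1 f y u \<equiv> frechet_derivative f (at y) u"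

abbreviation D2 :: "('a::real_normed_vector \<Rightarrow> 'b::real_normed_vector) \<Rightarrow> 'a \<Rightarrow> 'a \<Rightarrow> 'a \<Rightarrow> 'b" where
  "D2 f y u v \<equiv> frechet_derivative (\<lambda>z. frechet_derivative f (at z) u) (at y) v"

lemma smooth_on_has_derivative_D1:
  "smooth_on W f \<Longrightarrow> y \<in> W \<Longrightarrow> ((\<lambda>z. D1 f z u) has_derivative D2 f y u) (at y)"
  by (rule smooth_on_imp_has_derivative[OF smooth_on_frechet_derivative])

lemma linear_D1: "smooth_on W f \<Longrightarrow> y \<in> W \<Longrightarrow> linear (D1 f y)"
  by (rule has_derivative_linear[OF smooth_on_imp_has_derivative])

lemma linear_D2: "smooth_on W f \<Longrightarrow> y \<in> W \<Longrightarrow> linear (D2 f y u)"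
  by (rule has_derivative_linear[OF smooth_on_has_derivative_D1])

lemma linear_D2_left:
  assumes W: "open W" and f: "smooth_on W f" and y: "y \<in> W"
  shows "linear (\<lambda>u. D2 f y u v)"
proof (rule linearI)
  fix u1 u2 c
  have "((\<lambda>z. D1 f z (u1 + u2)) has_derivative (\<lambda>v. D2 f y u1 v + D2 f y u2 v)) (at y)"
  proof (rule has_derivative_transform_within_open[OF _ W y])
    show "((\<lambda>z. D1 f z u1 + D1 f z u2) has_derivative (\<lambda>v. D2 f y u1 v + D2 f y u2 v)) (at y)"
      by (intro has_derivative_add smooth_on_has_derivative_D1[OF f y])
  qed (simp add: linear_add[OF linear_D1[OF f]])
  from fun_cong[OF frechet_derivative_at[OF this], of v]
  show "D2 f y (u1 + u2) v = D2 f y u1 v + D2 f y u2 v" by simp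
  have "((\<lambda>z. D1 f z (c *\<^sub>R u1)) has_derivative (\<lambda>v. c *\<^sub>R D2 f y u1 v)) (at y)"
  proof (rule has_derivative_transform_within_open[OF _ W y])
    show "((\<lambda>z. c *\<^sub>R D1 f z u1) has_derivative (\<lambda>v. c *\<^sub>R D2 f y u1 v)) (at y)"
      by (intro has_derivative_scaleR_right smooth_on_has_derivative_D1[OF f y])
  qed (simp add: linear_scale[OF linear_D1[OF f]])
  from fun_cong[OF frechet_derivative_at[OF this], of v]
  show "D2 f y (c *\<^sub>R u1) v = c *\<^sub>R D2 f y u1 v" by simp
qed

lemma D2_symmetric:
  fixes f :: "'a::real_normed_vector \<Rightarrow> 'b::euclidean_space"
  assumes W: "open W" and f: "smooth_on W f" and y: "y \<in> W"
  shows "D2 f y u v = D2 f y v u"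
proof (rule euclidean_eqI)
  fix w :: 'b assume "w \<in> Basis"
  have line: "((\<lambda>s. F (z + s *\<^sub>R c) \<bullet> w) has_real_derivative F' c \<bullet> w) (at 0)"
    if "(F has_derivative F') (at z)" for F F' z c
  proof -
    have F: "(F has_derivative F') (at (z + 0 *\<^sub>R c))" using that by simp
    have "((\<lambda>s. z + s *\<^sub>R c) has_derivative (\<lambda>s. s *\<^sub>R c)) (at 0)"
      by (auto intro!: derivative_eq_intros)
    from has_derivative_compose[OF this F]
    have "((\<lambda>s. F (z + s *\<^sub>R c) \<bullet> w) has_derivative (\<lambda>s. F' (s *\<^sub>R c) \<bullet> w)) (at 0)"
      by (auto intro!: derivative_eq_intros)
    then show ?thesis
      by (simp add: has_field_derivative_def linear_scale[OF has_derivative_linear[OF that]] mult_commute_abs)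
  qed
  have "D2 f y u v \<bullet> w = D2 f y v u \<bullet> w"
  proof (rule mixed_derivatives_equal[OF W y, where g = "\<lambda>z. f z \<bullet> w" and gu = "\<lambda>z. D1 f z u \<bullet> w"
        and gv = "\<lambda>z. D1 f z v \<bullet> w" and u = u and v = v])
    show "continuous_on W (\<lambda>z. D2 f z u v \<bullet> w)" "continuous_on W (\<lambda>z. D2 f z v u \<bullet> w)"
      by (intro continuous_intros smooth_on_imp_continuous_on smooth_on_frechet_derivative f)+
  qed (auto intro!: line smooth_on_imp_has_derivative[OF f] smooth_on_has_derivative_D1[OF f])
  then show "D2 f y u v \<bullet> w = D2 f y v u \<bullet> w" .
qed

lemma linear_axis_expansion:
  fixes f :: "real^'d \<Rightarrow> 'b::real_vector"
  assumes "linear f"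
  shows "f x = (\<Sum>i\<in>UNIV. x $ i *\<^sub>R f (axis i 1))"
proof -
  have "f x = f (\<Sum>i\<in>UNIV. x $ i *\<^sub>R axis i 1)"
    using basis_expansion[of x] by (simp add: scalar_mult_eq_scaleR)
  then show ?thesis by (simp add: linear_sum[OF assms] linear_scale[OF assms])
qed

lemma D1_along_curve:
  fixes f :: "real^'d \<Rightarrow> 'b::euclidean_space"
  assumes W: "open W" and f: "smooth_on W f" and x: "(x has_vector_derivative x') (at t)" "x t \<in> W"
    and u: "(u has_vector_derivative u') (at t)"
  shows "((\<lambda>s. D1 f (x s) (u s)) has_vector_derivative D1 f (x t) u' + D2 f (x t) (u t) x') (at t)"
proof -
  have D: "((\<lambda>s. D1 f (x s) c) has_vector_derivative D2 f (x t) c x') (at t)" for c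
  proof -
    have "((\<lambda>s. D1 f (x s) c) has_derivative (\<lambda>h. D2 f (x t) c (h *\<^sub>R x'))) (at t)"
      using has_derivative_compose[OF x(1)[unfolded has_vector_derivative_def] smooth_on_has_derivative_D1[OF f x(2)]] .
    then show ?thesis by (simp add: has_vector_derivative_def linear_scale[OF linear_D2[OF f x(2)]])
  qed
  have ui: "((\<lambda>s. u s $ i) has_vector_derivative u' $ i) (at t)" for i
    by (rule bounded_linear.has_vector_derivative[OF bounded_linear_vec_nth u])
  have sc: "((\<lambda>s. u s $ i *\<^sub>R D1 f (x s) (axis i 1)) has_vector_derivative
      u t $ i *\<^sub>R D2 f (x t) (axis i 1) x' + u' $ i *\<^sub>R D1 f (x t) (axis i 1)) (at t)" for i
    by (rule bounded_bilinear.has_vector_derivative[OF bounded_bilinear_scaleR ui D])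
  have "((\<lambda>s. \<Sum>i\<in>UNIV. u s $ i *\<^sub>R D1 f (x s) (axis i 1)) has_vector_derivative
     (\<Sum>i\<in>UNIV. u t $ i *\<^sub>R D2 f (x t) (axis i 1) x' + u' $ i *\<^sub>R D1 f (x t) (axis i 1))) (at t)"
    by (intro has_vector_derivative_sum sc)
  moreover have "(\<Sum>i\<in>UNIV. u t $ i *\<^sub>R D2 f (x t) (axis i 1) x' + u' $ i *\<^sub>R D1 f (x t) (axis i 1))
      = D1 f (x t) u' + D2 f (x t) (u t) x'"
    using linear_axis_expansion[OF linear_D1[OF f x(2)], of u']
      linear_axis_expansion[OF linear_D2_left[OF W f x(2)], of "u t" x']
    by (simp add: sum.distrib)
  moreover have "\<forall>\<^sub>F s in at t. (\<Sum>i\<in>UNIV. u s $ i *\<^sub>R D1 f (x s) (axis i 1)) = D1 f (x s) (u s)"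
  proof -
    have "continuous (at t) x" using x(1) has_vector_derivative_continuous by blast
    then have "\<forall>\<^sub>F s in at t. x s \<in> W"
      using W x(2) by (auto simp: continuous_at dest: topological_tendstoD)
    then show ?thesis
      by (rule eventually_mono) (simp add: linear_axis_expansion[OF linear_D1[OF f]])
  qed
  moreover have "(\<Sum>i\<in>UNIV. u t $ i *\<^sub>R D1 f (x t) (axis i 1)) = D1 f (x t) (u t)"
    by (rule linear_axis_expansion[OF linear_D1[OF f x(2)], symmetric])
  ultimately show ?thesis
    unfolding has_vector_derivative_def
    using has_derivative_transform_eventually[of "\<lambda>s. \<Sum>i\<in>UNIV. u s $ i *\<^sub>R D1 f (x s) (axis i 1)" _ t UNIV
        "\<lambda>s. D1 f (x s) (u s)"] by simp
qed

lemma smooth_on_curve_derivatives: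
  fixes \<gamma> :: "real \<Rightarrow> 'a::euclidean_space"
  assumes "smooth_on I \<gamma>"
  obtains \<gamma>1 \<gamma>2 where "\<And>t. t \<in> I \<Longrightarrow> (\<gamma> has_vector_derivative \<gamma>1 t) (at t)"
    "\<And>t. t \<in> I \<Longrightarrow> (\<gamma>1 has_vector_derivative \<gamma>2 t) (at t)"
proof
  have *: "(f has_vector_derivative D1 f t 1) (at t)" if "smooth_on I f" "t \<in> I"
    for f :: "real \<Rightarrow> 'a" and t
  proof -
    have eq: "D1 f t = (\<lambda>h. h *\<^sub>R D1 f t 1)"
    proof (rule ext)
      show "D1 f t h = h *\<^sub>R D1 f t 1" for h
        using linear_scale[OF linear_D1[OF that], of h 1] by simp
    qed
    show ?thesis
      unfolding has_vector_derivative_def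
      by (rule has_derivative_eq_rhs[OF smooth_on_imp_has_derivative[OF that] eq])
  qed
  show "(\<gamma> has_vector_derivative D1 \<gamma> t 1) (at t)" if "t \<in> I" for t
    by (rule *[OF assms that])
  show "((\<lambda>t. D1 \<gamma> t 1) has_vector_derivative D1 (\<lambda>t. D1 \<gamma> t 1) t 1) (at t)" if "t \<in> I" for t
    by (rule *[OF smooth_on_frechet_derivative[OF assms] that])
qed

section \<open>Curves in local coordinates\<close>

text \<open>If \<open>h\<close> is tangent to the identity, then the increments of \<open>x\<close> and of \<open>h \<circ> x\<close> agree to first
  order, provided that \<open>x\<close> is continuous.\<close>

lemma has_vector_derivative_implicit:
  fixes x :: "real \<Rightarrow> 'a::euclidean_space"
  assumes h: "(h has_derivative (\<lambda>y. y)) (at (x t))" and x: "isCont x t"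
    and hx: "((\<lambda>s. h (x s)) has_vector_derivative v) (at t)"
  shows "(x has_vector_derivative v) (at t)"
  unfolding has_vector_derivative_def has_derivative_at_alt
proof (intro conjI allI impI)
  show "bounded_linear (\<lambda>h. h *\<^sub>R v)" by (rule bounded_linear_scaleR_left)
  fix e :: real assume e: "0 < e"
  define C where "C = e / 2 + norm v"
  have C: "C > 0" using e by (simp add: C_def add_pos_nonneg)
  (* increments of x are at most twice those of h o x, and the remainder of h contributes at most e / 2 *)
  define d where "d = min (1/2) (e / (4 * C))"
  have d: "d > 0" "d \<le> 1/2" "d * (2 * C) \<le> e / 2"
  proof -
    show "d > 0" "d \<le> 1/2" using e C by (auto simp: d_def)
    have "d \<le> e / (4 * C)" by (simp add: d_def)
    then show "d * (2 * C) \<le> e / 2" using C by (simp add: field_simps)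
  qed
  obtain \<delta> where \<delta>: "\<delta> > 0" "\<And>y. norm (y - x t) < \<delta> \<Longrightarrow> norm (h y - h (x t) - (y - x t)) \<le> d * norm (y - x t)"
    using h d(1) unfolding has_derivative_at_alt by blast
  obtain d2 where d2: "d2 > 0" "\<And>s. norm (s - t) < d2 \<Longrightarrow> norm (x s - x t) < \<delta>"
    using x \<delta>(1) unfolding continuous_at_eps_delta dist_norm by blast
  obtain d1 where d1: "d1 > 0"
    "\<And>s. norm (s - t) < d1 \<Longrightarrow> norm (h (x s) - h (x t) - (s - t) *\<^sub>R v) \<le> e / 2 * norm (s - t)"
    using hx half_gt_zero[OF e] unfolding has_vector_derivative_def has_derivative_at_alt by blast
  have "norm (x s - x t - (s - t) *\<^sub>R v) \<le> e * norm (s - t)" if s: "norm (s - t) < min d1 d2" for s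
  proof -
    let ?y = "x s - x t" and ?\<Delta> = "h (x s) - h (x t)"
    define w where "w = (s - t) *\<^sub>R v"
    have nw: "norm w = norm v * norm (s - t)" by (simp add: w_def)
    have 1: "norm (?\<Delta> - w) \<le> e / 2 * norm (s - t)" using d1(2) s by (simp add: w_def)
    have "norm ?\<Delta> \<le> norm (?\<Delta> - w) + norm w"
      using norm_triangle_sub[of ?\<Delta> w] by simp
    then have 2: "norm ?\<Delta> \<le> C * norm (s - t)" using 1 nw by (simp add: C_def algebra_simps)
    have 3: "norm (?\<Delta> - ?y) \<le> d * norm ?y" using \<delta>(2) d2(2) s by simp
    also have "\<dots> \<le> 1/2 * norm ?y" using d by (intro mult_right_mono) auto
    finally have "norm ?y \<le> 2 * norm ?\<Delta>"
      using norm_triangle_sub[of ?y ?\<Delta>] by (simp add: norm_minus_commute)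
    then have "d * norm ?y \<le> d * (2 * (C * norm (s - t)))" using 2 d by (intro mult_left_mono) auto
    also have "\<dots> = d * (2 * C) * norm (s - t)" by simp
    also have "\<dots> \<le> e / 2 * norm (s - t)" using d by (intro mult_right_mono) auto
    finally have "norm (?\<Delta> - ?y) \<le> e / 2 * norm (s - t)" using 3 by linarith
    then have "norm ((?\<Delta> - w) - (?\<Delta> - ?y)) \<le> e * norm (s - t)"
      using 1 norm_triangle_ineq4[of "?\<Delta> - w" "?\<Delta> - ?y"] by linarith
    moreover have "(?\<Delta> - w) - (?\<Delta> - ?y) = x s - x t - (s - t) *\<^sub>R v" by (simp add: w_def)
    ultimately show ?thesis by simp
  qed
  then show "\<exists>d>0. \<forall>y. norm (y - t) < d \<longrightarrow> norm (x y - x t - (y - t) *\<^sub>R v) \<le> e * norm (y - t)"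
    using d1(1) d2(1) by (intro exI[of _ "min d1 d2"]) auto
qed

text \<open>The coordinate curve of a twice differentiable curve is twice differentiable: with a left
  inverse \<open>\<pi>\<close> of the differential at one point, \<open>\<pi> \<circ> \<phi>\<close> is tangent to the identity there, and the
  velocity \<open>x'\<close> solves a linear equation whose coefficient matrix is differentiable and equal to the
  identity at that point.\<close>

lemma chart_curve_lift:
  fixes \<phi> :: "real^'d \<Rightarrow> 'a::euclidean_space" and \<gamma> :: "real \<Rightarrow> 'a"
  assumes lp: "local_parametrization M W \<phi>" and I: "open I" and \<gamma>M: "\<gamma> ` I \<subseteq> M"
    and \<gamma>1: "\<And>t. t \<in> I \<Longrightarrow> (\<gamma> has_vector_derivative \<gamma>1 t) (at t)"
    and \<gamma>2: "\<And>t. t \<in> I \<Longrightarrow> (\<gamma>1 has_vector_derivative \<gamma>2 t) (at t)"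
    and x_def: "x = inv_into W \<phi> \<circ> \<gamma>"
    and J_def: "J = {t \<in> I. \<gamma> t \<in> \<phi> ` W}"
  shows "open J" "\<And>t. t \<in> J \<Longrightarrow> x t \<in> W \<and> \<phi> (x t) = \<gamma> t"
    "\<exists>x' x''. \<forall>t\<in>J. (x has_vector_derivative x' t) (at t) \<and> (x' has_vector_derivative x'' t) (at t) \<and>
       D1 \<phi> (x t) (x' t) = \<gamma>1 t \<and> D1 \<phi> (x t) (x'' t) + D2 \<phi> (x t) (x' t) (x' t) = \<gamma>2 t"
proof -
  obtain \<psi> where W: "open W" and sm: "smooth_on W \<phi>" and inj: "\<And>y. y \<in> W \<Longrightarrow> inj (D1 \<phi> y)"
    and op: "openin (top_of_set M) (\<phi> ` W)" and hom: "homeomorphism W (\<phi> ` W) \<phi> \<psi>"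
    using lp by (auto simp: local_parametrization_def)
  have \<psi>: "\<psi> (\<phi> y) = y" if "y \<in> W" for y using hom that by (auto simp: homeomorphism_def)
  then have injW: "inj_on \<phi> W" by (metis inj_onI)
  have x\<psi>: "x t = \<psi> (\<gamma> t)" if "t \<in> J" for t
    using that injW \<psi> by (auto simp: x_def J_def)
  have cont\<gamma>: "continuous_on I \<gamma>"
    using \<gamma>1 by (auto intro: continuous_at_imp_continuous_on has_vector_derivative_continuous)
  obtain T where T: "open T" "\<phi> ` W = M \<inter> T" using op by (auto simp: openin_open)
  have "J = I \<inter> \<gamma> -` T" using T \<gamma>M by (auto simp: J_def)
  then show J: "open J" using continuous_open_preimage[OF cont\<gamma> I T(1)] by simp
  show xW: "x t \<in> W \<and> \<phi> (x t) = \<gamma> t" if "t \<in> J" for t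
    using that x\<psi>[OF that] \<psi> by (auto simp: J_def)
  have "continuous_on J (\<psi> \<circ> \<gamma>)"
  proof (rule continuous_on_compose)
    show "continuous_on J \<gamma>" by (rule continuous_on_subset[OF cont\<gamma>]) (auto simp: J_def)
    show "continuous_on (\<gamma> ` J) \<psi>"
      by (rule continuous_on_subset[of "\<phi> ` W"]) (use hom in \<open>auto simp: homeomorphism_def J_def\<close>)
  qed
  then have "continuous_on J x" using x\<psi> by (simp cong: continuous_on_cong)
  then have contx: "isCont x t" if "t \<in> J" for t using J that by (simp add: continuous_on_eq_continuous_at)
  have left_inv: "\<exists>\<pi>. bounded_linear \<pi> \<and> (\<forall>y. \<pi> (D1 \<phi> (x t) y) = y)" if t: "t \<in> J" for t
  proof -
    have "x t \<in> W" using xW[OF t] by simp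
    then obtain \<pi> where "linear \<pi>" "\<pi> \<circ> D1 \<phi> (x t) = id"
      using linear_injective_left_inverse[OF linear_D1[OF sm] inj] by blast
    then show ?thesis by (metis comp_apply id_apply linear_conv_bounded_linear)
  qed
  have "\<exists>v. (x has_vector_derivative v) (at t) \<and> D1 \<phi> (x t) v = \<gamma>1 t" if t: "t \<in> J" for t
  proof -
    obtain \<pi> where \<pi>: "bounded_linear \<pi>" "\<And>y. \<pi> (D1 \<phi> (x t) y) = y" using left_inv[OF t] by blast
    have tI: "t \<in> I" using t by (simp add: J_def)
    have D\<phi>: "(\<phi> has_derivative D1 \<phi> (x t)) (at (x t))"
      using smooth_on_imp_has_derivative[OF sm] xW[OF t] by blast
    have "((\<lambda>y. \<pi> (\<phi> y)) has_derivative (\<lambda>y. y)) (at (x t))"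
      using bounded_linear.has_derivative[OF \<pi>(1) D\<phi>] by (simp add: \<pi>(2))
    moreover have "((\<lambda>s. \<pi> (\<phi> (x s))) has_vector_derivative \<pi> (\<gamma>1 t)) (at t)"
      by (rule has_vector_derivative_transform_within_open[OF
            bounded_linear.has_vector_derivative[OF \<pi>(1) \<gamma>1[OF tI]] J t])
         (simp add: xW)
    ultimately have x': "(x has_vector_derivative \<pi> (\<gamma>1 t)) (at t)"
      using has_vector_derivative_implicit[where h = "\<lambda>y. \<pi> (\<phi> y)"] contx[OF t] by blast
    have "((\<lambda>s. \<phi> (x s)) has_vector_derivative D1 \<phi> (x t) (\<pi> (\<gamma>1 t))) (at t)"
      using has_derivative_compose[OF x'[unfolded has_vector_derivative_def] D\<phi>]
      by (simp add: has_vector_derivative_def linear_scale[OF has_derivative_linear[OF D\<phi>]])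
    moreover have "((\<lambda>s. \<phi> (x s)) has_vector_derivative \<gamma>1 t) (at t)"
      by (rule has_vector_derivative_transform_within_open[OF \<gamma>1[OF tI] J t]) (simp add: xW)
    ultimately have "D1 \<phi> (x t) (\<pi> (\<gamma>1 t)) = \<gamma>1 t" by (rule vector_derivative_unique_at)
    then show ?thesis using x' by blast
  qed
  then obtain x' where x': "\<And>t. t \<in> J \<Longrightarrow> (x has_vector_derivative x' t) (at t)"
    "\<And>t. t \<in> J \<Longrightarrow> D1 \<phi> (x t) (x' t) = \<gamma>1 t" by metis
  have "\<exists>v. (x' has_vector_derivative v) (at t)" if t: "t \<in> J" for t
  proof -
    obtain \<pi> where \<pi>: "bounded_linear \<pi>" "\<And>y. \<pi> (D1 \<phi> (x t) y) = y" using left_inv[OF t] by blast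
    have tI: "t \<in> I" using t by (simp add: J_def)
    have xtW: "x t \<in> W" using xW[OF t] by simp
    define N :: "real \<Rightarrow> real^'d^'d" where "N s = (\<chi> i j. \<pi> (D1 \<phi> (x s) (axis j 1)) $ i)" for s
    have Nv: "N s *v u = \<pi> (D1 \<phi> (x s) u)" if "s \<in> J" for s u
    proof -
      have "linear (\<lambda>u. \<pi> (D1 \<phi> (x s) u))"
        using linear_compose[OF linear_D1[OF sm] bounded_linear.linear[OF \<pi>(1)]] xW[OF that]
        by (simp add: o_def)
      from linear_axis_expansion[OF this, of u] show ?thesis
        by (simp add: N_def matrix_vector_mult_def vec_eq_iff mult.commute)
    qed
    have N0: "N t = mat 1"
      using Nv[OF t] \<pi>(2) by (simp add: matrix_eq)
    define N' :: "real^'d^'d" where "N' = (\<chi> i j. \<pi> (D2 \<phi> (x t) (axis j 1) (x' t)) $ i)"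
    have "(N has_vector_derivative N') (at t)"
    proof (rule has_vector_derivative_matrixI)
      fix i j
      have "((\<lambda>s. D1 \<phi> (x s) (axis j 1)) has_vector_derivative D2 \<phi> (x t) (axis j 1) (x' t)) (at t)"
        using D1_along_curve[OF W sm x'(1)[OF t] xtW has_vector_derivative_const[of "axis j 1"]]
        by (simp add: linear_0[OF linear_D1[OF sm xtW]])
      then show "((\<lambda>s. N s $ i $ j) has_vector_derivative N' $ i $ j) (at t)"
        unfolding N_def N'_def
        by (simp add: bounded_linear.has_vector_derivative[OF bounded_linear_vec_nth]
            bounded_linear.has_vector_derivative[OF \<pi>(1)])
    qed
    then have dN: "((\<lambda>s. N s - mat 1) has_derivative (\<lambda>h. h *\<^sub>R N')) (at t)"
      unfolding has_vector_derivative_def by (auto intro!: derivative_eq_intros)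
    let ?r = "\<lambda>s. \<pi> (\<gamma>1 s)"
    have dr: "(?r has_vector_derivative \<pi> (\<gamma>2 t)) (at t)"
      by (rule bounded_linear.has_vector_derivative[OF \<pi>(1) \<gamma>2[OF tI]])
    have eq: "x' s = ?r s - (N s - mat 1) *v x' s" if "s \<in> J" for s
      using Nv[OF that, of "x' s"] x'(2)[OF that] by (simp add: matrix_vector_mult_diff_rdistrib)
    have evJ: "\<forall>\<^sub>F s in at t. s \<in> J" using J t by (rule eventually_at_in_open')
    note bb = bounded_bilinear_matrix_vector_mul
    have N_lim: "((\<lambda>s. N s - mat 1) \<longlongrightarrow> 0) (at t)"
      using has_derivative_continuous[OF dN] by (simp add: continuous_at N0)
    have r_lim: "(?r \<longlongrightarrow> ?r t) (at t)"
      using has_vector_derivative_continuous[OF dr] by (simp add: continuous_at)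
    obtain K where K: "K > 0" "\<And>(A :: real^'d^'d) y. norm (A *v y) \<le> norm A * norm y * K"
      using bounded_bilinear.pos_bounded[OF bb] by blast
    have "\<forall>\<^sub>F s in at t. norm (x' s) \<le> 2 * (norm (?r t) + 1)"
    proof -
      have 1: "\<forall>\<^sub>F s in at t. norm (N s - mat 1) < 1 / (2 * K)"
        using N_lim K(1) by (auto simp: tendsto_iff dist_norm)
      have 2: "\<forall>\<^sub>F s in at t. norm (?r s - ?r t) < 1"
        using r_lim by (auto simp: tendsto_iff dist_norm)
      from evJ 1 2 show ?thesis
      proof eventually_elim
        case (elim s)
        have "norm ((N s - mat 1) *v x' s) \<le> norm (N s - mat 1) * norm (x' s) * K" by (rule K(2))
        also have "\<dots> \<le> 1 / (2 * K) * norm (x' s) * K"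
          using elim(2) K(1) by (intro mult_right_mono) auto
        also have "\<dots> = norm (x' s) / 2" using K(1) by simp
        finally have "norm (x' s) \<le> norm (?r s) + norm (x' s) / 2"
          using eq[OF elim(1)] norm_triangle_ineq4[of "?r s" "(N s - mat 1) *v x' s"] by simp
        moreover have "norm (?r s) \<le> norm (?r t) + 1" using elim(3) by norm
        ultimately show ?case by simp
      qed
    qed
    then have "Bfun x' (at t)" by (rule BfunI)
    then have "((\<lambda>s. (N s - mat 1) *v x' s) \<longlongrightarrow> 0) (at t)"
      using bounded_bilinear.Zfun_prod_Bfun[OF bb] N_lim by (simp add: tendsto_Zfun_iff)
    then have "((\<lambda>s. ?r s - (N s - mat 1) *v x' s) \<longlongrightarrow> ?r t - 0) (at t)"
      by (intro tendsto_diff r_lim)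
    moreover have "x' t = ?r t" using eq[OF t] by (simp add: N0)
    ultimately have x'_lim: "(x' \<longlongrightarrow> x' t) (at t)"
      using Lim_transform_eventually[OF _ eventually_mono[OF evJ eq[symmetric]]] by simp
    have "((\<lambda>s. (N s - mat 1) *v x' s) has_derivative (\<lambda>h. (h *\<^sub>R N') *v x' t)) (at t)"
      by (rule has_derivative_bilinear_vanishing[OF bounded_bilinear.flip[OF bb] dN _ x'_lim]) (simp add: N0)
    then have "((\<lambda>s. (N s - mat 1) *v x' s) has_vector_derivative N' *v x' t) (at t)"
      by (simp add: has_vector_derivative_def scaleR_matrix_vector_assoc)
    from has_vector_derivative_diff[OF dr this]
    have "(x' has_vector_derivative \<pi> (\<gamma>2 t) - N' *v x' t) (at t)"
      by (rule has_vector_derivative_transform_within_open[OF _ J t]) (simp add: eq[symmetric])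
    then show ?thesis by blast
  qed
  then obtain x'' where x'': "\<And>t. t \<in> J \<Longrightarrow> (x' has_vector_derivative x'' t) (at t)" by metis
  have "D1 \<phi> (x t) (x'' t) + D2 \<phi> (x t) (x' t) (x' t) = \<gamma>2 t" if t: "t \<in> J" for t
  proof (rule vector_derivative_unique_at)
    show "((\<lambda>s. D1 \<phi> (x s) (x' s)) has_vector_derivative
        D1 \<phi> (x t) (x'' t) + D2 \<phi> (x t) (x' t) (x' t)) (at t)"
      using D1_along_curve[OF W sm x'(1)[OF t] _ x''[OF t]] xW[OF t] by blast
    show "((\<lambda>s. D1 \<phi> (x s) (x' s)) has_vector_derivative \<gamma>2 t) (at t)"
      by (rule has_vector_derivative_transform_within_open[OF \<gamma>2 J t])
         (use t x'(2) in \<open>auto simp: J_def\<close>)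
  qed
  then show "\<exists>x' x''. \<forall>t\<in>J. (x has_vector_derivative x' t) (at t) \<and> (x' has_vector_derivative x'' t) (at t) \<and>
       D1 \<phi> (x t) (x' t) = \<gamma>1 t \<and> D1 \<phi> (x t) (x'' t) + D2 \<phi> (x t) (x' t) (x' t) = \<gamma>2 t"
    using x' x'' by blast
qed


section \<open>The geodesic equation without coordinates\<close>

text \<open>The Euler-Lagrange expression of the energy of a bilinear form \<open>Q\<close> at a point \<open>A\<close> of a curve
  with velocity \<open>a\<close> and acceleration \<open>c\<close>, paired with a variation \<open>b\<close>; \<open>DQ A c\<close> is the derivative of
  \<open>Q\<close> at \<open>A\<close> in the direction \<open>c\<close>.\<close>

definition euler_lagrange ::
  "('a \<Rightarrow> 'a \<Rightarrow> 'a \<Rightarrow> real) \<Rightarrow> ('a \<Rightarrow> 'a \<Rightarrow> 'a \<Rightarrow> 'a \<Rightarrow> real) \<Rightarrow> 'a \<Rightarrow> 'a \<Rightarrow> 'a \<Rightarrow> 'a \<Rightarrow> real" where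
  "euler_lagrange Q DQ A a c b = Q A c b + DQ A a a b - DQ A b a a / 2"

text \<open>A metric on a submanifold that is known through an expression \<open>Q\<close> which makes sense for
  arbitrary ambient vectors. The argument \<open>dimension\<close> carries the type that indexes the coordinates.\<close>

locale extended_metric =
  fixes M :: "'a::euclidean_space set" and g Q :: "'a \<Rightarrow> 'a \<Rightarrow> 'a \<Rightarrow> real"
    and DQ :: "'a \<Rightarrow> 'a \<Rightarrow> 'a \<Rightarrow> 'a \<Rightarrow> real" and dimension :: "'d::finite itself"
  assumes Q_bilinear: "A \<in> M \<Longrightarrow> bounded_bilinear (Q A)"
    and Q_sym: "A \<in> M \<Longrightarrow> Q A a b = Q A b a"
    and DQ_linear1: "A \<in> M \<Longrightarrow> linear (\<lambda>c. DQ A c a b)"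
    and DQ_linear2: "A \<in> M \<Longrightarrow> linear (\<lambda>a. DQ A c a b)"
    and DQ_linear3: "A \<in> M \<Longrightarrow> linear (\<lambda>b. DQ A c a b)"
    and Q_has_derivative: "\<And>(\<alpha> :: real^'d \<Rightarrow> 'a) u v y T. \<lbrakk>open T; y \<in> T; \<And>z. z \<in> T \<Longrightarrow> \<alpha> z \<in> M;
        (\<alpha> has_derivative \<alpha>') (at y); (u has_derivative u') (at y); (v has_derivative v') (at y)\<rbrakk> \<Longrightarrow>
        ((\<lambda>z. Q (\<alpha> z) (u z) (v z)) has_derivative
          (\<lambda>h. DQ (\<alpha> y) (\<alpha>' h) (u y) (v y) + (Q (\<alpha> y) (u' h) (v y) + Q (\<alpha> y) (u y) (v' h)))) (at y)"
    and g_eq_Q: "\<And>(\<phi> :: real^'d \<Rightarrow> 'a) W y u v. local_parametrization M W \<phi> \<Longrightarrow> y \<in> W \<Longrightarrow>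
        g (\<phi> y) (D1 \<phi> y u) (D1 \<phi> y v) = Q (\<phi> y) (D1 \<phi> y u) (D1 \<phi> y v)"
    and Q_pos: "\<And>(\<phi> :: real^'d \<Rightarrow> 'a) W y u. local_parametrization M W \<phi> \<Longrightarrow> y \<in> W \<Longrightarrow> u \<noteq> 0 \<Longrightarrow>
        0 < Q (\<phi> y) (D1 \<phi> y u) (D1 \<phi> y u)"
begin

lemma linear_euler_lagrange: "A \<in> M \<Longrightarrow> linear (euler_lagrange Q DQ A a c)"
  unfolding euler_lagrange_def
  by (rule linearI)
     (simp_all add: bounded_bilinear.add_right[OF Q_bilinear] bounded_bilinear.scaleR_right[OF Q_bilinear]
       linear_add[OF DQ_linear3] linear_scale[OF DQ_linear3] linear_add[OF DQ_linear1]
       linear_scale[OF DQ_linear1] field_simps)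

text \<open>Multiplying the geodesic equation by the Gram matrix turns it into the Euler-Lagrange equation. The
  derivatives of the metric coefficients contain second derivatives of \<open>\<phi>\<close>. By their symmetry these
  cancel, except for \<open>D2 \<phi> y x' x'\<close>, which completes \<open>D1 \<phi> y x''\<close> to the acceleration in the ambient space.\<close>

lemma christoffel_equation_iff:
  fixes \<phi> :: "real^'d \<Rightarrow> 'a" and x' x'' :: "real^'d"
  assumes lp: "local_parametrization M W \<phi>" and y: "y \<in> W"
  shows "(\<forall>m. x'' $ m + (\<Sum>i\<in>UNIV. \<Sum>j\<in>UNIV.
            christoffel (metric_coeffs g \<phi>) m i j y * x' $ i * x' $ j) = 0) \<longleftrightarrow>
     (\<forall>l. euler_lagrange Q DQ (\<phi> y) (D1 \<phi> y x') (D1 \<phi> y x'' + D2 \<phi> y x' x') (D1 \<phi> y (axis l 1)) = 0)"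
proof -
  have W: "open W" and sm: "smooth_on W \<phi>" and \<phi>M: "\<And>z. z \<in> W \<Longrightarrow> \<phi> z \<in> M"
    using lp by (auto simp: local_parametrization_def)
  note A = \<phi>M[OF y]
  note lin1 = linear_D1[OF sm y] and lin2 = linear_D2[OF sm y] and lin2' = linear_D2_left[OF W sm y]
  note Qs = bounded_bilinear.add_left[OF Q_bilinear[OF A]] bounded_bilinear.add_right[OF Q_bilinear[OF A]]
    bounded_bilinear.scaleR_left[OF Q_bilinear[OF A]] bounded_bilinear.scaleR_right[OF Q_bilinear[OF A]]
  let ?D = "D1 \<phi> y" and ?D2 = "D2 \<phi> y" and ?A = "\<phi> y" and ?G = "metric_coeffs g \<phi> y"
  let ?e = "\<lambda>i. axis i 1 :: real^'d"
  (* the derivative of the metric coefficient of u and v in the direction w *)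
  define T where "T w u v = DQ ?A (?D w) (?D u) (?D v) + (Q ?A (?D2 u w) (?D v) + Q ?A (?D u) (?D2 v w))" for w u v
  have coeff: "metric_coeffs g \<phi> z $ i $ j = Q (\<phi> z) (D1 \<phi> z (?e i)) (D1 \<phi> z (?e j))" if "z \<in> W" for z i j
    using g_eq_Q[OF lp that] by (simp add: metric_coeffs_def partial_def)
  have dG: "partial l (\<lambda>z. metric_coeffs g \<phi> z $ i $ j) y = T (?e l) (?e i) (?e j)" for l i j
  proof -
    have "((\<lambda>z. Q (\<phi> z) (D1 \<phi> z (?e i)) (D1 \<phi> z (?e j))) has_derivative (\<lambda>w. T w (?e i) (?e j))) (at y)"
      unfolding T_def
      by (rule Q_has_derivative[OF W y \<phi>M smooth_on_imp_has_derivative[OF sm y]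
            smooth_on_has_derivative_D1[OF sm y] smooth_on_has_derivative_D1[OF sm y]])
    then have "((\<lambda>z. metric_coeffs g \<phi> z $ i $ j) has_derivative (\<lambda>w. T w (?e i) (?e j))) (at y)"
      by (rule has_derivative_transform_within_open[OF _ W y]) (simp add: coeff)
    from frechet_derivative_at[OF this] show ?thesis
      unfolding partial_def by metis
  qed
  have T1: "linear (\<lambda>w. T w u v)" and T2: "linear (\<lambda>u. T w u v)" and T3: "linear (\<lambda>v. T w u v)" for u v w
    unfolding T_def
    by (rule linearI; simp add: linear_add[OF lin1] linear_scale[OF lin1] linear_add[OF lin2] linear_scale[OF lin2]
        linear_add[OF lin2'] linear_scale[OF lin2'] Qs
        linear_add[OF DQ_linear1[OF A]] linear_scale[OF DQ_linear1[OF A]]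
        linear_add[OF DQ_linear2[OF A]] linear_scale[OF DQ_linear2[OF A]]
        linear_add[OF DQ_linear3[OF A]] linear_scale[OF DQ_linear3[OF A]] algebra_simps)+
  have expand: "(\<Sum>i\<in>UNIV. \<Sum>j\<in>UNIV. T (?e i) (?e j) v * x' $ i * x' $ j) = T x' x' v"
    "(\<Sum>i\<in>UNIV. \<Sum>j\<in>UNIV. T v (?e i) (?e j) * x' $ i * x' $ j) = T v x' x'" for v
  proof -
    show "(\<Sum>i\<in>UNIV. \<Sum>j\<in>UNIV. T (?e i) (?e j) v * x' $ i * x' $ j) = T x' x' v"
      by (subst linear_axis_expansion[OF T1], subst linear_axis_expansion[OF T2])
         (simp add: sum_distrib_left mult_ac)
    show "(\<Sum>i\<in>UNIV. \<Sum>j\<in>UNIV. T v (?e i) (?e j) * x' $ i * x' $ j) = T v x' x'"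
      by (subst linear_axis_expansion[OF T2], subst linear_axis_expansion[OF T3])
         (simp add: sum_distrib_left mult_ac)
  qed
  define c :: "real^'d" where "c = (\<chi> l. T x' x' (?e l) - T (?e l) x' x' / 2)"
  have c: "c $ l = (\<Sum>i\<in>UNIV. \<Sum>j\<in>UNIV. (1/2) * (partial i (\<lambda>z. metric_coeffs g \<phi> z $ j $ l) y
      + partial j (\<lambda>z. metric_coeffs g \<phi> z $ i $ l) y - partial l (\<lambda>z. metric_coeffs g \<phi> z $ i $ j) y) * x' $ i * x' $ j)" for l
  proof -
    have "(\<Sum>i\<in>UNIV. \<Sum>j\<in>UNIV. T (?e j) (?e i) (?e l) * x' $ i * x' $ j) = T x' x' (?e l)"
      by (subst sum.swap) (simp add: expand(1)[symmetric] mult_ac)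
    then show ?thesis
      unfolding dG c_def using expand(1)[of "?e l"] expand(2)[of "?e l"]
      by (simp add: algebra_simps sum.distrib sum_subtractf add_divide_distrib diff_divide_distrib
          flip: sum_divide_distrib)
  qed
  have christ: "(\<Sum>i\<in>UNIV. \<Sum>j\<in>UNIV. christoffel (metric_coeffs g \<phi>) m i j y * x' $ i * x' $ j)
      = (matrix_inv ?G *v c) $ m" for m
  proof -
    have "(matrix_inv ?G *v c) $ m = (\<Sum>l\<in>UNIV. \<Sum>i\<in>UNIV. \<Sum>j\<in>UNIV. matrix_inv ?G $ m $ l *
        ((1/2) * (partial i (\<lambda>z. metric_coeffs g \<phi> z $ j $ l) y
      + partial j (\<lambda>z. metric_coeffs g \<phi> z $ i $ l) y - partial l (\<lambda>z. metric_coeffs g \<phi> z $ i $ j) y) * x' $ i * x' $ j))"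
      unfolding matrix_vector_mult_def c by (simp add: sum_distrib_left)
    also have "\<dots> = (\<Sum>i\<in>UNIV. \<Sum>j\<in>UNIV. \<Sum>l\<in>UNIV. matrix_inv ?G $ m $ l *
        ((1/2) * (partial i (\<lambda>z. metric_coeffs g \<phi> z $ j $ l) y
      + partial j (\<lambda>z. metric_coeffs g \<phi> z $ i $ l) y - partial l (\<lambda>z. metric_coeffs g \<phi> z $ i $ j) y) * x' $ i * x' $ j))"
      by (subst sum.swap) (intro sum.cong refl sum.swap)
    finally show ?thesis
      unfolding christoffel_def by (simp add: sum_distrib_left sum_distrib_right mult_ac)
  qed
  have Gv: "(?G *v u) $ l = Q ?A (?D u) (?D (?e l))" for u l
  proof -
    have "linear (\<lambda>u. Q ?A (?D u) (?D (?e l)))"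
      by (rule linearI) (simp_all add: linear_add[OF lin1] linear_scale[OF lin1] Qs)
    from linear_axis_expansion[OF this, of u] show ?thesis
      by (simp add: matrix_vector_mult_def coeff[OF y] mult.commute Q_sym[OF A, of "?D (?e l)"])
  qed
  have ker: "u = 0" if "?G *v u = 0" for u
  proof (rule ccontr)
    assume "u \<noteq> 0"
    have "linear (\<lambda>v. Q ?A (?D u) (?D v))"
      by (rule linearI) (simp_all add: linear_add[OF lin1] linear_scale[OF lin1] Qs)
    from linear_axis_expansion[OF this, of u] that
    have "Q ?A (?D u) (?D u) = 0" by (simp add: Gv[symmetric])
    then show False using Q_pos[OF lp y \<open>u \<noteq> 0\<close>] by simp
  qed
  then obtain H where "H ** ?G = mat 1" using matrix_left_invertible_ker[of ?G] by blast
  then have "?G ** H = mat 1" by (simp add: matrix_left_right_inverse)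
  then have inv: "?G ** matrix_inv ?G = mat 1" using matrix_inv_unique by metis
  have "(\<forall>m. x'' $ m + (\<Sum>i\<in>UNIV. \<Sum>j\<in>UNIV. christoffel (metric_coeffs g \<phi>) m i j y * x' $ i * x' $ j) = 0)
     \<longleftrightarrow> x'' + matrix_inv ?G *v c = 0"
    by (simp add: christ vec_eq_iff)
  also have "\<dots> \<longleftrightarrow> ?G *v (x'' + matrix_inv ?G *v c) = 0"
    using ker by auto
  also have "\<dots> \<longleftrightarrow> ?G *v x'' + c = 0"
    by (simp add: matrix_vector_right_distrib matrix_vector_mul_assoc inv)
  also have "\<dots> \<longleftrightarrow> (\<forall>l. euler_lagrange Q DQ ?A (?D x') (?D x'' + ?D2 x' x') (?D (?e l)) = 0)"
  proof -
    have "(?G *v x'' + c) $ l = euler_lagrange Q DQ ?A (?D x') (?D x'' + ?D2 x' x') (?D (?e l))" for l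
      using D2_symmetric[OF W sm y, of x' "?e l"] Q_sym[OF A, of "?D2 x' (?e l)" "?D x'"]
      by (simp add: Gv c_def T_def euler_lagrange_def Qs add_divide_distrib)
    then show ?thesis by (simp add: vec_eq_iff)
  qed
  finally show ?thesis .
qed

text \<open>The coordinate velocity and acceleration of a curve are unique, so they may be taken from
  \<open>chart_curve_lift\<close>.\<close>

lemma geodesic_iff_euler_lagrange:
  fixes \<gamma> :: "real \<Rightarrow> 'a"
  assumes I: "open I" "is_interval I" "I \<noteq> {}" "\<gamma> ` I \<subseteq> M" "smooth_on I \<gamma>"
    and \<gamma>1: "\<And>t. t \<in> I \<Longrightarrow> (\<gamma> has_vector_derivative \<gamma>1 t) (at t)"
    and \<gamma>2: "\<And>t. t \<in> I \<Longrightarrow> (\<gamma>1 has_vector_derivative \<gamma>2 t) (at t)"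
  shows "geodesic TYPE('d) M g I \<gamma> \<longleftrightarrow>
    (\<forall>(\<phi> :: real^'d \<Rightarrow> 'a) W. local_parametrization M W \<phi> \<longrightarrow>
       (\<forall>t\<in>I. \<forall>y\<in>W. \<phi> y = \<gamma> t \<longrightarrow> (\<forall>u. euler_lagrange Q DQ (\<gamma> t) (\<gamma>1 t) (\<gamma>2 t) (D1 \<phi> y u) = 0)))"
proof -
  have "(\<exists>x' x''. \<forall>t\<in>I. \<gamma> t \<in> \<phi> ` W \<longrightarrow>
          ((inv_into W \<phi> \<circ> \<gamma>) has_vector_derivative x' t) (at t) \<and>
          (x' has_vector_derivative x'' t) (at t) \<and>
          (\<forall>m. x'' t $ m + (\<Sum>i\<in>UNIV. \<Sum>j\<in>UNIV.
               christoffel (metric_coeffs g \<phi>) m i j ((inv_into W \<phi> \<circ> \<gamma>) t) * x' t $ i * x' t $ j) = 0)) \<longleftrightarrow>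
      (\<forall>t\<in>I. \<forall>y\<in>W. \<phi> y = \<gamma> t \<longrightarrow> (\<forall>u. euler_lagrange Q DQ (\<gamma> t) (\<gamma>1 t) (\<gamma>2 t) (D1 \<phi> y u) = 0))"
      (is "?geo \<longleftrightarrow> ?el")
    if lp: "local_parametrization M W \<phi>" for \<phi> :: "real^'d \<Rightarrow> 'a" and W
  proof -
    have sm: "smooth_on W \<phi>" and \<phi>M: "\<And>z. z \<in> W \<Longrightarrow> \<phi> z \<in> M" and injW: "inj_on \<phi> W"
      using lp by (auto simp: local_parametrization_def homeomorphism_def intro: inj_on_inverseI)
    define x where "x = inv_into W \<phi> \<circ> \<gamma>"
    define J where "J = {t \<in> I. \<gamma> t \<in> \<phi> ` W}"
    have lift: "open J" "\<And>t. t \<in> J \<Longrightarrow> x t \<in> W \<and> \<phi> (x t) = \<gamma> t"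
      "\<exists>x' x''. \<forall>t\<in>J. (x has_vector_derivative x' t) (at t) \<and> (x' has_vector_derivative x'' t) (at t) \<and>
         D1 \<phi> (x t) (x' t) = \<gamma>1 t \<and> D1 \<phi> (x t) (x'' t) + D2 \<phi> (x t) (x' t) (x' t) = \<gamma>2 t"
      using chart_curve_lift[OF lp I(1,4) \<gamma>1 \<gamma>2 x_def J_def] by blast+
    obtain x' x'' where x: "\<And>t. t \<in> J \<Longrightarrow> (x has_vector_derivative x' t) (at t)"
      "\<And>t. t \<in> J \<Longrightarrow> (x' has_vector_derivative x'' t) (at t)"
      "\<And>t. t \<in> J \<Longrightarrow> D1 \<phi> (x t) (x' t) = \<gamma>1 t"
      "\<And>t. t \<in> J \<Longrightarrow> D1 \<phi> (x t) (x'' t) + D2 \<phi> (x t) (x' t) (x' t) = \<gamma>2 t"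
      using lift(3) by metis
    have eq: "(\<forall>m. x'' t $ m + (\<Sum>i\<in>UNIV. \<Sum>j\<in>UNIV.
               christoffel (metric_coeffs g \<phi>) m i j (x t) * x' t $ i * x' t $ j) = 0) \<longleftrightarrow>
       (\<forall>l. euler_lagrange Q DQ (\<gamma> t) (\<gamma>1 t) (\<gamma>2 t) (D1 \<phi> (x t) (axis l 1)) = 0)" if "t \<in> J" for t
      using christoffel_equation_iff[OF lp conjunct1[OF lift(2)[OF that]], of "x'' t" "x' t"]
        lift(2)[OF that] x(3,4)[OF that] by simp
    have all_u: "(\<forall>l. euler_lagrange Q DQ (\<gamma> t) (\<gamma>1 t) (\<gamma>2 t) (D1 \<phi> (x t) (axis l 1)) = 0) \<longleftrightarrow>
        (\<forall>u. euler_lagrange Q DQ (\<gamma> t) (\<gamma>1 t) (\<gamma>2 t) (D1 \<phi> (x t) u) = 0)" if "t \<in> J" for t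
    proof -
      have "\<gamma> t \<in> M" using that I(4) by (auto simp: J_def)
      then have "linear (\<lambda>u. euler_lagrange Q DQ (\<gamma> t) (\<gamma>1 t) (\<gamma>2 t) (D1 \<phi> (x t) u))"
        using linear_compose[OF linear_D1[OF sm] linear_euler_lagrange] lift(2)[OF that] by (simp add: o_def)
      note exp = linear_axis_expansion[OF this]
      show ?thesis
      proof (intro iffI allI)
        fix u
        assume "\<forall>l. euler_lagrange Q DQ (\<gamma> t) (\<gamma>1 t) (\<gamma>2 t) (D1 \<phi> (x t) (axis l 1)) = 0"
        then show "euler_lagrange Q DQ (\<gamma> t) (\<gamma>1 t) (\<gamma>2 t) (D1 \<phi> (x t) u) = 0" by (subst exp) simp
      qed blast
    qed
    have pts: "?el \<longleftrightarrow> (\<forall>t\<in>J. \<forall>u. euler_lagrange Q DQ (\<gamma> t) (\<gamma>1 t) (\<gamma>2 t) (D1 \<phi> (x t) u) = 0)"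
    proof -
      have xy: "x t = y" if "y \<in> W" "\<phi> y = \<gamma> t" for t y
        using inv_into_f_f[OF injW that(1)] by (simp add: x_def that(2))
      show ?thesis
      proof
        assume ?el
        show "\<forall>t\<in>J. \<forall>u. euler_lagrange Q DQ (\<gamma> t) (\<gamma>1 t) (\<gamma>2 t) (D1 \<phi> (x t) u) = 0"
        proof
          fix t assume t: "t \<in> J"
          then have "t \<in> I" by (simp add: J_def)
          then show "\<forall>u. euler_lagrange Q DQ (\<gamma> t) (\<gamma>1 t) (\<gamma>2 t) (D1 \<phi> (x t) u) = 0"
            using \<open>?el\<close> lift(2)[OF t] by blast
        qed
      next
        assume el: "\<forall>t\<in>J. \<forall>u. euler_lagrange Q DQ (\<gamma> t) (\<gamma>1 t) (\<gamma>2 t) (D1 \<phi> (x t) u) = 0"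
        show ?el
        proof (intro ballI impI)
          fix t y assume t: "t \<in> I" "y \<in> W" "\<phi> y = \<gamma> t"
          from t(2) have "\<phi> y \<in> \<phi> ` W" by blast
          with t have "t \<in> J" by (simp add: J_def)
          with el show "\<forall>u. euler_lagrange Q DQ (\<gamma> t) (\<gamma>1 t) (\<gamma>2 t) (D1 \<phi> y u) = 0"
            using xy[OF t(2,3)] by blast
        qed
      qed
    qed
    have geo: "?geo \<longleftrightarrow> (\<forall>t\<in>J. \<forall>m. x'' t $ m + (\<Sum>i\<in>UNIV. \<Sum>j\<in>UNIV.
               christoffel (metric_coeffs g \<phi>) m i j (x t) * x' t $ i * x' t $ j) = 0)" (is "_ \<longleftrightarrow> ?geo'")
    proof
      assume ?geo
      then obtain z' z'' where z: "\<And>t. t \<in> J \<Longrightarrow> (x has_vector_derivative z' t) (at t)"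
        "\<And>t. t \<in> J \<Longrightarrow> (z' has_vector_derivative z'' t) (at t)"
        "\<And>t m. t \<in> J \<Longrightarrow> z'' t $ m + (\<Sum>i\<in>UNIV. \<Sum>j\<in>UNIV.
               christoffel (metric_coeffs g \<phi>) m i j (x t) * z' t $ i * z' t $ j) = 0"
        unfolding x_def[symmetric] J_def by blast
      have z': "z' t = x' t" if "t \<in> J" for t
        using vector_derivative_unique_at[OF z(1)[OF that] x(1)[OF that]] .
      have z'': "z'' t = x'' t" if "t \<in> J" for t
      proof (rule vector_derivative_unique_at)
        show "(x' has_vector_derivative z'' t) (at t)"
          by (rule has_vector_derivative_transform_within_open[OF z(2)[OF that] lift(1) that]) (rule z')
      qed (rule x(2)[OF that])
      show ?geo'
      proof (intro ballI allI)
        fix t m assume t: "t \<in> J"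
        show "x'' t $ m + (\<Sum>i\<in>UNIV. \<Sum>j\<in>UNIV.
               christoffel (metric_coeffs g \<phi>) m i j (x t) * x' t $ i * x' t $ j) = 0"
          using z(3)[OF t, of m] unfolding z'[OF t] z''[OF t] .
      qed
    next
      assume ?geo'
      then show ?geo
        unfolding x_def[symmetric] using x(1,2) unfolding J_def by blast
    qed
    have mid: "?geo' \<longleftrightarrow> (\<forall>t\<in>J. \<forall>u. euler_lagrange Q DQ (\<gamma> t) (\<gamma>1 t) (\<gamma>2 t) (D1 \<phi> (x t) u) = 0)"
      by (rule ball_cong[OF refl]) (simp only: eq all_u)
    show ?thesis by (rule trans[OF trans[OF geo mid] pts[symmetric]])
  qed
  then show ?thesis
    using I unfolding geodesic_def Let_def by auto
qed

end

section \<open>Blocks of tangent vectors\<close>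

lemma trace_zero [simp]: "trace (0 :: real^'n^'n) = 0"
  by (simp add: trace_def)

text \<open>Abstractly, \<open>B\<close> is the pseudoinverse of \<open>A\<close> and \<open>a\<close> is tangent at \<open>A\<close>. The block \<open>X\<close> describes how
  \<open>a\<close> turns the range of \<open>A\<close>, the block \<open>W\<close> how it changes \<open>A\<close> within the range.\<close>

locale tangent_blocks =
  fixes A B a X W :: "real^'n^'n"
  assumes ABA: "A ** B ** A = A" and BAB: "B ** A ** B = B" and AB: "A ** B = B ** A"
    and At: "transpose A = A" and Bt: "transpose B = B" and at: "transpose a = a"
    and tan: "(mat 1 - A ** B) ** a ** (mat 1 - A ** B) = 0"
    and X: "X = (mat 1 - A ** B) ** a ** B" and W: "W = B ** a ** A ** B"
begin

lemma AB_words: "B ** A = A ** B" "A ** (A ** B) = A" "A ** (B ** B) = B"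
  using ABA BAB AB by (metis matrix_mul_assoc)+

lemmas AB_simps = AB_words AB_words[THEN matrix_mul_reassoc, unfolded matrix_mul_assoc[symmetric]]
  matrix_mul_assoc[symmetric]

lemma a_expand: "a = A ** (B ** a) + a ** (A ** B) - A ** (B ** (a ** (A ** B)))"
  using tan by (simp add: matrix_distribs matrix_mul_assoc) (simp add: algebra_simps)

lemma X_block: "A ** X = 0" "B ** X = 0" "X ** (A ** B) = X"
  by (simp_all add: X matrix_distribs AB_simps)

lemma W_block: "W ** (A ** B) = W" "A ** (B ** W) = W"
  by (simp_all add: W matrix_distribs AB_simps)

lemma transposes: "transpose X = B ** a ** (mat 1 - A ** B)" "transpose W = A ** B ** a ** B"
  by (simp_all add: X W transpose_simps At Bt at matrix_mul_assoc AB)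

lemma Xt_block: "transpose X ** A = 0" "transpose X ** B = 0" "A ** (B ** transpose X) = transpose X"
  by (simp_all add: transposes matrix_distribs AB_simps)

lemma Wt_block: "transpose W ** (A ** B) = transpose W" "A ** (B ** transpose W) = transpose W"
  by (simp_all add: transposes matrix_distribs AB_simps)

lemma W_selfadjoint: "A ** W = transpose W ** A" "B ** transpose W = W ** B"
  unfolding transposes by (simp_all add: W matrix_distribs AB_simps)

lemma XX: "X ** X = 0" "W ** X = 0" "transpose W ** X = 0"
   "transpose X ** transpose X = 0" "transpose X ** W = 0" "transpose X ** transpose W = 0"
proof -
  have *: "M ** X = 0" if "M ** (A ** B) = M" for M
    using that X_block(2) by (metis matrix_mul_assoc matrix_mul_rzero)
  show "X ** X = 0" "W ** X = 0" "transpose W ** X = 0"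
    by (rule *, rule X_block(3) W_block(1) Wt_block(1))+
  have *: "transpose X ** M = 0" if "A ** (B ** M) = M" for M
    using that Xt_block(1) by (metis matrix_mul_assoc matrix_mul_lzero)
  show "transpose X ** transpose X = 0" "transpose X ** W = 0" "transpose X ** transpose W = 0"
    by (rule *, rule Xt_block(3) W_block(2) Wt_block(2))+
qed

lemma a_blocks: "a = X ** A + A ** transpose X + A ** W"
  unfolding transposes by (subst (1) a_expand) (simp add: X W matrix_distribs AB_simps)

lemma Ba: "B ** a = transpose X + W" and aB: "a ** B = X + transpose W"
proof -
  show "B ** a = transpose X + W"
    unfolding transposes by (simp add: W matrix_distribs AB_simps)
  from arg_cong[OF this, of transpose] show "a ** B = X + transpose W"
    by (simp add: transpose_simps Bt at)
qed

lemma coproj_a: "(mat 1 - A ** B) ** a = X ** A" and a_coproj: "a ** (mat 1 - A ** B) = A ** transpose X"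
proof -
  show "(mat 1 - A ** B) ** a = X ** A"
    using tan by (simp add: X matrix_distribs AB_simps)
  from arg_cong[OF this, of transpose] show "a ** (mat 1 - A ** B) = A ** transpose X"
    by (simp add: transpose_simps At Bt at AB)
qed

end

locale tangent_blocks_pair = a: tangent_blocks A B a X W + b: tangent_blocks A B b Y V
  for A B a X W b Y V :: "real^'n^'n"
begin

lemma cross: "X ** Y = 0" "W ** Y = 0" "transpose W ** Y = 0" "Y ** X = 0" "V ** X = 0" "transpose V ** X = 0"
  "transpose X ** V = 0" "transpose Y ** W = 0" "transpose Y ** transpose W = 0" "transpose X ** transpose Y = 0"
proof -
  have *: "M ** Y = 0" if "M ** (A ** B) = M" for M
    using that b.X_block(2) by (metis matrix_mul_assoc matrix_mul_rzero)
  show "X ** Y = 0" "W ** Y = 0" "transpose W ** Y = 0"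
    by (rule *, rule a.X_block(3) a.W_block(1) a.Wt_block(1))+
  have *: "M ** X = 0" if "M ** (A ** B) = M" for M
    using that a.X_block(2) by (metis matrix_mul_assoc matrix_mul_rzero)
  show "Y ** X = 0" "V ** X = 0" "transpose V ** X = 0"
    by (rule *, rule b.X_block(3) b.W_block(1) b.Wt_block(1))+
  then show "transpose X ** transpose Y = 0" by (metis matrix_transpose_mul transpose_zero)
  have *: "transpose X ** M = 0" if "A ** (B ** M) = M" for M
    using that a.Xt_block(1) by (metis matrix_mul_assoc matrix_mul_lzero)
  show "transpose X ** V = 0" by (rule *, rule b.W_block(2))
  have *: "transpose Y ** M = 0" if "A ** (B ** M) = M" for M
    using that b.Xt_block(1) by (metis matrix_mul_assoc matrix_mul_lzero)
  show "transpose Y ** W = 0" "transpose Y ** transpose W = 0"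
    by (rule *, rule a.W_block(2) a.Wt_block(2))+
qed

abbreviation "\<beta> \<equiv> - (B ** (b ** B)) + B ** B ** (b ** (mat 1 - A ** B)) + (mat 1 - A ** B) ** (b ** (B ** B))"

lemma beta: "\<beta> = - (V ** B) + B ** transpose Y + Y ** B"
proof -
  have "B ** (b ** B) = V ** B"
    using b.Ba b.Xt_block(2) by (simp add: matrix_mul_assoc matrix_distribs)
  moreover have "B ** B ** (b ** (mat 1 - A ** B)) = B ** transpose Y"
    by (simp add: b.transposes matrix_mul_assoc)
  moreover have "(mat 1 - A ** B) ** (b ** (B ** B)) = Y ** B"
    by (simp add: b.X matrix_mul_assoc)
  ultimately show ?thesis by simp
qed

lemma proj_variation: "b ** B + A ** \<beta> = Y + transpose Y"
  unfolding beta unfolding b.aB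
  by (simp add: matrix_distribs matrix_mul_assoc b.W_selfadjoint(1) b.X_block(1))
    (simp add: matrix_mul_assoc[symmetric] b.Wt_block b.Xt_block)

text \<open>The first trace on the left is the derivative along the curve of the pairing of the velocity with a
  fixed \<open>b\<close>, and the subtracted bracket is half the derivative of the squared length of \<open>a\<close> in the
  direction \<open>b\<close>. The
  constraints on \<open>X'\<close> and \<open>W'\<close> are the derivatives of \<open>A ** X = 0\<close> and \<open>(mat 1 - A ** B) ** W = 0\<close>. Of the terms
  that are quadratic in \<open>a\<close> only \<open>2 k X (W - W\<^sup>T)\<close> survives, the force exerted by the curvature of the horizontal
  distribution.\<close>

lemma trace_euler_lagrange:
  assumes X': "A ** B ** X' = - (transpose X ** X)" and W': "(mat 1 - A ** B) ** W' = X ** W"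
    and B': "B' = - (W ** B) + B ** transpose X + X ** B"
  shows "trace ((B' ** transpose X + B ** transpose X' + k *\<^sub>R (W' ** B + W ** B')) ** b)
     - (trace (X ** (\<beta> ** (a ** (mat 1 - A ** B)))) - trace (X ** (B ** (a ** (b ** B + A ** \<beta>))))
        + k * trace (\<beta> ** (a ** (B ** a))))
     = trace (transpose Y ** (X' + (2 * k) *\<^sub>R (X ** W) - (2 * k) *\<^sub>R (X ** transpose W))) + k * trace (V ** W')"
proof -
  note z = a.XX cross a.X_block(1,2) b.X_block(1,2) a.Xt_block(1,2) b.Xt_block(1,2)
  note z' = z z[THEN matrix_mul_reassoc] matrix_mul_assoc[symmetric] matrix_distribs
  have Xb: "transpose X ** b = transpose X ** (Y ** A)"
    by (subst b.a_blocks) (simp add: z')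
  have "trace (B' ** transpose X ** b) = - trace (W ** (B ** (transpose X ** (Y ** A)))) + trace (X ** (B ** (transpose X ** (Y ** A))))"
    by (simp add: B' z' Xb trace_add trace_uminus trace_sub)
  also have "trace (X ** (B ** (transpose X ** (Y ** A)))) = trace (A ** (X ** (B ** (transpose X ** Y))))"
    by (subst (2) trace_mul_sym) (simp add: matrix_mul_assoc)
  also have "trace (W ** (B ** (transpose X ** (Y ** A)))) = trace (A ** (W ** (B ** (transpose X ** Y))))"
    by (subst (2) trace_mul_sym) (simp add: matrix_mul_assoc)
  also have "A ** (W ** (B ** (transpose X ** Y))) = transpose W ** (transpose X ** Y)"
    by (simp add: matrix_mul_assoc a.W_selfadjoint(1)) (simp add: matrix_mul_assoc[symmetric] a.Wt_block(1)[THEN matrix_mul_reassoc, unfolded matrix_mul_assoc[symmetric]])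
  also have T1: "trace (transpose W ** (transpose X ** Y)) = trace (transpose Y ** (X ** W))"
    by (subst trace_transpose[symmetric]) (simp add: transpose_simps matrix_mul_assoc)
  finally have L1: "trace (B' ** transpose X ** b) = - trace (transpose Y ** (X ** W))"
    by (simp add: z')
  have bB: "b ** B = Y + transpose V" by (rule b.aB)
  have "trace (B ** transpose X' ** b) = trace (transpose X' ** (b ** B))"
    by (subst matrix_mul_assoc[symmetric], subst trace_mul_sym) (simp add: matrix_mul_assoc)
  also have "\<dots> = trace (transpose X' ** Y) + trace (transpose X' ** transpose V)"
    by (simp add: bB matrix_distribs trace_add)
  also have "trace (transpose X' ** Y) = trace (transpose Y ** X')"
    by (subst trace_transpose[symmetric]) (simp add: transpose_simps)
  also have "trace (transpose X' ** transpose V) = trace (V ** X')"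
    by (subst trace_transpose[symmetric]) (simp add: transpose_simps)
  also have "V ** X' = V ** (A ** B ** X')"
    using b.W_block(1) by (simp add: matrix_mul_assoc)
  finally have L2: "trace (B ** transpose X' ** b) = trace (transpose Y ** X') - trace (V ** (transpose X ** X))"
    by (simp add: X' matrix_distribs trace_uminus)
  have "trace (W' ** B ** b) = trace (W' ** transpose Y) + trace (W' ** V)"
    using b.Ba by (simp add: matrix_mul_assoc[symmetric] matrix_distribs trace_add)
  also have "trace (W' ** transpose Y) = trace (transpose Y ** W')" by (rule trace_mul_sym)
  also have "transpose Y ** W' = transpose Y ** ((mat 1 - A ** B) ** W')"
    by (simp add: matrix_distribs matrix_mul_assoc b.Xt_block)
  also have "trace (W' ** V) = trace (V ** W')" by (rule trace_mul_sym)
  finally have L3: "trace (W' ** B ** b) = trace (transpose Y ** (X ** W)) + trace (V ** W')"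
    by (simp add: W')
  have "trace (W ** B' ** b) = - trace (W ** (W ** (B ** b))) + trace (W ** (B ** (transpose X ** (Y ** A))))"
    by (simp add: B' z' Xb trace_add trace_uminus trace_sub)
  also have "trace (W ** (B ** (transpose X ** (Y ** A)))) = trace (A ** (W ** (B ** (transpose X ** Y))))"
    by (subst (2) trace_mul_sym) (simp add: matrix_mul_assoc)
  also have "A ** (W ** (B ** (transpose X ** Y))) = transpose W ** (transpose X ** Y)"
    by (simp add: matrix_mul_assoc a.W_selfadjoint(1)) (simp add: matrix_mul_assoc[symmetric] a.Wt_block(1)[THEN matrix_mul_reassoc, unfolded matrix_mul_assoc[symmetric]])
  also note T1
  also have "trace (W ** (W ** (B ** b))) = trace (W ** (W ** V))"
  proof -
    have "trace (W ** (W ** transpose Y)) = trace (transpose Y ** (W ** W))"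
      by (subst trace_mul_sym[of "transpose Y"]) (simp add: matrix_mul_assoc)
    then show ?thesis by (simp add: b.Ba matrix_distribs trace_add z')
  qed
  also have "trace (W ** (W ** V)) = trace (V ** (W ** W))"
    by (subst trace_mul_sym[of V]) (simp add: matrix_mul_assoc)
  finally have L4: "trace (W ** B' ** b) = - trace (V ** (W ** W)) + trace (transpose Y ** (X ** W))" .
  have "X ** (\<beta> ** (a ** (mat 1 - A ** B))) = - (X ** (V ** (B ** (A ** transpose X))))"
    unfolding beta a.a_coproj by (simp add: z')
  also have "B ** (A ** transpose X) = transpose X"
    using a.Xt_block(3) a.AB by (simp add: matrix_mul_assoc)
  also have "trace (- (X ** (V ** transpose X))) = - trace (V ** (transpose X ** X))"
    using trace_mul_sym[of X "V ** transpose X"] by (simp add: matrix_mul_assoc trace_uminus)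
  finally have R1: "trace (X ** (\<beta> ** (a ** (mat 1 - A ** B)))) = - trace (V ** (transpose X ** X))" .
  have "X ** (B ** (a ** (b ** B + A ** \<beta>))) = X ** ((transpose X + W) ** (Y + transpose Y))"
    unfolding proj_variation using a.Ba by (simp add: matrix_mul_assoc)
  also have "\<dots> = X ** (transpose X ** Y) + X ** (W ** transpose Y)"
    by (simp add: z')
  finally have "trace (X ** (B ** (a ** (b ** B + A ** \<beta>)))) = trace (X ** (transpose X ** Y)) + trace (X ** (W ** transpose Y))"
    by (simp add: trace_add)
  also have "trace (X ** (transpose X ** Y)) = trace (Y ** (X ** transpose X))"
    by (subst trace_mul_sym[of Y]) (simp add: matrix_mul_assoc)
  also have "trace (X ** (W ** transpose Y)) = trace (transpose Y ** (X ** W))"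
    by (subst trace_mul_sym[of "transpose Y"]) (simp add: matrix_mul_assoc)
  finally have R2: "trace (X ** (B ** (a ** (b ** B + A ** \<beta>)))) = trace (transpose Y ** (X ** W))"
    by (simp add: z')
  have aBa: "a ** (B ** a) = X ** (A ** transpose X) + X ** (A ** W) + transpose W ** (A ** transpose X) + transpose W ** (A ** W)"
  proof -
    have "a ** (B ** a) = (X + transpose W) ** (X ** A + A ** transpose X + A ** W)"
      using a.aB a.a_blocks by (metis matrix_mul_assoc)
    then show ?thesis by (simp add: z')
  qed
  have Wt: "B ** (transpose W ** Z) = W ** (B ** Z)" for Z
    using a.W_selfadjoint(2) by (simp add: matrix_mul_assoc)
  have BA: "B ** (A ** transpose X) = transpose X" "B ** (A ** W) = W"
    using a.Xt_block(3) a.W_block(2) a.AB by (simp_all add: matrix_mul_assoc)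
  have "\<beta> ** (a ** (B ** a)) = - (V ** (W ** transpose X)) - V ** (W ** W)
     + B ** (transpose Y ** (X ** (A ** transpose X))) + B ** (transpose Y ** (X ** (A ** W)))
     + Y ** (W ** transpose X) + Y ** (W ** W)"
    unfolding beta aBa by (simp add: z' Wt BA)
  then have "trace (\<beta> ** (a ** (B ** a))) = - trace (V ** (W ** transpose X)) - trace (V ** (W ** W))
     + trace (B ** (transpose Y ** (X ** (A ** transpose X)))) + trace (B ** (transpose Y ** (X ** (A ** W))))
     + trace (Y ** (W ** transpose X)) + trace (Y ** (W ** W))"
    by (simp add: trace_add trace_sub trace_uminus)
  also have "trace (V ** (W ** transpose X)) = trace (transpose X ** (V ** W))"
    by (subst trace_mul_sym[of "transpose X"]) (simp add: matrix_mul_assoc)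
  also have "trace (B ** (transpose Y ** (X ** (A ** transpose X)))) = trace (transpose X ** (B ** (transpose Y ** (X ** A))))"
    by (subst trace_mul_sym[of "transpose X"]) (simp add: matrix_mul_assoc)
  also have "trace (B ** (transpose Y ** (X ** (A ** W)))) = trace (transpose Y ** (X ** (A ** (W ** B))))"
    by (subst trace_mul_sym[of B]) (simp add: matrix_mul_assoc)
  also have "A ** (W ** B) = transpose W"
    by (simp add: matrix_mul_assoc a.W_selfadjoint(1)) (simp add: matrix_mul_assoc[symmetric] a.Wt_block)
  also have "trace (Y ** (W ** transpose X)) = trace (transpose Y ** (X ** transpose W))"
    by (subst trace_transpose[symmetric]) (simp add: transpose_simps trace_mul_sym[of _ "transpose Y"] matrix_mul_assoc)
  also have "trace (Y ** (W ** W)) = trace (W ** (Y ** W))"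
  proof -
    have "trace (Y ** W ** W) = trace (W ** (Y ** W))" by (rule trace_mul_sym)
    then show ?thesis by (simp add: matrix_mul_assoc)
  qed
  finally have R3: "trace (\<beta> ** (a ** (B ** a))) = - trace (V ** (W ** W)) + 2 * trace (transpose Y ** (X ** transpose W))"
    by (simp add: z')
  show ?thesis
    unfolding R1 R2 R3
    by (simp add: matrix_add_rdistrib matrix_add_ldistrib matrix_mul_sub_ldistrib matrix_mul_scaleR_left
        matrix_mul_scaleR_right trace_add trace_sub trace_scaleR L1 L2 L3 L4 algebra_simps)
qed

end


section \<open>The metric along curves of matrices of fixed rank\<close>

lemma pinv_comp_has_derivative:
  fixes \<alpha> :: "'x::real_normed_vector \<Rightarrow> real^'n^'n"
  assumes T: "open T" "y \<in> T" "\<And>z. z \<in> T \<Longrightarrow> \<alpha> z \<in> psd_rank CARD('p::finite)"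
    and \<alpha>: "(\<alpha> has_derivative \<alpha>') (at y)"
  shows "((\<lambda>z. pinv (\<alpha> z)) has_derivative (\<lambda>h. pinv_deriv (\<alpha> y) (\<alpha>' h))) (at y)"
proof -
  have "(\<alpha> has_derivative \<alpha>') (at y within T)" by (rule has_derivative_at_withinI[OF \<alpha>])
  moreover have "(pinv has_derivative pinv_deriv (\<alpha> y)) (at (\<alpha> y) within \<alpha> ` T)"
    by (rule has_derivative_subset[OF pinv_has_derivative[OF T(3)[OF T(2)]]]) (use T(3) in auto)
  ultimately have "(pinv \<circ> \<alpha> has_derivative pinv_deriv (\<alpha> y) \<circ> \<alpha>') (at y within T)"
    by (rule diff_chain_within)
  then show ?thesis using at_within_open[OF T(2,1)] by (simp add: o_def)
qed

text \<open>Differentiate \<open>A B A = A\<close> and compress the result to the kernel of \<open>A\<close>.\<close>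

lemma velocity_tangent:
  fixes \<alpha> :: "'x::real_normed_vector \<Rightarrow> real^'n^'n"
  assumes T: "open T" "y \<in> T" "\<And>z. z \<in> T \<Longrightarrow> \<alpha> z \<in> psd_rank CARD('p::finite)"
    and \<alpha>: "(\<alpha> has_derivative \<alpha>') (at y)"
  shows "tangent (\<alpha> y) (\<alpha>' h)"
proof -
  note B = pinv_psd_rank[OF T(3)[OF T(2)]]
  have "((\<lambda>z. transpose (\<alpha> z)) has_derivative (\<lambda>h. transpose (\<alpha>' h))) (at y)"
    by (rule bounded_linear.has_derivative[OF bounded_linear_transpose \<alpha>])
  then have "(\<alpha> has_derivative (\<lambda>h. transpose (\<alpha>' h))) (at y)"
    by (rule has_derivative_transform_within_open[OF _ T(1,2)]) (simp add: pinv_psd_rank[OF T(3)])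
  then have sym: "transpose (\<alpha>' h) = \<alpha>' h" using has_derivative_unique[OF \<alpha>] by metis
  have "((\<lambda>z. \<alpha> z ** pinv (\<alpha> z) ** \<alpha> z) has_derivative
     (\<lambda>h. \<alpha> y ** pinv (\<alpha> y) ** \<alpha>' h + (\<alpha> y ** pinv_deriv (\<alpha> y) (\<alpha>' h) + \<alpha>' h ** pinv (\<alpha> y)) ** \<alpha> y)) (at y)"
    by (intro has_derivative_matrix_mul \<alpha> pinv_comp_has_derivative[OF T \<alpha>])
  then have "(\<alpha> has_derivative
     (\<lambda>h. \<alpha> y ** pinv (\<alpha> y) ** \<alpha>' h + (\<alpha> y ** pinv_deriv (\<alpha> y) (\<alpha>' h) + \<alpha>' h ** pinv (\<alpha> y)) ** \<alpha> y)) (at y)"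
    by (rule has_derivative_transform_within_open[OF _ T(1,2)]) (simp add: pinv_psd_rank(1)[OF T(3)])
  then have eq: "\<alpha>' h = \<alpha> y ** pinv (\<alpha> y) ** \<alpha>' h + (\<alpha> y ** pinv_deriv (\<alpha> y) (\<alpha>' h) + \<alpha>' h ** pinv (\<alpha> y)) ** \<alpha> y"
    by (rule fun_cong[OF has_derivative_unique[OF \<alpha>]])
  have z: "coproj (\<alpha> y) ** \<alpha> y = 0" "\<alpha> y ** coproj (\<alpha> y) = 0"
  proof -
    show "coproj (\<alpha> y) ** \<alpha> y = 0" using B(1) by (simp add: coproj_def matrix_mul_sub_rdistrib)
    have "\<alpha> y ** (\<alpha> y ** pinv (\<alpha> y)) = \<alpha> y" by (metis B(1,3) matrix_mul_assoc)
    then show "\<alpha> y ** coproj (\<alpha> y) = 0" by (simp add: coproj_def matrix_mul_sub_ldistrib)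
  qed
  have "coproj (\<alpha> y) ** \<alpha>' h ** coproj (\<alpha> y) = 0"
    by (subst eq) (simp add: matrix_distribs matrix_mul_assoc[symmetric] z z(1)[THEN matrix_mul_reassoc])
  with sym show ?thesis by (simp add: tangent_def)
qed

definition psd_form_deriv :: "real \<Rightarrow> real^'n^'n \<Rightarrow> real^'n^'n \<Rightarrow> real^'n^'n \<Rightarrow> real^'n^'n \<Rightarrow> real" where
  "psd_form_deriv k A c a b =
     (pinv_deriv A c ** a ** coproj A - pinv A ** a ** (A ** pinv_deriv A c + c ** pinv A)) \<bullet> (pinv A ** b ** coproj A)
   + (pinv A ** a ** coproj A) \<bullet> (pinv_deriv A c ** b ** coproj A - pinv A ** b ** (A ** pinv_deriv A c + c ** pinv A))
   + k * (trace (pinv_deriv A c ** a ** pinv A ** b) + trace (pinv A ** a ** pinv_deriv A c ** b))"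

lemma psd_form_has_derivative:
  fixes \<alpha> :: "'x::real_normed_vector \<Rightarrow> real^'n^'n"
  assumes T: "open T" "y \<in> T" "\<And>z. z \<in> T \<Longrightarrow> \<alpha> z \<in> psd_rank CARD('p::finite)"
    and d: "(\<alpha> has_derivative \<alpha>') (at y)" "(u has_derivative u') (at y)" "(v has_derivative v') (at y)"
  shows "((\<lambda>z. psd_form k (\<alpha> z) (u z) (v z)) has_derivative
    (\<lambda>h. psd_form_deriv k (\<alpha> y) (\<alpha>' h) (u y) (v y) + (psd_form k (\<alpha> y) (u' h) (v y) + psd_form k (\<alpha> y) (u y) (v' h)))) (at y)"
proof -
  let ?B = "pinv (\<alpha> y)" and ?\<Pi> = "coproj (\<alpha> y)" and ?B' = "\<lambda>h. pinv_deriv (\<alpha> y) (\<alpha>' h)"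
  let ?\<Pi>' = "\<lambda>h. 0 - (\<alpha> y ** ?B' h + \<alpha>' h ** ?B)"
  have dB: "((\<lambda>z. pinv (\<alpha> z)) has_derivative ?B') (at y)" by (rule pinv_comp_has_derivative[OF T d(1)])
  have d\<Pi>: "((\<lambda>z. coproj (\<alpha> z)) has_derivative ?\<Pi>') (at y)"
    unfolding coproj_def by (intro has_derivative_diff has_derivative_const has_derivative_matrix_mul d dB)
  have dt: "((\<lambda>z. trace (f z)) has_derivative (\<lambda>h. trace (f' h))) (at y)"
    if "(f has_derivative f') (at y)" for f :: "'x \<Rightarrow> real^'n^'n" and f'
    by (rule bounded_linear.has_derivative[OF bounded_linear_trace that])
  have N: "((\<lambda>z. pinv (\<alpha> z) ** w z ** coproj (\<alpha> z)) has_derivative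
      (\<lambda>h. ?B ** w y ** ?\<Pi>' h + (?B ** w' h + ?B' h ** w y) ** ?\<Pi>)) (at y)"
    if "(w has_derivative w') (at y)" for w w'
    by (intro has_derivative_matrix_mul that dB d\<Pi>)
  have R: "((\<lambda>z. trace (pinv (\<alpha> z) ** u z ** pinv (\<alpha> z) ** v z)) has_derivative
      (\<lambda>h. trace (?B ** u y ** ?B ** v' h + (?B ** u y ** ?B' h + (?B ** u' h + ?B' h ** u y) ** ?B) ** v y))) (at y)"
    by (intro dt has_derivative_matrix_mul d dB)
  have NN: "((\<lambda>z. (pinv (\<alpha> z) ** u z ** coproj (\<alpha> z)) \<bullet> (pinv (\<alpha> z) ** v z ** coproj (\<alpha> z))) has_derivative
      (\<lambda>h. (?B ** u y ** ?\<Pi>) \<bullet> (?B ** v y ** ?\<Pi>' h + (?B ** v' h + ?B' h ** v y) ** ?\<Pi>)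
         + (?B ** u y ** ?\<Pi>' h + (?B ** u' h + ?B' h ** u y) ** ?\<Pi>) \<bullet> (?B ** v y ** ?\<Pi>))) (at y)"
    by (rule has_derivative_inner[OF N[OF d(2)] N[OF d(3)]])
  have product_rule: "(B ** u ** C) \<bullet> (B ** v ** (0 - P') + (B ** v' + B' ** v) ** C)
         + (B ** u ** (0 - P') + (B ** u' + B' ** u) ** C) \<bullet> (B ** v ** C)
       + k * trace (B ** u ** B ** v' + (B ** u ** B' + (B ** u' + B' ** u) ** B) ** v)
      = (B' ** u ** C - B ** u ** P') \<bullet> (B ** v ** C) + (B ** u ** C) \<bullet> (B' ** v ** C - B ** v ** P')
         + k * (trace (B' ** u ** B ** v) + trace (B ** u ** B' ** v)) +
         ((B ** u' ** C) \<bullet> (B ** v ** C) + k * trace (B ** u' ** B ** v)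
         + ((B ** u ** C) \<bullet> (B ** v' ** C) + k * trace (B ** u ** B ** v')))"
    for B u v C P' B' u' v' :: "real^'n^'n"
    by (simp add: matrix_add_rdistrib matrix_add_ldistrib matrix_mul_sub_ldistrib inner_add_left inner_add_right
        inner_diff_left inner_diff_right trace_add distrib_left matrix_mul_rminus)
  show ?thesis
    unfolding psd_form_def
  proof (rule has_derivative_eq_rhs[OF has_derivative_add[OF NN has_derivative_mult_right[OF R]]], rule ext)
    fix h
    show "(?B ** u y ** ?\<Pi>) \<bullet> (?B ** v y ** ?\<Pi>' h + (?B ** v' h + ?B' h ** v y) ** ?\<Pi>)
         + (?B ** u y ** ?\<Pi>' h + (?B ** u' h + ?B' h ** u y) ** ?\<Pi>) \<bullet> (?B ** v y ** ?\<Pi>)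
       + k * trace (?B ** u y ** ?B ** v' h + (?B ** u y ** ?B' h + (?B ** u' h + ?B' h ** u y) ** ?B) ** v y)
      = psd_form_deriv k (\<alpha> y) (\<alpha>' h) (u y) (v y) +
         ((?B ** u' h ** ?\<Pi>) \<bullet> (?B ** v y ** ?\<Pi>) + k * trace (?B ** u' h ** ?B ** v y)
         + ((?B ** u y ** ?\<Pi>) \<bullet> (?B ** v' h ** ?\<Pi>) + k * trace (?B ** u y ** ?B ** v' h)))"
      unfolding psd_form_deriv_def by (rule product_rule)
  qed
qed


lemma psd_form_bilinear: "bounded_bilinear (psd_form k A)"
  unfolding bilinear_conv_bounded_bilinear[symmetric] bilinear_def psd_form_def
  by (auto intro!: linearI simp: matrix_add_ldistrib matrix_add_rdistrib matrix_mul_scaleR_left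
      matrix_mul_scaleR_right inner_add_left inner_add_right trace_add trace_scaleR algebra_simps)

lemma psd_form_sym: "psd_form k A a b = psd_form k A b a"
  using trace_mul_sym[of "pinv A ** a" "pinv A ** b"]
  by (simp add: psd_form_def inner_commute matrix_mul_assoc)

text \<open>The dependence on \<open>c\<close> is linear because it is through \<open>c\<close> and the linear map \<open>pinv_deriv A\<close> only.\<close>

lemma psd_form_deriv_linear:
  fixes A a b c :: "real^'n^'n"
  shows "linear (\<lambda>c. psd_form_deriv k A c a b)" "linear (\<lambda>a. psd_form_deriv k A c a b)" "linear (\<lambda>b. psd_form_deriv k A c a b)"
proof -
  have "linear (pinv_deriv A)"
    by (rule linearI) (simp_all add: matrix_add_ldistrib matrix_add_rdistrib matrix_mul_scaleR_left
      matrix_mul_scaleR_right algebra_simps)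
  moreover have "linear (\<lambda>c. (p c ** a ** C - B ** a ** (A ** p c + c ** B)) \<bullet> y
      + x \<bullet> (p c ** b ** C - B ** b ** (A ** p c + c ** B)) + k * (trace (p c ** a ** B ** b) + trace (B ** a ** p c ** b)))"
    if "linear p" for p and C B x y :: "real^'n^'n"
    by (rule linearI)
      (simp_all add: linear_add[OF that] linear_scale[OF that] matrix_add_ldistrib matrix_add_rdistrib
        matrix_mul_sub_ldistrib matrix_mul_sub_rdistrib matrix_mul_scaleR_left matrix_mul_scaleR_right
        inner_add_left inner_add_right inner_diff_left inner_diff_right trace_add trace_scaleR algebra_simps)
  ultimately show "linear (\<lambda>c. psd_form_deriv k A c a b)"
    unfolding psd_form_deriv_def by blast
  have "linear (\<lambda>a. (P ** a ** C - B ** a ** Q) \<bullet> y + (B ** a ** C) \<bullet> z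
      + k * (trace (P ** a ** B ** b) + trace (B ** a ** P ** b)))" for P Q C B y z :: "real^'n^'n"
    by (rule linearI)
      (simp_all add: matrix_add_ldistrib matrix_add_rdistrib matrix_mul_scaleR_left matrix_mul_scaleR_right
        inner_add_left inner_diff_left trace_add trace_scaleR algebra_simps)
  then show "linear (\<lambda>a. psd_form_deriv k A c a b)"
    unfolding psd_form_deriv_def by blast
  have "linear (\<lambda>b. x \<bullet> (B ** b ** C) + y \<bullet> (P ** b ** C - B ** b ** Q)
      + k * (trace (M ** b) + trace (N ** b)))" for P Q C B M N x y :: "real^'n^'n"
    by (rule linearI)
      (simp_all add: matrix_add_ldistrib matrix_add_rdistrib matrix_mul_scaleR_left matrix_mul_scaleR_right
        inner_add_right inner_diff_right trace_add trace_scaleR algebra_simps)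
  then show "linear (\<lambda>b. psd_form_deriv k A c a b)"
    unfolding psd_form_deriv_def by blast
qed

lemma psd_form_pos:
  fixes A a :: "real^'n^'n"
  assumes A: "A \<in> psd_rank CARD('p::finite)" and card: "CARD('p) < CARD('n)" and k: "k > 0"
    and a: "tangent A a" "a \<noteq> 0"
  shows "0 < psd_form k A a a"
proof -
  obtain U :: "real^'p^'n" and S where US: "U \<in> stiefel" "S \<in> spd_matrices" "A = U ** S ** transpose U"
    using psd_rank_factorization[OF A] by blast
  obtain R where R: "R \<in> spd_matrices" "R ** R = S" using spd_sqrt[OF US(2)] by blast
  have AR: "A = quotient_map (U, R ** R)" by (simp add: quotient_map_def US(3) R(2))
  obtain \<Delta> D where h: "(\<Delta>, D) \<in> horizontal U R"
    "a = frechet_derivative quotient_map (at (U, R ** R)) (\<Delta>, D)"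
    using tangent_ex_horizontal[OF US(1) R(1) card] a(1) unfolding AR by (metis surj_pair)
  obtain D0 where D0: "transpose D0 = D0" "D = R ** D0 ** R" using horizontalD(2)[OF h(1)] by blast
  note inv = matrix_inv_spd[OF R(1)]
  have "psd_form k A a a = trace (transpose \<Delta> ** \<Delta>)
     + k * trace (matrix_inv R ** D ** (matrix_inv R ** matrix_inv R) ** D ** matrix_inv R)"
    using psd_form_horizontal[OF US(1) R(1) h(1) h(1), of k] AR h(2) by (simp add: horizontal_metric_def)
  also have "matrix_inv R ** D ** (matrix_inv R ** matrix_inv R) ** D ** matrix_inv R = transpose D0 ** D0"
    by (simp add: D0 matrix_mul_assoc[symmetric] inv inv(1)[THEN matrix_mul_reassoc] inv(2)[THEN matrix_mul_reassoc])
  finally have eq: "psd_form k A a a = (norm \<Delta>)\<^sup>2 + k * (norm D0)\<^sup>2"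
    by (simp add: trace_inner power2_norm_eq_inner)
  have "\<Delta> \<noteq> 0 \<or> D0 \<noteq> 0"
  proof (rule ccontr)
    assume "\<not> ?thesis"
    then have "a = 0" by (simp add: h(2) quotient_map_derivative D0(2))
    then show False using a(2) by simp
  qed
  then show ?thesis
    unfolding eq using k by (auto intro: add_pos_nonneg add_nonneg_pos)
qed

text \<open>The form \<^const>\<open>psd_form\<close> extends the metric to all matrices.\<close>

lemma extended_metric_psd:
  assumes card: "CARD('p) < CARD('n)" and k: "k > 0"
  shows "extended_metric TYPE('d::finite) (psd_rank CARD('p::finite) :: (real^'n^'n) set)
    (psd_metric TYPE('p) k) (psd_form k) (psd_form_deriv k)"
proof (rule extended_metric.intro)
  fix \<phi> :: "real^'d \<Rightarrow> real^'n^'n" and W y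
  assume lp: "local_parametrization (psd_rank CARD('p)) W \<phi>" and y: "y \<in> W"
  then have W: "open W" and sm: "smooth_on W \<phi>" and \<phi>M: "\<And>z. z \<in> W \<Longrightarrow> \<phi> z \<in> psd_rank CARD('p)"
    and inj: "inj (D1 \<phi> y)"
    by (auto simp: local_parametrization_def)
  have tan: "tangent (\<phi> y) (D1 \<phi> y u)" for u
    by (rule velocity_tangent[OF W y \<phi>M smooth_on_imp_has_derivative[OF sm y]])
  show "psd_metric TYPE('p) k (\<phi> y) (D1 \<phi> y u) (D1 \<phi> y v) = psd_form k (\<phi> y) (D1 \<phi> y u) (D1 \<phi> y v)" for u v
    by (rule psd_metric_eq_psd_form[OF \<phi>M[OF y] card tan tan])
  show "0 < psd_form k (\<phi> y) (D1 \<phi> y u) (D1 \<phi> y u)" if "u \<noteq> 0" for u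
  proof -
    have "D1 \<phi> y u \<noteq> 0"
      using inj that linear_0[OF linear_D1[OF sm y]] by (metis injD)
    then show ?thesis using psd_form_pos[OF \<phi>M[OF y] card k tan] by blast
  qed
qed (rule psd_form_bilinear psd_form_sym psd_form_deriv_linear psd_form_has_derivative; assumption)+


section \<open>The geodesic system\<close>

text \<open>In a factorization \<open>A = U S U\<^sup>T\<close> with horizontal motion \<open>U' = \<Delta>\<close>, the first block is \<open>\<Delta> U\<^sup>T\<close> and the second
  one is \<open>U S\<^sup>-\<^sup>1 S' U\<^sup>T\<close>.\<close>

definition turn :: "real^'n^'n \<Rightarrow> real^'n^'n \<Rightarrow> real^'n^'n" where
  "turn A a = coproj A ** a ** pinv A"

definition stretch :: "real^'n^'n \<Rightarrow> real^'n^'n \<Rightarrow> real^'n^'n" where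
  "stretch A a = pinv A ** a ** A ** pinv A"

lemma tangent_blocks_psd:
  assumes "A \<in> psd_rank CARD('p::finite)" "tangent A a"
  shows "tangent_blocks A (pinv A) a (turn A a) (stretch A a)"
  using pinv_psd_rank[OF assms(1)] assms(2)
  by unfold_locales (simp_all add: turn_def stretch_def tangent_def coproj_def)

lemma vector_derivative_unique_on_open:
  assumes "open I" "t \<in> I" "\<And>s. s \<in> I \<Longrightarrow> f s = g s"
    and "(f has_vector_derivative f') (at t)" "(g has_vector_derivative g') (at t)"
  shows "f' = g'"
  using has_vector_derivative_transform_within_open[OF assms(4,1,2), of g] assms(3,5)
  by (metis vector_derivative_unique_at)

text \<open>A twice differentiable curve of matrices whose rank is the cardinality of the type carried by
  \<open>range_dim\<close>.\<close>

locale psd_path =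
  fixes I :: "real set" and \<gamma> \<gamma>1 \<gamma>2 :: "real \<Rightarrow> real^'n^'n" and range_dim :: "'p::finite itself"
  assumes I: "open I" and mem: "\<And>s. s \<in> I \<Longrightarrow> \<gamma> s \<in> psd_rank CARD('p)"
    and \<gamma>1: "\<And>s. s \<in> I \<Longrightarrow> (\<gamma> has_vector_derivative \<gamma>1 s) (at s)"
    and \<gamma>2: "\<And>s. s \<in> I \<Longrightarrow> (\<gamma>1 has_vector_derivative \<gamma>2 s) (at s)"
begin

abbreviation "B s \<equiv> pinv (\<gamma> s)"
abbreviation "X s \<equiv> turn (\<gamma> s) (\<gamma>1 s)"
abbreviation "W s \<equiv> stretch (\<gamma> s) (\<gamma>1 s)"

lemma tangent_velocity: "s \<in> I \<Longrightarrow> tangent (\<gamma> s) (\<gamma>1 s)"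
  using velocity_tangent[OF I _ mem \<gamma>1[unfolded has_vector_derivative_def], of s 1] by simp

lemma blocks: "s \<in> I \<Longrightarrow> tangent_blocks (\<gamma> s) (B s) (\<gamma>1 s) (X s) (W s)"
  by (rule tangent_blocks_psd[OF mem tangent_velocity])

lemma pinv_derivative:
  assumes t: "t \<in> I"
  shows "((\<lambda>s. B s) has_vector_derivative - (W t ** B t) + B t ** transpose (X t) + X t ** B t) (at t)"
proof -
  interpret tangent_blocks_pair "\<gamma> t" "B t" "\<gamma>1 t" "X t" "W t" "\<gamma>1 t" "X t" "W t"
    by (intro tangent_blocks_pair.intro blocks t)
  have "((\<lambda>s. B s) has_derivative (\<lambda>h. pinv_deriv (\<gamma> t) (h *\<^sub>R \<gamma>1 t))) (at t)"
    by (rule pinv_comp_has_derivative[OF I t mem \<gamma>1[OF t, unfolded has_vector_derivative_def]])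
  moreover have "pinv_deriv (\<gamma> t) (h *\<^sub>R \<gamma>1 t) = h *\<^sub>R pinv_deriv (\<gamma> t) (\<gamma>1 t)" for h
    by (simp add: matrix_mul_scaleR_left matrix_mul_scaleR_right scaleR_add_right scaleR_diff_right)
  ultimately show ?thesis
    unfolding has_vector_derivative_def by (simp only: beta)
qed

lemma proj_derivative:
  assumes t: "t \<in> I"
  shows "((\<lambda>s. \<gamma> s ** B s) has_vector_derivative X t + transpose (X t)) (at t)"
proof -
  interpret tangent_blocks_pair "\<gamma> t" "B t" "\<gamma>1 t" "X t" "W t" "\<gamma>1 t" "X t" "W t"
    by (intro tangent_blocks_pair.intro blocks t)
  show ?thesis
    by (rule has_vector_derivative_eq_rhs[OF has_vector_derivative_matrix_mul[OF \<gamma>1[OF t] pinv_derivative[OF t]]])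
      (use proj_variation[unfolded beta] in \<open>simp only: add.commute\<close>)
qed

text \<open>Each of the relations is the derivative of an algebraic relation between \<open>\<gamma>\<close>, its pseudoinverse and
  the two blocks.\<close>

lemma block_derivatives:
  assumes t: "t \<in> I"
  obtains X' W' where "(X has_vector_derivative X') (at t)" "(W has_vector_derivative W') (at t)"
    "\<gamma> t ** B t ** X' = - (transpose (X t) ** X t)" "(mat 1 - \<gamma> t ** B t) ** W' = X t ** W t"
    "X' ** (mat 1 - \<gamma> t ** B t) = X t ** transpose (X t)" "W' ** (mat 1 - \<gamma> t ** B t) = W t ** transpose (X t)"
    "transpose (W' ** B t + W t ** (- (W t ** B t) + B t ** transpose (X t) + X t ** B t))
       = W' ** B t + W t ** (- (W t ** B t) + B t ** transpose (X t) + X t ** B t)"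
proof -
  interpret tangent_blocks "\<gamma> t" "B t" "\<gamma>1 t" "X t" "W t" by (rule blocks[OF t])
  note dP = proj_derivative[OF t] and dB = pinv_derivative[OF t]
  have "((\<lambda>s. (mat 1 - \<gamma> s ** B s) ** \<gamma>1 s ** B s) has_vector_derivative
      (mat 1 - \<gamma> t ** B t) ** \<gamma>1 t ** (- (W t ** B t) + B t ** transpose (X t) + X t ** B t) +
      ((mat 1 - \<gamma> t ** B t) ** \<gamma>2 t + (0 - (X t + transpose (X t))) ** \<gamma>1 t) ** B t) (at t)"
    by (intro has_vector_derivative_matrix_mul has_vector_derivative_diff has_vector_derivative_const dP dB \<gamma>2 t)
  then obtain X' where X': "(X has_vector_derivative X') (at t)"
    unfolding turn_def coproj_def by blast
  have "((\<lambda>s. B s ** \<gamma>1 s ** (\<gamma> s ** B s)) has_vector_derivative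
      B t ** \<gamma>1 t ** (X t + transpose (X t)) +
      (B t ** \<gamma>2 t + (- (W t ** B t) + B t ** transpose (X t) + X t ** B t) ** \<gamma>1 t) ** (\<gamma> t ** B t)) (at t)"
    by (intro has_vector_derivative_matrix_mul dP dB \<gamma>2 t)
  then obtain W' where W': "(W has_vector_derivative W') (at t)"
    unfolding stretch_def by (auto simp: matrix_mul_assoc)
  note unique = vector_derivative_unique_on_open[OF I t]
  have "\<gamma> t ** B t ** X' + (X t + transpose (X t)) ** X t = 0"
    by (rule unique[OF _ has_vector_derivative_matrix_mul[OF dP X'] has_vector_derivative_const[of 0]])
      (simp add: tangent_blocks.X_block[OF blocks] matrix_mul_assoc[symmetric])
  then have 1: "\<gamma> t ** B t ** X' = - (transpose (X t) ** X t)"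
    by (simp add: matrix_add_rdistrib XX eq_neg_iff_add_eq_0)
  have "\<gamma> t ** B t ** W' + (X t + transpose (X t)) ** W t = W'"
    by (rule unique[OF _ has_vector_derivative_matrix_mul[OF dP W'] W'])
      (simp add: tangent_blocks.W_block[OF blocks] matrix_mul_assoc[symmetric])
  then have 2: "(mat 1 - \<gamma> t ** B t) ** W' = X t ** W t"
    by (simp add: matrix_add_rdistrib matrix_mul_sub_rdistrib XX algebra_simps)
  have "X t ** (X t + transpose (X t)) + X' ** (\<gamma> t ** B t) = X'"
    by (rule unique[OF _ has_vector_derivative_matrix_mul[OF X' dP] X'])
      (simp add: tangent_blocks.X_block[OF blocks])
  then have 3: "X' ** (mat 1 - \<gamma> t ** B t) = X t ** transpose (X t)"
    by (simp add: matrix_add_ldistrib matrix_mul_sub_ldistrib XX algebra_simps)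
  have "W t ** (X t + transpose (X t)) + W' ** (\<gamma> t ** B t) = W'"
    by (rule unique[OF _ has_vector_derivative_matrix_mul[OF W' dP] W'])
      (simp add: tangent_blocks.W_block[OF blocks])
  then have 4: "W' ** (mat 1 - \<gamma> t ** B t) = W t ** transpose (X t)"
    by (simp add: matrix_add_ldistrib matrix_mul_sub_ldistrib XX algebra_simps)
  note dWB = has_vector_derivative_matrix_mul[OF W' dB]
  have "transpose (W t ** (- (W t ** B t) + B t ** transpose (X t) + X t ** B t) + W' ** B t)
      = W t ** (- (W t ** B t) + B t ** transpose (X t) + X t ** B t) + W' ** B t"
    by (rule unique[OF _ has_vector_derivative_transpose[OF dWB] dWB])
      (simp add: transpose_simps tangent_blocks.W_selfadjoint[OF blocks] tangent_blocks.Bt[OF blocks])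
  then show ?thesis using that[OF X' W' 1 2 3 4] by (simp add: add.commute)
qed

text \<open>For symmetric \<open>b\<close> the pairing \<open>psd_form k (\<gamma> s) (\<gamma>1 s) b\<close> is the trace of \<open>b\<close> against
  \<open>B X\<^sup>T + k W B\<close>, which is differentiated by the product rule.\<close>

lemma euler_lagrange_blocks:
  assumes t: "t \<in> I" and b: "tangent (\<gamma> t) b"
    and X': "(X has_vector_derivative X') (at t)" and W': "(W has_vector_derivative W') (at t)"
    and PX': "\<gamma> t ** B t ** X' = - (transpose (X t) ** X t)"
    and PW': "(mat 1 - \<gamma> t ** B t) ** W' = X t ** W t"
  shows "euler_lagrange (psd_form k) (psd_form_deriv k) (\<gamma> t) (\<gamma>1 t) (\<gamma>2 t) b =
     trace (transpose (turn (\<gamma> t) b) ** (X' + (2 * k) *\<^sub>R (X t ** W t) - (2 * k) *\<^sub>R (X t ** transpose (W t))))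
     + k * trace (stretch (\<gamma> t) b ** W')"
proof -
  interpret tangent_blocks_pair "\<gamma> t" "B t" "\<gamma>1 t" "X t" "W t" b "turn (\<gamma> t) b" "stretch (\<gamma> t) b"
    by (intro tangent_blocks_pair.intro blocks t tangent_blocks_psd[OF mem[OF t] b])
  have bt: "transpose b = b" using b by (simp add: tangent_def)
  let ?B' = "- (W t ** B t) + B t ** transpose (X t) + X t ** B t"
  have form: "psd_form k (\<gamma> s) (\<gamma>1 s) b = trace ((B s ** transpose (X s) + k *\<^sub>R (W s ** B s)) ** b)" if "s \<in> I" for s
  proof -
    interpret s: tangent_blocks "\<gamma> s" "B s" "\<gamma>1 s" "X s" "W s" by (rule blocks[OF that])
    have Xt: "B s ** \<gamma>1 s ** coproj (\<gamma> s) = transpose (X s)"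
      by (simp add: s.transposes coproj_def)
    have ct: "transpose (coproj (\<gamma> s)) = coproj (\<gamma> s)"
      by (simp add: coproj_def transpose_simps s.At s.Bt s.AB)
    have "(B s ** \<gamma>1 s ** coproj (\<gamma> s)) \<bullet> (B s ** b ** coproj (\<gamma> s))
        = trace (transpose (B s ** b ** coproj (\<gamma> s)) ** transpose (X s))"
      unfolding Xt by (simp add: trace_inner inner_commute)
    also have "\<dots> = trace (coproj (\<gamma> s) ** (b ** (B s ** transpose (X s))))"
      by (simp add: transpose_simps ct bt s.Bt matrix_mul_assoc)
    also have "\<dots> = trace (b ** (B s ** (transpose (X s) ** coproj (\<gamma> s))))"
      by (subst trace_mul_sym) (simp add: matrix_mul_assoc)
    also have "transpose (X s) ** coproj (\<gamma> s) = transpose (X s)"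
      by (simp add: coproj_def matrix_mul_sub_ldistrib matrix_mul_assoc s.Xt_block)
    also have "trace (b ** (B s ** transpose (X s))) = trace (B s ** transpose (X s) ** b)"
      by (rule trace_mul_sym)
    finally have 1: "(B s ** \<gamma>1 s ** coproj (\<gamma> s)) \<bullet> (B s ** b ** coproj (\<gamma> s)) = trace (B s ** transpose (X s) ** b)" .
    have "B s ** \<gamma>1 s ** B s = W s ** B s"
      by (simp add: s.W matrix_mul_assoc[symmetric] s.AB_words)
    then show ?thesis
      unfolding psd_form_def 1 by (simp add: matrix_add_rdistrib trace_add matrix_mul_scaleR_left trace_scaleR)
  qed
  have "((\<lambda>s. (B s ** transpose (X s) + k *\<^sub>R (W s ** B s)) ** b) has_vector_derivative
      (B t ** transpose X' + ?B' ** transpose (X t) + k *\<^sub>R (W t ** ?B' + W' ** B t)) ** b) (at t)"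
    by (rule bounded_linear.has_vector_derivative[OF bounded_bilinear.bounded_linear_left[OF bounded_bilinear_matrix_mul]])
      (intro has_vector_derivative_add has_vector_derivative_matrix_mul has_vector_derivative_transpose X' W'
        pinv_derivative[OF t] bounded_linear.has_vector_derivative[OF bounded_linear_scaleR_right])
  then have "((\<lambda>s. trace ((B s ** transpose (X s) + k *\<^sub>R (W s ** B s)) ** b)) has_vector_derivative
      trace ((B t ** transpose X' + ?B' ** transpose (X t) + k *\<^sub>R (W t ** ?B' + W' ** B t)) ** b)) (at t)"
    by (rule bounded_linear.has_vector_derivative[OF bounded_linear_trace])
  then have d1: "((\<lambda>s. psd_form k (\<gamma> s) (\<gamma>1 s) b) has_vector_derivative
      trace ((B t ** transpose X' + ?B' ** transpose (X t) + k *\<^sub>R (W t ** ?B' + W' ** B t)) ** b)) (at t)"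
    by (rule has_vector_derivative_transform_within_open[OF _ I t]) (simp add: form)
  have "((\<lambda>s. psd_form k (\<gamma> s) (\<gamma>1 s) b) has_derivative
      (\<lambda>h. psd_form_deriv k (\<gamma> t) (h *\<^sub>R \<gamma>1 t) (\<gamma>1 t) b + (psd_form k (\<gamma> t) (h *\<^sub>R \<gamma>2 t) b + psd_form k (\<gamma> t) (\<gamma>1 t) 0))) (at t)"
    by (rule psd_form_has_derivative[OF I t mem])
      (use \<gamma>1[OF t] \<gamma>2[OF t] in \<open>auto simp: has_vector_derivative_def\<close>)
  moreover have "psd_form_deriv k (\<gamma> t) (h *\<^sub>R \<gamma>1 t) (\<gamma>1 t) b + (psd_form k (\<gamma> t) (h *\<^sub>R \<gamma>2 t) b + psd_form k (\<gamma> t) (\<gamma>1 t) 0)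
      = h *\<^sub>R (psd_form_deriv k (\<gamma> t) (\<gamma>1 t) (\<gamma>1 t) b + psd_form k (\<gamma> t) (\<gamma>2 t) b)" for h
    by (simp add: linear_scale[OF psd_form_deriv_linear(1)] bounded_bilinear.scaleR_left[OF psd_form_bilinear]
        bounded_bilinear.zero_right[OF psd_form_bilinear] distrib_left)
  ultimately have d2: "((\<lambda>s. psd_form k (\<gamma> s) (\<gamma>1 s) b) has_vector_derivative
      psd_form_deriv k (\<gamma> t) (\<gamma>1 t) (\<gamma>1 t) b + psd_form k (\<gamma> t) (\<gamma>2 t) b) (at t)"
    by (simp add: has_vector_derivative_def)
  have eq1: "psd_form k (\<gamma> t) (\<gamma>2 t) b + psd_form_deriv k (\<gamma> t) (\<gamma>1 t) (\<gamma>1 t) b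
      = trace ((?B' ** transpose (X t) + B t ** transpose X' + k *\<^sub>R (W' ** B t + W t ** ?B')) ** b)"
    using vector_derivative_unique_at[OF d1 d2] by (simp add: add.commute)
  have "psd_form_deriv k (\<gamma> t) b (\<gamma>1 t) (\<gamma>1 t) =
      2 * ((\<beta> ** \<gamma>1 t ** coproj (\<gamma> t) - B t ** \<gamma>1 t ** (b ** B t + \<gamma> t ** \<beta>)) \<bullet> transpose (X t))
      + k * (trace (\<beta> ** \<gamma>1 t ** B t ** \<gamma>1 t) + trace (B t ** \<gamma>1 t ** \<beta> ** \<gamma>1 t))"
    unfolding psd_form_deriv_def a.transposes by (simp add: coproj_def inner_commute add.commute)
  also have "trace (B t ** \<gamma>1 t ** \<beta> ** \<gamma>1 t) = trace (\<beta> ** \<gamma>1 t ** B t ** \<gamma>1 t)"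
    using trace_mul_sym[of "B t ** \<gamma>1 t" "\<beta> ** \<gamma>1 t"] by (simp only: matrix_mul_assoc)
  also have "M \<bullet> transpose (X t) = trace (X t ** M)" for M
    using trace_inner[of "transpose (X t)" M] by (simp add: inner_commute)
  finally have eq2: "psd_form_deriv k (\<gamma> t) b (\<gamma>1 t) (\<gamma>1 t) / 2 =
      trace (X t ** (\<beta> ** (\<gamma>1 t ** (mat 1 - \<gamma> t ** B t)))) - trace (X t ** (B t ** (\<gamma>1 t ** (b ** B t + \<gamma> t ** \<beta>))))
        + k * trace (\<beta> ** (\<gamma>1 t ** (B t ** \<gamma>1 t)))"
    by (simp only: coproj_def matrix_mul_sub_ldistrib trace_sub matrix_mul_assoc) simp
  show ?thesis
    unfolding euler_lagrange_def eq1 eq2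
    by (rule trace_euler_lagrange[OF PX' PW' refl])
qed

end

context psd_path
begin

text \<open>Testing with the tangent vector whose first block is the residual \<open>Z\<close> of the first equation and whose second
  block is zero shows that \<open>Z = 0\<close>. Since \<open>W B\<close> is symmetric along the curve, \<open>P W' B\<close> is symmetric and may itself
  be used as a tangent vector. This test shows that it vanishes, and the other blocks of \<open>W'\<close> are known.\<close>

lemma euler_lagrange_zero_iff:
  assumes t: "t \<in> I" and k: "k > 0"
  shows "(\<forall>b. tangent (\<gamma> t) b \<longrightarrow> euler_lagrange (psd_form k) (psd_form_deriv k) (\<gamma> t) (\<gamma>1 t) (\<gamma>2 t) b = 0) \<longleftrightarrow>
     (X has_vector_derivative X t ** transpose (X t) - transpose (X t) ** X t
        + X t ** ((2 * k) *\<^sub>R (transpose (W t) - W t))) (at t) \<and>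
     (W has_vector_derivative X t ** W t + W t ** transpose (X t)) (at t)"
proof -
  interpret tangent_blocks "\<gamma> t" "B t" "\<gamma>1 t" "X t" "W t" by (rule blocks[OF t])
  define B' where "B' = - (W t ** B t) + B t ** transpose (X t) + X t ** B t"
  define P where "P = \<gamma> t ** B t"
  obtain X' W' where X': "(X has_vector_derivative X') (at t)" and W': "(W has_vector_derivative W') (at t)"
    and PX': "P ** X' = - (transpose (X t) ** X t)" and QW': "(mat 1 - P) ** W' = X t ** W t"
    and X'Q: "X' ** (mat 1 - P) = X t ** transpose (X t)" and W'Q: "W' ** (mat 1 - P) = W t ** transpose (X t)"
    and S: "transpose (W' ** B t + W t ** B') = W' ** B t + W t ** B'"
    unfolding P_def B'_def using block_derivatives[OF t] .
  note EL = euler_lagrange_blocks[OF t _ X' W' PX'[unfolded P_def] QW'[unfolded P_def], where k = k]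
  have P: "P ** \<gamma> t = \<gamma> t" "\<gamma> t ** P = \<gamma> t" "P ** B t = B t" "B t ** P = B t" "P ** P = P" "transpose P = P"
    by (simp_all add: P_def transpose_simps At Bt AB_simps)
  have PX: "P ** X t = 0" "X t ** P = X t" "P ** transpose (X t) = transpose (X t)" "transpose (X t) ** P = 0"
    using X_block Xt_block by (simp_all add: P_def matrix_mul_assoc[symmetric] matrix_mul_assoc[of "transpose (X t)" "\<gamma> t"])
  have PW: "P ** W t = W t" "W t ** P = W t" "transpose (W t) ** P = transpose (W t)"
    using W_block Wt_block by (simp_all add: P_def matrix_mul_assoc[symmetric])
  define M where "M = X' + (2 * k) *\<^sub>R (X t ** W t) - (2 * k) *\<^sub>R (X t ** transpose (W t))"
  (* the residuals of the two equations *)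
  define Z where "Z = M + transpose (X t) ** X t - X t ** transpose (X t)"
  define R where "R = W' - X t ** W t - W t ** transpose (X t)"
  have iff: "(X has_vector_derivative X t ** transpose (X t) - transpose (X t) ** X t
        + X t ** ((2 * k) *\<^sub>R (transpose (W t) - W t))) (at t) \<longleftrightarrow> Z = 0"
    "(W has_vector_derivative X t ** W t + W t ** transpose (X t)) (at t) \<longleftrightarrow> R = 0"
  proof -
    have "(f has_vector_derivative d) (at t) \<longleftrightarrow> f' = d" if "(f has_vector_derivative f') (at t)"
      for f :: "real \<Rightarrow> real^'n^'n" and f' d
      using that vector_derivative_unique_at by blast
    then show "(X has_vector_derivative X t ** transpose (X t) - transpose (X t) ** X t
        + X t ** ((2 * k) *\<^sub>R (transpose (W t) - W t))) (at t) \<longleftrightarrow> Z = 0"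
      "(W has_vector_derivative X t ** W t + W t ** transpose (X t)) (at t) \<longleftrightarrow> R = 0"
      using X' W' by (auto simp: Z_def M_def R_def matrix_mul_sub_ldistrib matrix_mul_scaleR_right algebra_simps)
  qed
  show ?thesis
    unfolding iff
  proof
    assume ZR: "Z = 0 \<and> R = 0"
    show "\<forall>b. tangent (\<gamma> t) b \<longrightarrow> euler_lagrange (psd_form k) (psd_form_deriv k) (\<gamma> t) (\<gamma>1 t) (\<gamma>2 t) b = 0"
    proof (intro allI impI)
      fix b assume b: "tangent (\<gamma> t) b"
      interpret tangent_blocks_pair "\<gamma> t" "B t" "\<gamma>1 t" "X t" "W t" b "turn (\<gamma> t) b" "stretch (\<gamma> t) b"
        by (intro tangent_blocks_pair.intro blocks t tangent_blocks_psd[OF mem[OF t] b])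
      let ?Y = "turn (\<gamma> t) b" and ?V = "stretch (\<gamma> t) b"
      have "M = X t ** transpose (X t) - transpose (X t) ** X t" using ZR by (simp add: Z_def algebra_simps)
      then have "transpose ?Y ** M = transpose ?Y ** (X t ** transpose (X t)) - (transpose ?Y ** transpose (X t)) ** X t"
        by (simp add: matrix_mul_sub_ldistrib matrix_mul_assoc)
      also have "transpose ?Y ** transpose (X t) = 0"
        using arg_cong[OF cross(1), of transpose] by (simp add: transpose_simps)
      finally have "trace (transpose ?Y ** M) = trace (transpose ?Y ** X t ** transpose (X t))"
        by (simp add: matrix_mul_assoc)
      also have "\<dots> = trace (transpose (X t) ** transpose ?Y ** X t)"
        by (subst trace_mul_sym) (simp add: matrix_mul_assoc)
      finally have 1: "trace (transpose ?Y ** M) = 0" by (simp add: cross)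
      have "W' = X t ** W t + W t ** transpose (X t)" using ZR by (simp add: R_def algebra_simps)
      then have "?V ** W' = ?V ** W t ** transpose (X t)"
        by (simp add: matrix_add_ldistrib cross[THEN matrix_mul_reassoc]) (simp add: matrix_mul_assoc)
      then have "trace (?V ** W') = trace (transpose (X t) ** (?V ** W t))"
        using trace_mul_sym[of "?V ** W t" "transpose (X t)"] by simp
      then have 2: "trace (?V ** W') = 0" by (simp add: cross[THEN matrix_mul_reassoc])
      show "euler_lagrange (psd_form k) (psd_form_deriv k) (\<gamma> t) (\<gamma>1 t) (\<gamma>2 t) b = 0"
        using EL[OF b] 1 2 by (simp add: M_def)
    qed
  next
    assume el: "\<forall>b. tangent (\<gamma> t) b \<longrightarrow> euler_lagrange (psd_form k) (psd_form_deriv k) (\<gamma> t) (\<gamma>1 t) (\<gamma>2 t) b = 0"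
    have PZ: "P ** Z = 0"
    proof -
      have "P ** Z = P ** X' + transpose (X t) ** X t"
        using PX by (simp add: Z_def M_def matrix_distribs PX[THEN matrix_mul_reassoc])
      then show ?thesis by (simp add: PX')
    qed
    have ZP: "Z ** P = Z"
    proof -
      have "Z ** (mat 1 - P) = X' ** (mat 1 - P) - X t ** transpose (X t)"
        by (simp add: Z_def M_def matrix_distribs PX PW matrix_mul_assoc[symmetric])
      then show ?thesis using X'Q by (simp add: matrix_mul_sub_ldistrib)
    qed
    have Zt: "transpose Z ** P = 0" "P ** transpose Z = transpose Z"
      using arg_cong[OF PZ, of transpose] arg_cong[OF ZP, of transpose] by (simp_all add: transpose_simps P)
    have BZ: "B t ** Z = 0" "transpose Z ** \<gamma> t = 0"
      using PZ Zt(1) P(1,4) by (metis matrix_mul_assoc matrix_mul_rzero, metis matrix_mul_assoc matrix_mul_lzero)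
    have "Z = 0"
    proof -
      let ?b = "Z ** \<gamma> t + \<gamma> t ** transpose Z"
      have tan: "tangent (\<gamma> t) ?b"
        unfolding tangent_def coproj_def P_def[symmetric]
        by (simp add: transpose_simps At add.commute matrix_distribs P matrix_mul_assoc[symmetric]
            P(1-5)[THEN matrix_mul_reassoc] PZ[THEN matrix_mul_reassoc])
      have turn: "turn (\<gamma> t) ?b = Z"
        unfolding turn_def coproj_def P_def[symmetric]
        by (simp add: matrix_distribs P matrix_mul_assoc[symmetric] PZ[THEN matrix_mul_reassoc]
            P(1-5)[THEN matrix_mul_reassoc] P_def[symmetric] ZP)
      have stretch: "stretch (\<gamma> t) ?b = 0"
        unfolding stretch_def
        by (simp add: matrix_distribs matrix_mul_assoc[symmetric] BZ[THEN matrix_mul_reassoc])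
      have "trace (transpose Z ** M) = 0"
        using EL[OF tan] el tan by (simp add: turn stretch M_def)
      also have "transpose Z ** M = transpose Z ** Z - transpose Z ** (transpose (X t) ** X t) + transpose Z ** (X t ** transpose (X t))"
        by (simp add: Z_def matrix_distribs)
      also have "transpose Z ** (transpose (X t) ** X t) = (transpose Z ** P) ** (transpose (X t) ** X t)"
        by (simp add: matrix_mul_assoc[symmetric] PX[THEN matrix_mul_reassoc])
      also have "trace (transpose Z ** Z - transpose Z ** P ** (transpose (X t) ** X t) + transpose Z ** (X t ** transpose (X t)))
          = trace (transpose Z ** Z) + trace (transpose Z ** (X t ** transpose (X t)))"
        by (simp add: Zt trace_add)
      also have "trace (transpose Z ** (X t ** transpose (X t))) = trace (P ** transpose Z ** (X t ** transpose (X t)))"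
        by (simp add: Zt)
      also have "\<dots> = trace (transpose Z ** (X t ** transpose (X t)) ** P)"
        using trace_mul_sym[of P "transpose Z ** (X t ** transpose (X t))"] by (simp add: matrix_mul_assoc)
      finally have "trace (transpose Z ** Z) = 0" by (simp add: matrix_mul_assoc[symmetric] PX)
      then show ?thesis by (simp add: trace_inner)
    qed
    moreover have "R = 0"
    proof -
      define b where "b = P ** W' ** B t"
      have "W t ** (W t ** B t) = W t ** (B t ** transpose (W t))" by (simp add: W_selfadjoint)
      also have "\<dots> = B t ** (transpose (W t) ** transpose (W t))"
        by (simp only: matrix_mul_assoc W_selfadjoint(2)[symmetric])
      finally have WWB: "transpose (W t ** (W t ** B t)) = W t ** (W t ** B t)"
        by (simp add: transpose_simps Bt matrix_mul_assoc)
      have "P ** (W' ** B t + W t ** B') ** P = b - W t ** (W t ** B t)"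
        by (simp add: b_def B'_def matrix_distribs matrix_mul_assoc[symmetric] P PX PW PW[THEN matrix_mul_reassoc]
          XX[THEN matrix_mul_reassoc])
      then have b_eq: "b = P ** (W' ** B t + W t ** B') ** P + W t ** (W t ** B t)" by simp
      have bt: "transpose b = b"
        unfolding b_eq by (simp add: transpose_add WWB) (simp add: transpose_simps P S[unfolded transpose_simps] matrix_mul_assoc)
      have Pb: "P ** b = b" "b ** P = b"
        by (simp_all add: b_def matrix_mul_assoc[symmetric] P P(1-5)[THEN matrix_mul_reassoc])
      have tan: "tangent (\<gamma> t) b"
        unfolding tangent_def coproj_def P_def[symmetric] by (simp add: bt matrix_distribs Pb)
      have turn: "turn (\<gamma> t) b = 0"
        unfolding turn_def coproj_def P_def[symmetric] by (simp add: matrix_distribs Pb)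
      have stretch: "stretch (\<gamma> t) b = B t ** b"
        unfolding stretch_def by (simp add: matrix_mul_assoc[symmetric] P_def[symmetric] Pb)
      have "trace (B t ** b ** W') = 0"
        using EL[OF tan] el tan k by (simp add: turn stretch)
      also have "trace (B t ** b ** W') = trace (b ** W' ** B t)"
        using trace_mul_sym[of "B t" "b ** W'"] by (simp add: matrix_mul_assoc)
      also have "b ** W' ** B t = b ** P ** W' ** B t" by (simp add: Pb)
      also have "\<dots> = transpose b ** b" by (simp add: bt) (simp add: b_def matrix_mul_assoc[symmetric])
      finally have "b = 0" by (simp add: trace_inner)
      then have "P ** W' ** B t ** \<gamma> t = 0" by (simp add: b_def)
      then have PWP: "P ** W' ** P = 0" using AB by (simp add: P_def matrix_mul_assoc[symmetric])
      have "P ** (W' ** (mat 1 - P)) = W t ** transpose (X t)"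
        unfolding W'Q by (simp add: matrix_mul_assoc PW)
      then have "P ** W' = W t ** transpose (X t)" using PWP by (simp add: matrix_distribs matrix_mul_assoc)
      then show ?thesis using QW' by (simp add: R_def matrix_mul_sub_rdistrib algebra_simps)
    qed
    ultimately show "Z = 0 \<and> R = 0" by simp
  qed
qed

end


section \<open>Local parametrizations\<close>

text \<open>The symmetrized matrix units form an orthogonal basis. They are indexed by the sets \<open>{i, j}\<close>, so that the
  index type needs no order.\<close>

lemma dim_sym_matrices: "dim (sym_matrices :: (real^'p^'p) set) = CARD('p) * (CARD('p) + 1) div 2"
proof -
  define S where "S = {s :: 'p set. card s = 1} \<union> {s. card s = 2}"
  define M where "M s = ((\<chi> i j. if {i, j} = s then 1 else 0) :: real^'p^'p)" for s
  have S_iff: "s \<in> S \<longleftrightarrow> (\<exists>i j. s = {i, j})" for s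
    unfolding S_def by (auto simp: card_1_singleton_iff card_2_iff)
  have finS: "finite S" by simp
  have "card S = card {s :: 'p set. card s = 1} + card {s :: 'p set. card s = 2}"
    unfolding S_def by (rule card_Un_disjoint) auto
  also have "\<dots> = (CARD('p) choose 1) + (CARD('p) choose 2)"
    using n_subsets[of "UNIV :: 'p set" 1] n_subsets[of "UNIV :: 'p set" 2] by simp
  also have "\<dots> = CARD('p) * (CARD('p) + 1) div 2"
  proof -
    have "(CARD('p) choose 2) * 2 = CARD('p) * (CARD('p) - 1)"
      unfolding choose_two by simp
    then have "CARD('p) * (CARD('p) + 1) = 2 * (CARD('p) + (CARD('p) choose 2))"
      by (cases "CARD('p)") auto
    then show ?thesis by simp
  qed
  finally have cardS: "card S = CARD('p) * (CARD('p) + 1) div 2" .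
  have inner: "M s \<bullet> M r = 0" if "s \<noteq> r" for s r
    unfolding inner_vec_def M_def using that by (auto intro!: sum.neutral split: if_splits)
  have nz: "M s \<noteq> 0" if "s \<in> S" for s
  proof -
    obtain i j where "s = {i, j}" using \<open>s \<in> S\<close> S_iff by blast
    then have "M s $ i $ j = 1" by (simp add: M_def)
    then show ?thesis by auto
  qed
  have injM: "inj_on M S"
    by (rule inj_onI) (metis inner nz inner_eq_zero_iff)
  have "pairwise orthogonal (M ` S)"
  proof (rule pairwiseI)
    fix x y assume "x \<in> M ` S" "y \<in> M ` S" "x \<noteq> y"
    then obtain s r where "x = M s" "y = M r" "s \<noteq> r" by auto
    then show "orthogonal x y" using inner by (simp add: orthogonal_def)
  qed
  moreover have "0 \<notin> M ` S" using nz by auto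
  ultimately have ind: "independent (M ` S)" by (rule pairwise_orthogonal_independent)
  have sub: "M ` S \<subseteq> sym_matrices"
    by (auto simp: sym_matrices_def M_def transpose_def vec_eq_iff insert_commute)
  have "A \<in> span (M ` S)" if "A \<in> sym_matrices" for A
  proof -
    have Aij: "A $ i $ j = A $ j $ i" for i j
      using that by (auto simp: sym_matrices_def transpose_def vec_eq_iff)
    define c where "c s = (SOME x. \<exists>i j. s = {i, j} \<and> x = A $ i $ j)" for s
    have c: "c {i, j} = A $ i $ j" for i j
      unfolding c_def
    proof (rule some_equality)
      show "\<exists>i' j'. {i, j} = {i', j'} \<and> A $ i $ j = A $ i' $ j'" by blast
      show "x = A $ i $ j" if "\<exists>i' j'. {i, j} = {i', j'} \<and> x = A $ i' $ j'" for x
        using that Aij by (auto simp: doubleton_eq_iff)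
    qed
    have "A = (\<Sum>s\<in>S. c s *\<^sub>R M s)"
    proof -
      have "(\<Sum>s\<in>S. c s *\<^sub>R M s) $ i $ j = A $ i $ j" for i j
      proof -
        have "{i, j} \<in> S" using S_iff by blast
        have "(\<Sum>s\<in>S. c s *\<^sub>R M s) $ i $ j = (\<Sum>s\<in>S. c s * M s $ i $ j)"
          by simp
        also have "\<dots> = (\<Sum>s\<in>S. if {i, j} = s then c s else 0)"
          by (rule sum.cong) (auto simp: M_def)
        also have "\<dots> = c {i, j}" using finS \<open>{i, j} \<in> S\<close> by simp
        finally show ?thesis by (simp add: c)
      qed
      then show ?thesis by (simp add: vec_eq_iff)
    qed
    also have "\<dots> \<in> span (M ` S)" by (intro span_sum span_scale span_base) auto
    finally show ?thesis .
  qed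
  then have "sym_matrices \<subseteq> span (M ` S)" by blast
  then have "dim (sym_matrices :: (real^'p^'p) set) = card (M ` S)"
    using dim_unique[OF sub _ ind] by blast
  then show ?thesis using cardS card_image[OF injM] by simp
qed

lemma subspace_sym_matrices: "subspace (sym_matrices :: (real^'p^'p) set)"
  by (auto simp: subspace_def sym_matrices_def transpose_simps)

lemma ex_psd_coordinates:
  assumes card: "CARD('p::finite) < CARD('n::finite)"
  obtains L :: "real^('n::finite, 'p::finite) psd_coord \<Rightarrow> (real^'p^'p) \<times> (real^'p^('n, 'p) codim)" and G
  where "bounded_linear L" "bounded_linear G" "\<And>c. fst (L c) \<in> sym_matrices" "\<And>c. G (L c) = c"
    "\<And>S Y. S \<in> sym_matrices \<Longrightarrow> L (G (S, Y)) = (S, Y)"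
proof -
  let ?V = "(sym_matrices :: (real^'p^'p) set) \<times> (UNIV :: (real^'p^('n, 'p) codim) set)"
  have sub: "subspace ?V" by (intro subspace_Times subspace_sym_matrices subspace_UNIV)
  have "dim ?V = dim (sym_matrices :: (real^'p^'p) set) + dim (UNIV :: (real^'p^('n, 'p) codim) set)"
    by (rule dim_Times[OF subspace_sym_matrices subspace_UNIV])
  also have "\<dots> = CARD(('n, 'p) psd_coord)"
    using card by (simp add: dim_sym_matrices card_psd_coord card_codim mult.commute)
  finally have "dim (UNIV :: (real^('n, 'p) psd_coord) set) = dim ?V" by simp
  from isometries_subspaces[OF subspace_UNIV sub this]
  obtain L :: "real^('n, 'p) psd_coord \<Rightarrow> (real^'p^'p) \<times> (real^'p^('n, 'p) codim)" and G where
    LG: "linear L" "linear G" "L ` UNIV = ?V" "\<And>c. G (L c) = c" "\<And>v. v \<in> ?V \<Longrightarrow> L (G v) = v"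
    by (metis UNIV_I)
  have "fst (L c) \<in> sym_matrices" for c using LG(3) by (metis mem_Times_iff rangeI)
  then show ?thesis
    using that[of L G] LG by (simp add: linear_conv_bounded_linear)
qed

lemma spd_nearby:
  fixes S :: "real^'p^'p"
  assumes "S \<in> spd_matrices"
  shows "\<exists>e>0. \<forall>S'\<in>sym_matrices. norm (S' - S) < e \<longrightarrow> S' \<in> spd_matrices"
proof -
  obtain c e where ce: "c > 0" "e > 0" "\<And>A x. norm (A - S) < e \<Longrightarrow> c * (norm x)\<^sup>2 \<le> x \<bullet> (A *v x)"
    using compression_coercive_nearby[of "mat 1 :: real^'p^'p" S] assms by auto
  have "S' \<in> spd_matrices" if "S' \<in> sym_matrices" "norm (S' - S) < e" for S'
    unfolding spd_matrices_def
  proof (intro CollectI conjI allI impI that(1))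
    fix x :: "real^'p" assume "x \<noteq> 0"
    then have "0 < c * (norm x)\<^sup>2" using ce(1) by simp
    then show "0 < x \<bullet> (S' *v x)" using ce(3)[OF that(2), of x] by linarith
  qed
  then show ?thesis using ce(2) by blast
qed

lemma continuous_on_matrix_inv_spd: "continuous_on spd_matrices (matrix_inv :: real^'p^'p \<Rightarrow> _)"
proof -
  have "continuous_on (psd_rank CARD('p)) (pinv :: real^'p^'p \<Rightarrow> _)"
    unfolding continuous_on_eq_continuous_within
    using has_derivative_continuous[OF pinv_has_derivative] by blast
  then have "continuous_on spd_matrices (pinv :: real^'p^'p \<Rightarrow> _)"
    by (rule continuous_on_subset) (use spd_imp_psd_rank in auto)
  then show ?thesis by (simp add: pinv_spd cong: continuous_on_cong)
qed

text \<open>Let the columns of \<open>U\<close> and \<open>V\<close> be orthonormal bases of the range of \<open>A0\<close> and of its complement. The matrices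
  of rank \<open>p\<close> whose compression to the range of \<open>A0\<close> is positive definite are the matrices
  \<open>(U + V Y) S (U + V Y)\<^sup>T\<close>, and \<open>S\<close> and \<open>Y S\<close> are recovered as compressions.\<close>

lemma ex_local_parametrization:
  fixes A0 :: "real^'n^'n"
  assumes card: "CARD('p::finite) < CARD('n)" and A0: "A0 \<in> psd_rank CARD('p)"
  shows "\<exists>(\<phi> :: real^('n, 'p) psd_coord \<Rightarrow> real^'n^'n) W y.
     local_parametrization (psd_rank CARD('p)) W \<phi> \<and> y \<in> W \<and> \<phi> y = A0 \<and>
     (\<forall>b. tangent A0 b \<longrightarrow> (\<exists>u. D1 \<phi> y u = b))"
proof -
  let ?M = "psd_rank CARD('p) :: (real^'n^'n) set"
  obtain U :: "real^'p^'n" and S0 where U: "U \<in> stiefel" and S0: "S0 \<in> spd_matrices"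
    and A0_eq: "A0 = U ** S0 ** transpose U"
    using psd_rank_factorization[OF A0] by blast
  obtain V :: "real^('n, 'p) codim^'n" where V: "V \<in> stiefel" "transpose U ** V = 0" "transpose V ** U = 0"
    "U ** transpose U + V ** transpose V = mat 1" using ex_stiefel_complement[OF U card] by blast
  note UU = stiefelD[OF U] and VV = stiefelD[OF V(1)]
  note red = UU VV V(2,3) UU[THEN matrix_mul_reassoc] VV[THEN matrix_mul_reassoc] V(2,3)[THEN matrix_mul_reassoc]
    matrix_mul_assoc[symmetric]
  obtain L :: "real^('n, 'p) psd_coord \<Rightarrow> (real^'p^'p) \<times> (real^'p^('n, 'p) codim)" and G
    where L: "bounded_linear L" and G: "bounded_linear G" and Lsym: "\<And>c. fst (L c) \<in> sym_matrices"
      and GL: "\<And>c. G (L c) = c" and LG: "\<And>S Y. S \<in> sym_matrices \<Longrightarrow> L (G (S, Y)) = (S, Y)"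
    using ex_psd_coordinates[OF card] by metis
  define Sc where "Sc c = fst (L c)" for c
  define Yc where "Yc c = snd (L c)" for c
  have blS: "bounded_linear Sc" and blY: "bounded_linear Yc"
    unfolding Sc_def Yc_def
    by (auto intro: bounded_linear_compose[OF bounded_linear_fst L] bounded_linear_compose[OF bounded_linear_snd L])
  have Sc_sym: "transpose (Sc c) = Sc c" for c using Lsym by (simp add: Sc_def sym_matrices_def)
  define F where "F c = U + V ** Yc c" for c
  define \<phi> where "\<phi> c = F c ** Sc c ** transpose (F c)" for c
  define W where "W = {c. Sc c \<in> spd_matrices}"
  have blVY: "bounded_linear (\<lambda>c. V ** Yc c)"
    by (rule bounded_linear_compose[OF bounded_bilinear.bounded_linear_right[OF bounded_bilinear_matrix_mul] blY])
  have W: "open W"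
    unfolding open_dist
  proof
    fix c assume "c \<in> W"
    then obtain e where e: "e > 0" "\<And>S'. S' \<in> sym_matrices \<Longrightarrow> norm (S' - Sc c) < e \<Longrightarrow> S' \<in> spd_matrices"
      using spd_nearby[of "Sc c"] by (auto simp: W_def)
    have "isCont Sc c" by (rule linear_continuous_at[OF blS])
    then obtain d where d: "d > 0" "\<And>c'. dist c' c < d \<Longrightarrow> dist (Sc c') (Sc c) < e"
      using e(1) unfolding continuous_at_eps_delta by blast
    have "c' \<in> W" if "dist c' c < d" for c'
      unfolding W_def using e(2) d(2)[OF that] Lsym by (simp add: Sc_def dist_norm)
    then show "\<exists>d>0. \<forall>c'. dist c' c < d \<longrightarrow> c' \<in> W" using d(1) by blast
  qed
  have smooth: "smooth_on W \<phi>"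
    unfolding \<phi>_def F_def
    by (intro smooth_on_matrix_mul smooth_on_transpose smooth_on_add smooth_on_const
        smooth_on_bounded_linear W blS blVY)
  have UF: "transpose U ** F c = mat 1" and VF: "transpose V ** F c = Yc c"
    and FU: "transpose (F c) ** U = mat 1" for c
    by (simp_all add: F_def matrix_distribs red transpose_simps)
  have \<phi>M: "\<phi> c \<in> ?M" if "c \<in> W" for c
    unfolding \<phi>_def using conj_in_psd_rank[OF UF] that by (simp add: W_def)
  have S_eq: "transpose U ** \<phi> c ** U = Sc c" for c
    unfolding \<phi>_def by (simp add: matrix_mul_assoc[symmetric] FU UF[THEN matrix_mul_reassoc])
  have Y_eq: "transpose V ** \<phi> c ** U = Yc c ** Sc c" for c
    unfolding \<phi>_def by (simp add: matrix_mul_assoc[symmetric] FU VF[THEN matrix_mul_reassoc])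
  define \<psi> where "\<psi> A = G (transpose U ** A ** U, transpose V ** A ** U ** matrix_inv (transpose U ** A ** U))" for A
  have \<psi>\<phi>: "\<psi> (\<phi> c) = c" if "c \<in> W" for c
  proof -
    have "Yc c ** Sc c ** matrix_inv (Sc c) = Yc c"
      using that matrix_inv_spd[of "Sc c"] by (simp add: W_def matrix_mul_assoc[symmetric])
    then show ?thesis by (simp add: \<psi>_def S_eq Y_eq) (simp add: Sc_def Yc_def GL)
  qed
  have \<phi>\<psi>: "\<psi> A \<in> W" "\<phi> (\<psi> A) = A" if A: "A \<in> ?M" "transpose U ** A ** U \<in> spd_matrices" for A
  proof -
    let ?S = "transpose U ** A ** U" and ?Y = "transpose V ** A ** U ** matrix_inv (transpose U ** A ** U)"
    have "?S \<in> sym_matrices" using A(2) by (simp add: spd_matrices_def)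
    then have L\<psi>: "L (\<psi> A) = (?S, ?Y)" unfolding \<psi>_def by (rule LG)
    then show "\<psi> A \<in> W" using A(2) by (simp add: W_def Sc_def)
    have At: "transpose A = A" using A(1) by (simp add: psd_rank_def sym_matrices_def)
    have "F (\<psi> A) = U ** (?S ** matrix_inv ?S) + V ** ?Y"
      by (simp add: F_def Yc_def L\<psi> matrix_inv_spd[OF A(2)])
    also have "\<dots> = (U ** transpose U + V ** transpose V) ** A ** U ** matrix_inv ?S"
      by (simp add: matrix_distribs matrix_mul_assoc)
    finally have F: "F (\<psi> A) = A ** U ** matrix_inv ?S" by (simp add: V(4))
    have "\<phi> (\<psi> A) = A ** U ** matrix_inv ?S ** ?S ** transpose (A ** U ** matrix_inv ?S)"
      by (simp add: \<phi>_def F Sc_def L\<psi>)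
    also have "\<dots> = A ** U ** (matrix_inv ?S ** ?S) ** matrix_inv ?S ** transpose U ** A"
      by (simp add: transpose_simps At matrix_inv_spd(3)[OF A(2), unfolded matrix_mul_assoc[symmetric]] matrix_mul_assoc[symmetric])
    also have "\<dots> = A" using psd_rank_schur[OF A] by (simp add: matrix_inv_spd[OF A(2)])
    finally show "\<phi> (\<psi> A) = A" .
  qed
  have image: "\<phi> ` W = {A \<in> ?M. transpose U ** A ** U \<in> spd_matrices}"
  proof
    show "\<phi> ` W \<subseteq> {A \<in> ?M. transpose U ** A ** U \<in> spd_matrices}"
      using \<phi>M S_eq by (auto simp: W_def)
    show "{A \<in> ?M. transpose U ** A ** U \<in> spd_matrices} \<subseteq> \<phi> ` W"
      using \<phi>\<psi> by (auto intro!: rev_image_eqI)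
  qed
  have op: "openin (top_of_set ?M) (\<phi> ` W)"
    unfolding openin_euclidean_subtopology_iff image
  proof (intro conjI ballI)
    fix A assume A: "A \<in> {A \<in> ?M. transpose U ** A ** U \<in> spd_matrices}"
    then obtain c e where ce: "c > 0" "e > 0" "\<And>A' x. norm (A' - A) < e \<Longrightarrow>
       c * (norm x)\<^sup>2 \<le> x \<bullet> ((transpose U ** A' ** U) *v x)"
      using compression_coercive_nearby[of U A] by auto
    have "transpose U ** A' ** U \<in> spd_matrices" if "A' \<in> ?M" "dist A' A < e" for A'
      unfolding spd_matrices_def
    proof (intro CollectI conjI allI impI)
      show "transpose U ** A' ** U \<in> sym_matrices"
        using that(1) by (simp add: psd_rank_def sym_matrices_def transpose_simps matrix_mul_assoc)
      fix x :: "real^'p" assume "x \<noteq> 0"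
      then have "0 < c * (norm x)\<^sup>2" using ce(1) by simp
      then show "0 < x \<bullet> ((transpose U ** A' ** U) *v x)"
        using ce(3)[of A' x] that(2) by (simp add: dist_norm)
    qed
    then show "\<exists>e>0. \<forall>A'\<in>?M. dist A' A < e \<longrightarrow> A' \<in> {A \<in> ?M. transpose U ** A ** U \<in> spd_matrices}"
      using ce(2) by blast
  qed auto
  have hom: "homeomorphism W (\<phi> ` W) \<phi> \<psi>"
  proof (rule homeomorphismI)
    show "continuous_on W \<phi>" by (rule smooth_on_imp_continuous_on[OF smooth])
    have cS: "continuous_on (\<phi> ` W) (\<lambda>A. transpose U ** A ** U)"
      "continuous_on (\<phi> ` W) (\<lambda>A. transpose V ** A ** U)"
      by (intro continuous_on_matrix_mul continuous_on_const continuous_on_id)+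
    have "continuous_on (\<phi> ` W) (\<lambda>A. matrix_inv (transpose U ** A ** U))"
      by (rule continuous_on_compose2[OF continuous_on_matrix_inv_spd cS(1)]) (auto simp: image)
    then show "continuous_on (\<phi> ` W) \<psi>"
      unfolding \<psi>_def
      by (intro bounded_linear.continuous_on[OF G] continuous_on_Pair continuous_on_matrix_mul cS)
    show "\<psi> (\<phi> c) = c" if "c \<in> W" for c by (rule \<psi>\<phi>[OF that])
  qed (use \<psi>\<phi> in auto)
  have D1: "D1 \<phi> c h = F c ** Sc c ** transpose (V ** Yc h) + (F c ** Sc h + V ** Yc h ** Sc c) ** transpose (F c)" for c h
  proof -
    have dF: "(F has_derivative (\<lambda>h. 0 + V ** Yc h)) (at c)"
      unfolding F_def by (intro has_derivative_add has_derivative_const bounded_linear_imp_has_derivative blVY)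
    have "(\<phi> has_derivative (\<lambda>h. F c ** Sc c ** transpose (0 + V ** Yc h) + (F c ** Sc h + (0 + V ** Yc h) ** Sc c) ** transpose (F c))) (at c)"
      unfolding \<phi>_def
      by (intro has_derivative_matrix_mul dF bounded_linear_imp_has_derivative blS
          bounded_linear.has_derivative[OF bounded_linear_transpose])
    from fun_cong[OF frechet_derivative_at[OF this], of h] show ?thesis by simp
  qed
  have inj: "inj (D1 \<phi> c)" if c: "c \<in> W" for c
    unfolding linear_injective_0[OF linear_D1[OF smooth c]]
  proof (intro allI impI)
    fix h assume 0: "D1 \<phi> c h = 0"
    have "transpose U ** D1 \<phi> c h ** U = Sc h"
      unfolding D1 by (simp add: matrix_distribs transpose_simps red FU UF UF[THEN matrix_mul_reassoc])
    then have Sh: "Sc h = 0" using 0 by simp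
    have "transpose V ** D1 \<phi> c h ** U = Yc h ** Sc c"
      unfolding D1 Sh by (simp add: matrix_distribs transpose_simps red FU VF VF[THEN matrix_mul_reassoc])
    then have "Yc h ** Sc c ** matrix_inv (Sc c) = 0" using 0 by simp
    then have "Yc h = 0"
      using c matrix_inv_spd[of "Sc c"] by (simp add: W_def matrix_mul_assoc[symmetric])
    with Sh have "L h = 0" by (simp add: Sc_def Yc_def prod_eq_iff)
    then show "h = 0" using GL[of h] linear_0[OF bounded_linear.linear[OF G]] by simp
  qed
  have lp: "local_parametrization ?M W \<phi>"
    unfolding local_parametrization_def using W smooth inj \<phi>M op hom by blast
  define y where "y = \<psi> A0"
  have S0': "transpose U ** A0 ** U = S0" by (simp add: A0_eq red)
  have y: "y \<in> W" "\<phi> y = A0" using \<phi>\<psi>[OF A0] S0 S0' by (simp_all add: y_def)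
  have Ly: "L y = (S0, 0)"
  proof -
    have "transpose V ** A0 ** U = 0" by (simp add: A0_eq red)
    then show ?thesis
      using LG[of S0 0] S0 by (simp add: y_def \<psi>_def S0' spd_matrices_def)
  qed
  have "\<exists>u. D1 \<phi> y u = b" if b: "tangent A0 b" for b
  proof -
    have bt: "transpose b = b" and b0: "V ** (transpose V ** (b ** (V ** transpose V))) = 0"
    proof -
      show "transpose b = b" using b by (simp add: tangent_def)
      have "coproj A0 = V ** transpose V"
        using coproj_stiefel_conj[OF U S0] V(4)[symmetric] by (simp add: A0_eq)
      then show "V ** (transpose V ** (b ** (V ** transpose V))) = 0"
        using b by (simp add: tangent_def matrix_mul_assoc)
    qed
    let ?u = "G (transpose U ** b ** U, transpose V ** b ** U ** matrix_inv S0)"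
    have "transpose U ** b ** U \<in> sym_matrices"
      by (simp add: sym_matrices_def transpose_simps bt matrix_mul_assoc)
    then have Lu: "L ?u = (transpose U ** b ** U, transpose V ** b ** U ** matrix_inv S0)" by (rule LG)
    have "D1 \<phi> y ?u = U ** transpose U ** b ** V ** transpose V + U ** transpose U ** b ** U ** transpose U
        + V ** transpose V ** b ** U ** transpose U"
      unfolding D1 F_def Sc_def Yc_def Ly Lu
      by (simp add: transpose_simps bt matrix_inv_spd[OF S0] matrix_distribs matrix_mul_assoc[symmetric]
          matrix_inv_spd(1)[OF S0, THEN matrix_mul_reassoc] matrix_inv_spd(2)[OF S0, THEN matrix_mul_reassoc])
    also have "\<dots> = (U ** transpose U + V ** transpose V) ** b ** (U ** transpose U + V ** transpose V)"
      by (simp add: matrix_distribs matrix_mul_assoc[symmetric] b0)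
    finally show ?thesis by (auto simp: V(4))
  qed
  with lp y show ?thesis by blast
qed

section \<open>The geodesic flow\<close>

lemma constant_on_interval:
  fixes f :: "real \<Rightarrow> 'a::real_normed_vector"
  assumes "is_interval I" "\<And>s. s \<in> I \<Longrightarrow> (f has_vector_derivative 0) (at s)" "s \<in> I" "t \<in> I"
  shows "f s = f t"
proof -
  have "convex I" using assms(1) by (simp add: is_interval_convex_1)
  moreover have "\<And>x. x \<in> I \<Longrightarrow> (f has_vector_derivative 0) (at x within I)"
    by (rule has_vector_derivative_at_within[OF assms(2)])
  ultimately obtain c where "\<And>x. x \<in> I \<Longrightarrow> f x = c"
    using has_vector_derivative_zero_constant[of I f] by metis
  then show ?thesis using assms(3,4) by simp
qed

text \<open>\<open>exp (-t C) M exp (t A)\<close> is constant in \<open>t\<close>.\<close>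

lemma matrix_exp_intertwine:
  fixes M A C :: "real^'n^'n"
  assumes "M ** A = C ** M"
  shows "M ** matrix_exp (t *\<^sub>R A) = matrix_exp (t *\<^sub>R C) ** M"
proof -
  let ?f = "\<lambda>t. matrix_exp (t *\<^sub>R - C) ** (M ** matrix_exp (t *\<^sub>R A))"
  have comm: "- C ** matrix_exp (s *\<^sub>R - C) = matrix_exp (s *\<^sub>R - C) ** - C" for s
    using matrix_exp_commute[of "s *\<^sub>R - C"]
    by (cases "s = 0") (auto simp: matrix_mul_scaleR_left matrix_mul_scaleR_right simp del: scaleR_minus_right)
  have "(?f has_vector_derivative 0) (at s)" for s
  proof (rule has_vector_derivative_eq_rhs)
    have d: "((\<lambda>t. M ** matrix_exp (t *\<^sub>R A)) has_vector_derivative M ** (A ** matrix_exp (s *\<^sub>R A))) (at s)"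
      by (rule bounded_linear.has_vector_derivative[OF
            bounded_bilinear.bounded_linear_right[OF bounded_bilinear_matrix_mul] matrix_exp_has_vector_derivative])
    show "(?f has_vector_derivative matrix_exp (s *\<^sub>R - C) ** (M ** (A ** matrix_exp (s *\<^sub>R A)))
        + (- C ** matrix_exp (s *\<^sub>R - C)) ** (M ** matrix_exp (s *\<^sub>R A))) (at s)"
      by (rule has_vector_derivative_matrix_mul[OF matrix_exp_has_vector_derivative d])
    have "M ** (A ** Z) = C ** (M ** Z)" for Z using assms by (metis matrix_mul_assoc)
    note MA = this[of "matrix_exp (s *\<^sub>R A)"]
    show "matrix_exp (s *\<^sub>R - C) ** (M ** (A ** matrix_exp (s *\<^sub>R A)))
        + (- C ** matrix_exp (s *\<^sub>R - C)) ** (M ** matrix_exp (s *\<^sub>R A)) = 0"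
      unfolding comm MA by (simp add: matrix_mul_assoc[symmetric] matrix_mul_lminus matrix_mul_rminus)
  qed
  then have "?f t = ?f 0" by (intro constant_on_interval[of UNIV]) auto
  then have f: "matrix_exp (t *\<^sub>R - C) ** (M ** matrix_exp (t *\<^sub>R A)) = M" by simp
  have inv: "matrix_exp (t *\<^sub>R C) ** matrix_exp (t *\<^sub>R - C) = mat 1"
    using matrix_exp_inverse[of t C] by simp
  have "M ** matrix_exp (t *\<^sub>R A)
      = matrix_exp (t *\<^sub>R C) ** matrix_exp (t *\<^sub>R - C) ** (M ** matrix_exp (t *\<^sub>R A))"
    by (simp only: inv matrix_mul_lid)
  also have "\<dots> = matrix_exp (t *\<^sub>R C) ** (matrix_exp (t *\<^sub>R - C) ** (M ** matrix_exp (t *\<^sub>R A)))"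
    by (rule matrix_mul_assoc[symmetric])
  also have "\<dots> = matrix_exp (t *\<^sub>R C) ** M" by (simp only: f)
  finally show ?thesis .
qed

lemma matrix_exp_skew:
  assumes "transpose K = - K"
  shows "matrix_exp (t *\<^sub>R K) ** transpose (matrix_exp (t *\<^sub>R K)) = mat 1"
    "transpose (matrix_exp (t *\<^sub>R K)) ** matrix_exp (t *\<^sub>R K) = mat 1"
proof -
  have "transpose (matrix_exp (t *\<^sub>R K)) = matrix_exp (- t *\<^sub>R K)"
    by (simp only: matrix_exp_transpose transpose_scalar assms scaleR_minus_left scaleR_minus_right)
  then show 1: "matrix_exp (t *\<^sub>R K) ** transpose (matrix_exp (t *\<^sub>R K)) = mat 1"
    using matrix_exp_inverse[of t K] by simp
  then show "transpose (matrix_exp (t *\<^sub>R K)) ** matrix_exp (t *\<^sub>R K) = mat 1"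
    by (rule matrix_left_right_inverse[THEN iffD1])
qed

lemma matrix_exp_shift_derivative:
  "((\<lambda>s. matrix_exp ((s - c) *\<^sub>R A)) has_vector_derivative A ** matrix_exp ((s - c) *\<^sub>R A)) (at s)"
proof -
  have "((\<lambda>s. s - c) has_vector_derivative 1) (at s)" by (auto intro!: derivative_eq_intros)
  from vector_diff_chain_at[OF this matrix_exp_has_vector_derivative[of A "s - c"]]
  show ?thesis by (simp add: o_def)
qed

lemma smooth_on_matrix_exp_shift: "smooth_on UNIV (\<lambda>s. matrix_exp ((s - c) *\<^sub>R A))"
  by (rule smooth_on_linear_ode[OF bounded_bilinear.bounded_linear_right[OF bounded_bilinear_matrix_mul]])
     (rule matrix_exp_shift_derivative)

text \<open>Along a geodesic with blocks \<open>X\<close>, \<open>W\<close> the skew matrix \<open>K = X - X\<^sup>T - L\<close> with \<open>L = 2 k (W\<^sup>T - W)\<close> is conserved.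
  Up to a factor it is the momentum of the action of the orthogonal group by conjugation. In the frame that rotates
  with \<open>exp (t K)\<close> the matrix \<open>L\<close> is constant as well, so the frame that follows the geodesic is
  \<open>Q = exp (t K) exp (t L0)\<close>, and in this frame the curve is the geodesic \<open>A0 exp (t W0)\<close> of the cone of
  positive definite matrices on the range of \<open>A0\<close>. Here \<open>t\<close> is the time elapsed since \<open>t0\<close>.\<close>

locale psd_flow =
  fixes k t0 :: real and A0 a0 :: "real^'n^'n" and range_dim :: "'p::finite itself"
  assumes A0: "A0 \<in> psd_rank CARD('p)" and a0: "tangent A0 a0"
begin

abbreviation "B0 \<equiv> pinv A0"
abbreviation "X0 \<equiv> turn A0 a0"
abbreviation "W0 \<equiv> stretch A0 a0"

sublocale tangent_blocks A0 B0 a0 X0 W0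
  by (rule tangent_blocks_psd[OF A0 a0])

definition "P0 = A0 ** B0"
definition "L0 = (2 * k) *\<^sub>R (transpose W0 - W0)"
definition "K = X0 - transpose X0 - L0"
definition "E s = matrix_exp ((s - t0) *\<^sub>R K)"
definition "Q s = E s ** matrix_exp ((s - t0) *\<^sub>R L0)"
definition "flow s = Q s ** (A0 ** matrix_exp ((s - t0) *\<^sub>R W0)) ** transpose (Q s)"
definition "X s = E s ** X0 ** transpose (E s)"
definition "W s = Q s ** W0 ** transpose (Q s)"
definition "\<Omega> s = X s - transpose (X s)"

lemma L0_skew: "transpose L0 = - L0"
  by (simp add: L0_def transpose_simps flip: scaleR_minus_right)

lemma K_skew: "transpose K = - K"
  by (simp add: K_def transpose_simps L0_skew)

lemma E_orth: "E s ** transpose (E s) = mat 1" "transpose (E s) ** E s = mat 1"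
  unfolding E_def by (rule matrix_exp_skew[OF K_skew])+

lemma Q_orth: "Q s ** transpose (Q s) = mat 1" "transpose (Q s) ** Q s = mat 1"
  unfolding Q_def using E_orth[of s] matrix_exp_skew[OF L0_skew, of "s - t0"]
  by (simp_all add: transpose_simps matrix_mul_assoc[symmetric] matrix_mul_reassoc)

lemma initial: "E t0 = mat 1" "Q t0 = mat 1" "flow t0 = A0" "X t0 = X0" "W t0 = W0"
  by (simp_all add: E_def Q_def flow_def X_def W_def)

lemma L0_blocks: "L0 ** X0 = 0" "transpose X0 ** L0 = 0" "P0 ** L0 = L0" "L0 ** P0 = L0"
  using W_block Wt_block
  by (simp_all add: L0_def P0_def matrix_distribs XX matrix_mul_assoc[symmetric])

lemma P0_blocks: "P0 ** X0 = 0" "X0 ** P0 = X0" "P0 ** W0 = W0" "W0 ** P0 = W0" "P0 ** A0 = A0" "A0 ** P0 = A0"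
  "P0 ** B0 = B0" "B0 ** P0 = B0" "transpose P0 = P0" "P0 ** P0 = P0"
  by (simp_all add: P0_def X_block W_block transpose_simps At Bt AB_simps)

lemma E_derivative: "(E has_vector_derivative K ** E s) (at s)"
  unfolding E_def[abs_def] by (rule matrix_exp_shift_derivative)

lemma KE: "K ** E s = E s ** K"
  unfolding E_def by (rule matrix_exp_intertwine) simp

lemma K_conj: "K = E s ** K ** transpose (E s)"
  by (simp add: KE[symmetric] matrix_mul_assoc[symmetric] E_orth)

definition "L s = E s ** L0 ** transpose (E s)"

lemma L_eq: "L s = (2 * k) *\<^sub>R (transpose (W s) - W s)"
proof -
  let ?e = "matrix_exp ((s - t0) *\<^sub>R L0)"
  have "L0 ** ?e = ?e ** L0" by (rule matrix_exp_intertwine) simp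
  then have "Q s ** L0 ** transpose (Q s) = E s ** (L0 ** ?e) ** transpose ?e ** transpose (E s)"
    by (simp add: Q_def transpose_simps matrix_mul_assoc[symmetric])
  also have "\<dots> = E s ** L0 ** (?e ** transpose ?e) ** transpose (E s)"
    by (simp only: matrix_mul_assoc)
  also have "\<dots> = L s" by (simp add: matrix_exp_skew[OF L0_skew] L_def)
  finally show ?thesis
    by (simp add: W_def L0_def transpose_simps matrix_distribs matrix_mul_assoc)
qed

lemma K_Omega: "K = \<Omega> s - L s"
  by (subst K_conj[of s])
     (simp add: K_def \<Omega>_def X_def L_def transpose_simps matrix_distribs matrix_mul_assoc)

lemma Q_derivative: "(Q has_vector_derivative \<Omega> s ** Q s) (at s)"
proof -
  let ?e = "\<lambda>s. matrix_exp ((s - t0) *\<^sub>R L0)"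
  have "(Q has_vector_derivative E s ** (L0 ** ?e s) + (K ** E s) ** ?e s) (at s)"
    unfolding Q_def[abs_def] by (rule has_vector_derivative_matrix_mul[OF E_derivative matrix_exp_shift_derivative])
  moreover have "E s ** (L0 ** ?e s) = L s ** Q s"
    by (simp add: L_def Q_def matrix_mul_assoc[symmetric] matrix_mul_reassoc[OF E_orth(2)])
  moreover have "(K ** E s) ** ?e s = K ** Q s" by (simp add: Q_def matrix_mul_assoc)
  ultimately have "(Q has_vector_derivative L s ** Q s + K ** Q s) (at s)" by simp
  then show ?thesis by (simp add: K_Omega[of s] matrix_mul_sub_rdistrib)
qed

lemma Qt_derivative: "((\<lambda>s. transpose (Q s)) has_vector_derivative - (transpose (Q s) ** \<Omega> s)) (at s)"
  using has_vector_derivative_transpose[OF Q_derivative[of s]]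
  by (simp add: transpose_simps \<Omega>_def matrix_distribs)

lemma flow_derivative: "(flow has_vector_derivative \<Omega> s ** flow s - flow s ** \<Omega> s + flow s ** W s) (at s)"
proof -
  let ?w = "\<lambda>s. matrix_exp ((s - t0) *\<^sub>R W0)"
  have "W0 ** ?w s = ?w s ** W0" by (rule matrix_exp_intertwine) simp
  then have "flow s ** W s = Q s ** (A0 ** (W0 ** ?w s)) ** transpose (Q s)"
    by (simp add: flow_def W_def matrix_mul_assoc[symmetric] matrix_mul_reassoc[OF Q_orth(2)])
  moreover have "((\<lambda>s. A0 ** ?w s) has_vector_derivative A0 ** (W0 ** ?w s)) (at s)"
    by (rule bounded_linear.has_vector_derivative[OF
          bounded_bilinear.bounded_linear_right[OF bounded_bilinear_matrix_mul] matrix_exp_shift_derivative])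
  ultimately show ?thesis
    unfolding flow_def[abs_def]
    by (intro has_vector_derivative_eq_rhs[OF has_vector_derivative_matrix_mul[OF
          has_vector_derivative_matrix_mul[OF Q_derivative] Qt_derivative]])
      (auto simp: matrix_distribs matrix_mul_assoc)
qed

text \<open>Since \<open>A0 W0 = W0\<^sup>T A0\<close>, half of the exponential can be moved to the left of \<open>A0\<close>, which exhibits the flow
  as a congruence of \<open>A0\<close>.\<close>

lemma flow_in_psd_rank: "flow s \<in> psd_rank CARD('p)"
proof -
  obtain U :: "real^'p^'n" and S where US: "U \<in> stiefel" "S \<in> spd_matrices" "A0 = U ** S ** transpose U"
    using psd_rank_factorization[OF A0] by blast
  let ?h = "(s - t0) / 2"
  have "A0 ** matrix_exp ((s - t0) *\<^sub>R W0) = A0 ** matrix_exp (?h *\<^sub>R W0) ** matrix_exp (?h *\<^sub>R W0)"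
    using matrix_exp_add[of ?h ?h W0] by (simp add: matrix_mul_assoc)
  also have "A0 ** matrix_exp (?h *\<^sub>R W0) = matrix_exp (?h *\<^sub>R transpose W0) ** A0"
    by (rule matrix_exp_intertwine[OF W_selfadjoint(1)])
  finally have eq: "A0 ** matrix_exp ((s - t0) *\<^sub>R W0) = matrix_exp (?h *\<^sub>R transpose W0) ** A0 ** matrix_exp (?h *\<^sub>R W0)" .
  let ?G = "matrix_exp (?h *\<^sub>R transpose W0)" and ?G' = "matrix_exp (- (?h *\<^sub>R transpose W0))"
  have G: "?G' ** ?G = mat 1" using matrix_exp_inverse[of "- ?h" "transpose W0"] by simp
  have Gt: "transpose ?G = matrix_exp (?h *\<^sub>R W0)" by (simp add: matrix_exp_transpose transpose_scalar)
  have "(transpose U ** ?G' ** transpose (Q s)) ** (Q s ** ?G ** U) = mat 1"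
    by (simp add: matrix_mul_assoc[symmetric] matrix_mul_reassoc[OF Q_orth(2)] matrix_mul_reassoc[OF G] stiefelD[OF US(1)])
  note mem = conj_in_psd_rank[OF this US(2)]
  have "Q s ** ?G ** U ** S ** transpose (Q s ** ?G ** U)
      = Q s ** (?G ** (U ** S ** transpose U) ** transpose ?G) ** transpose (Q s)"
    by (simp only: transpose_simps matrix_mul_assoc)
  also have "\<dots> = flow s" by (simp only: US(3)[symmetric] Gt flow_def eq)
  finally show ?thesis using mem by simp
qed

lemma EP0: "Q s ** P0 ** transpose (Q s) = E s ** P0 ** transpose (E s)"
proof -
  let ?e = "matrix_exp ((s - t0) *\<^sub>R L0)"
  have "P0 ** ?e = ?e ** P0" by (rule matrix_exp_intertwine) (simp add: L0_blocks)
  then have "Q s ** P0 ** transpose (Q s) = E s ** (P0 ** ?e) ** transpose ?e ** transpose (E s)"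
    by (simp add: Q_def transpose_simps matrix_mul_assoc[symmetric])
  also have "\<dots> = E s ** P0 ** (?e ** transpose ?e) ** transpose (E s)"
    by (simp only: matrix_mul_assoc)
  finally show ?thesis by (simp add: matrix_exp_skew[OF L0_skew])
qed

lemma flow_proj: "flow s ** pinv (flow s) = Q s ** P0 ** transpose (Q s)"
proof -
  let ?w = "matrix_exp ((s - t0) *\<^sub>R W0)" and ?v = "matrix_exp ((t0 - s) *\<^sub>R W0)"
  let ?C = "Q s ** (?v ** B0) ** transpose (Q s)"
  have wv: "?w ** ?v = mat 1" "?v ** ?w = mat 1"
    using matrix_exp_inverse[of "s - t0" W0] matrix_exp_inverse[of "t0 - s" W0] by simp_all
  have Pw: "P0 ** ?w = ?w ** P0" "P0 ** ?v = ?v ** P0"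
    by (rule matrix_exp_intertwine, simp add: P0_blocks)+
  have BA: "B0 ** A0 = P0" "A0 ** B0 = P0" by (simp_all add: P0_def AB)
  note simps = flow_def matrix_mul_assoc[symmetric] matrix_mul_reassoc[OF Q_orth(2)]
    matrix_mul_reassoc[OF wv(1)] matrix_mul_reassoc[OF wv(2)] matrix_mul_reassoc[OF BA(1)] matrix_mul_reassoc[OF BA(2)]
    matrix_mul_reassoc[OF Pw(1)] matrix_mul_reassoc[OF Pw(2)]
    P0_blocks(5-8)[THEN matrix_mul_reassoc]
  have 1: "flow s ** ?C = Q s ** P0 ** transpose (Q s)" by (simp add: simps)
  have 2: "?C ** flow s = Q s ** P0 ** transpose (Q s)" by (simp add: simps)
  have "pinv (flow s) = ?C"
  proof (rule pinv_eqI)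
    show "flow s ** ?C ** flow s = flow s" unfolding 1 by (simp add: simps)
    show "?C ** flow s ** ?C = ?C" unfolding 2 by (simp add: simps)
    show "flow s ** ?C = ?C ** flow s" unfolding 1 2 ..
  qed
  then show "flow s ** pinv (flow s) = Q s ** P0 ** transpose (Q s)" using 1 by simp
qed

lemma flow_blocks: "flow s ** pinv (flow s) ** X s = 0" "X s ** (flow s ** pinv (flow s)) = X s"
    "flow s ** pinv (flow s) ** W s = W s" "W s ** (flow s ** pinv (flow s)) = W s"
proof -
  show "flow s ** pinv (flow s) ** X s = 0" "X s ** (flow s ** pinv (flow s)) = X s"
    unfolding flow_proj EP0 X_def
    by (simp_all add: matrix_mul_assoc[symmetric] matrix_mul_reassoc[OF E_orth(2)] P0_blocks(1,2)[THEN matrix_mul_reassoc])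
  show "flow s ** pinv (flow s) ** W s = W s" "W s ** (flow s ** pinv (flow s)) = W s"
    unfolding flow_proj W_def
    by (simp_all add: matrix_mul_assoc[symmetric] matrix_mul_reassoc[OF Q_orth(2)] P0_blocks(3,4)[THEN matrix_mul_reassoc])
qed

lemma flow_zero_products: "flow s ** X s = 0" "pinv (flow s) ** X s = 0" "X s ** X s = 0" "W s ** X s = 0"
  "transpose (X s) ** flow s = 0" "transpose (X s) ** (flow s ** pinv (flow s)) = 0" "transpose (X s) ** W s = 0"
proof -
  note p = pinv_psd_rank[OF flow_in_psd_rank[of s]]
  let ?P = "flow s ** pinv (flow s)"
  have Pt: "transpose ?P = ?P" by (simp add: transpose_simps p)
  have *: "M ** X s = 0" if "M ** ?P = M" for M
    using that flow_blocks(1) by (metis matrix_mul_assoc matrix_mul_rzero)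
  have "flow s ** ?P = flow s" "pinv (flow s) ** ?P = pinv (flow s)"
    using p(1-3) by (metis matrix_mul_assoc)+
  then show "flow s ** X s = 0" "pinv (flow s) ** X s = 0" "X s ** X s = 0" "W s ** X s = 0"
    using flow_blocks by (auto intro: *)
  show XP: "transpose (X s) ** ?P = 0"
    using arg_cong[OF flow_blocks(1)[of s], of transpose]
    by (simp only: matrix_transpose_mul[of "flow s ** pinv (flow s)" "X s"] Pt transpose_zero)
  have *: "transpose (X s) ** M = 0" if "?P ** M = M" for M
    using that XP by (metis matrix_mul_assoc matrix_mul_lzero)
  show "transpose (X s) ** flow s = 0" "transpose (X s) ** W s = 0"
    using p(1) flow_blocks(3) by (auto intro: *)
qed

definition "velocity s = X s ** flow s + flow s ** transpose (X s) + flow s ** W s"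

lemma flow_velocity: "(flow has_vector_derivative velocity s) (at s)"
  using flow_derivative[of s]
  by (simp add: velocity_def \<Omega>_def matrix_distribs flow_zero_products)

lemma turn_flow: "turn (flow s) (velocity s) = X s" and stretch_flow: "stretch (flow s) (velocity s) = W s"
proof -
  note p = pinv_psd_rank[OF flow_in_psd_rank[of s]]
  have c: "coproj (flow s) ** flow s = 0" "coproj (flow s) ** X s = X s"
    using p(1) flow_blocks(1) by (simp_all add: coproj_def matrix_mul_sub_rdistrib)
  show "turn (flow s) (velocity s) = X s"
    unfolding turn_def velocity_def
    by (simp add: matrix_distribs matrix_mul_assoc[symmetric] c[THEN matrix_mul_reassoc] flow_blocks)
  have XtP: "transpose (X s) ** (flow s ** pinv (flow s)) = 0" by (rule flow_zero_products)
  have "stretch (flow s) (velocity s) = flow s ** pinv (flow s) ** W s ** (flow s ** pinv (flow s))"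
    unfolding stretch_def velocity_def
    by (simp add: matrix_distribs p(3) matrix_mul_assoc[symmetric] flow_zero_products[THEN matrix_mul_reassoc] XtP[unfolded p(3)])
  then show "stretch (flow s) (velocity s) = W s"
    by (simp add: flow_blocks matrix_mul_assoc[symmetric]) (simp add: flow_blocks matrix_mul_assoc)
qed

lemma X_derivative:
  "(X has_vector_derivative X s ** transpose (X s) - transpose (X s) ** X s + X s ** ((2 * k) *\<^sub>R (transpose (W s) - W s))) (at s)"
proof -
  have Et: "((\<lambda>s. transpose (E s)) has_vector_derivative - (transpose (E s) ** K)) (at s)"
    using has_vector_derivative_transpose[OF E_derivative[of s]] by (simp add: transpose_simps K_skew matrix_distribs)
  have EX: "((\<lambda>s. E s ** X0) has_vector_derivative (K ** E s) ** X0) (at s)"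
    by (rule bounded_linear.has_vector_derivative[OF
          bounded_bilinear.bounded_linear_left[OF bounded_bilinear_matrix_mul] E_derivative])
  have "(X has_vector_derivative E s ** X0 ** - (transpose (E s) ** K) + (K ** E s) ** X0 ** transpose (E s)) (at s)"
    unfolding X_def[abs_def] by (rule has_vector_derivative_matrix_mul[OF EX Et])
  also have "E s ** X0 ** - (transpose (E s) ** K) + (K ** E s) ** X0 ** transpose (E s) = K ** X s - X s ** K"
    by (simp add: X_def matrix_distribs matrix_mul_assoc)
  also have "\<dots> = X s ** transpose (X s) - transpose (X s) ** X s + X s ** L s"
  proof -
    have "L s ** X s = 0"
      by (simp add: L_def X_def matrix_mul_assoc[symmetric] matrix_mul_reassoc[OF E_orth(2)] L0_blocks(1)[THEN matrix_mul_reassoc])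
    then show ?thesis
      by (simp add: K_Omega[of s] \<Omega>_def matrix_distribs flow_zero_products)
  qed
  finally show ?thesis by (simp only: L_eq)
qed

lemma W_derivative: "(W has_vector_derivative X s ** W s + W s ** transpose (X s)) (at s)"
proof -
  have QW: "((\<lambda>s. Q s ** W0) has_vector_derivative (\<Omega> s ** Q s) ** W0) (at s)"
    by (rule bounded_linear.has_vector_derivative[OF
          bounded_bilinear.bounded_linear_left[OF bounded_bilinear_matrix_mul] Q_derivative])
  have "(W has_vector_derivative Q s ** W0 ** - (transpose (Q s) ** \<Omega> s) + (\<Omega> s ** Q s) ** W0 ** transpose (Q s)) (at s)"
    unfolding W_def[abs_def] by (rule has_vector_derivative_matrix_mul[OF QW Qt_derivative])
  also have "Q s ** W0 ** - (transpose (Q s) ** \<Omega> s) + (\<Omega> s ** Q s) ** W0 ** transpose (Q s) = \<Omega> s ** W s - W s ** \<Omega> s"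
    by (simp add: W_def matrix_distribs matrix_mul_assoc)
  also have "\<dots> = X s ** W s + W s ** transpose (X s)"
    by (simp add: \<Omega>_def matrix_distribs flow_zero_products)
  finally show ?thesis .
qed

lemma smooth_flow: "smooth_on UNIV flow"
proof -
  have "smooth_on UNIV Q"
    unfolding Q_def[abs_def] E_def by (intro smooth_on_matrix_mul smooth_on_matrix_exp_shift open_UNIV)
  then show ?thesis
    unfolding flow_def[abs_def]
    by (intro smooth_on_matrix_mul smooth_on_transpose smooth_on_const smooth_on_matrix_exp_shift open_UNIV)
qed

lemma acceleration: "\<exists>c. (velocity has_vector_derivative c) (at s)"
  unfolding velocity_def[abs_def]
  by (rule exI, rule has_vector_derivative_add[OF has_vector_derivative_add[OF
          has_vector_derivative_matrix_mul[OF X_derivative flow_velocity]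
          has_vector_derivative_matrix_mul[OF flow_velocity has_vector_derivative_transpose[OF X_derivative]]]
          has_vector_derivative_matrix_mul[OF flow_velocity W_derivative]])

text \<open>A solution of the geodesic system through the initial data is the flow: undoing the rotation \<open>Q\<close>
  leaves quantities with zero derivative.\<close>

lemma flow_unique:
  assumes path: "psd_path TYPE('p) I \<gamma> \<gamma>1 \<gamma>2" and I: "is_interval I" "t0 \<in> I"
    and init: "\<gamma> t0 = A0" "\<gamma>1 t0 = a0"
    and dx: "\<And>s. s \<in> I \<Longrightarrow> ((\<lambda>s. turn (\<gamma> s) (\<gamma>1 s)) has_vector_derivative
       turn (\<gamma> s) (\<gamma>1 s) ** transpose (turn (\<gamma> s) (\<gamma>1 s)) - transpose (turn (\<gamma> s) (\<gamma>1 s)) ** turn (\<gamma> s) (\<gamma>1 s)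
        + turn (\<gamma> s) (\<gamma>1 s) ** ((2 * k) *\<^sub>R (transpose (stretch (\<gamma> s) (\<gamma>1 s)) - stretch (\<gamma> s) (\<gamma>1 s)))) (at s)"
    and dw: "\<And>s. s \<in> I \<Longrightarrow> ((\<lambda>s. stretch (\<gamma> s) (\<gamma>1 s)) has_vector_derivative
       turn (\<gamma> s) (\<gamma>1 s) ** stretch (\<gamma> s) (\<gamma>1 s) + stretch (\<gamma> s) (\<gamma>1 s) ** transpose (turn (\<gamma> s) (\<gamma>1 s))) (at s)"
    and s: "s \<in> I"
  shows "\<gamma> s = flow s"
proof -
  define x where "x s = turn (\<gamma> s) (\<gamma>1 s)" for s
  define w where "w s = stretch (\<gamma> s) (\<gamma>1 s)" for s
  define l where "l s = (2 * k) *\<^sub>R (transpose (w s) - w s)" for s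
  have dx: "(x has_vector_derivative x s ** transpose (x s) - transpose (x s) ** x s + x s ** l s) (at s)" if "s \<in> I" for s
    using dx[OF that] by (simp add: x_def[abs_def] w_def l_def)
  have dw: "(w has_vector_derivative x s ** w s + w s ** transpose (x s)) (at s)" if "s \<in> I" for s
    using dw[OF that] by (simp add: w_def[abs_def] x_def)
  have blk: "tangent_blocks (\<gamma> s) (pinv (\<gamma> s)) (\<gamma>1 s) (x s) (w s)" if "s \<in> I" for s
    using psd_path.blocks[OF path that] by (simp add: x_def w_def)
  have init': "x t0 = X0" "w t0 = W0" "l t0 = L0"
    by (simp_all add: x_def w_def l_def L0_def init)
  have lt: "transpose (l s) = - l s" for s by (simp add: l_def transpose_simps flip: scaleR_minus_right)
  have lx: "l s ** x s = 0" "transpose (x s) ** l s = 0" if "s \<in> I" for s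
    using tangent_blocks.XX[OF blk[OF that]] by (simp_all add: l_def matrix_distribs)
  have dl: "(l has_vector_derivative x s ** l s + l s ** transpose (x s)) (at s)" if "s \<in> I" for s
    unfolding l_def[abs_def]
    by (rule has_vector_derivative_eq_rhs[OF bounded_linear.has_vector_derivative[OF bounded_linear_scaleR_right
          has_vector_derivative_diff[OF has_vector_derivative_transpose[OF dw[OF that]] dw[OF that]]]])
      (simp add: transpose_simps matrix_distribs algebra_simps)
  have const: "f s = f t0" if "\<And>s. s \<in> I \<Longrightarrow> (f has_vector_derivative 0) (at s)" "s \<in> I" for f :: "real \<Rightarrow> real^'n^'n" and s
    by (rule constant_on_interval[OF I(1) that(1) that(2) I(2)])
  have K: "x s - transpose (x s) - l s = K" if "s \<in> I" for s
  proof -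
    have "((\<lambda>s. x s - transpose (x s) - l s) has_vector_derivative 0) (at s)" if "s \<in> I" for s
      by (rule has_vector_derivative_eq_rhs[OF has_vector_derivative_diff[OF has_vector_derivative_diff[OF
            dx[OF that] has_vector_derivative_transpose[OF dx[OF that]]] dl[OF that]]])
        (simp add: transpose_simps lt matrix_distribs)
    from const[OF this that] show ?thesis by (simp add: init' K_def)
  qed
  have Et: "((\<lambda>s. transpose (E s)) has_vector_derivative - (transpose (E s) ** K)) (at s)" for s
    using has_vector_derivative_transpose[OF E_derivative[of s]] by (simp add: transpose_simps K_skew matrix_distribs)
  have l: "l s = L s" if "s \<in> I" for s
  proof -
    have "((\<lambda>s. transpose (E s) ** l s ** E s) has_vector_derivative 0) (at s)" if "s \<in> I" for s
    proof (rule has_vector_derivative_eq_rhs[OF has_vector_derivative_matrix_mul[OF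
            has_vector_derivative_matrix_mul[OF Et dl[OF that]] E_derivative]])
      have "transpose (E s) ** l s ** (K ** E s) + (transpose (E s) ** (x s ** l s + l s ** transpose (x s))
           + - (transpose (E s) ** K) ** l s) ** E s
         = transpose (E s) ** (l s ** K + x s ** l s + l s ** transpose (x s) - K ** l s) ** E s"
        by (simp add: matrix_distribs matrix_mul_assoc)
      also have "l s ** K + x s ** l s + l s ** transpose (x s) - K ** l s = 0"
        by (simp add: K[OF that, symmetric] matrix_distribs lx[OF that])
      finally show "transpose (E s) ** l s ** (K ** E s) + (transpose (E s) ** (x s ** l s + l s ** transpose (x s))
           + - (transpose (E s) ** K) ** l s) ** E s = 0" by simp
    qed
    from const[OF this that] have "transpose (E s) ** l s ** E s = L0" by (simp add: init' initial)
    then have "L s = E s ** (transpose (E s) ** l s ** E s) ** transpose (E s)" by (simp add: L_def)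
    also have "\<dots> = l s"
      by (simp add: matrix_mul_assoc E_orth) (simp add: matrix_mul_assoc[symmetric] E_orth)
    finally show ?thesis by simp
  qed
  have om: "\<Omega> s = x s - transpose (x s)" if "s \<in> I" for s
    using K_Omega[of s] K[OF that] l[OF that] by (simp add: algebra_simps)
  have w: "Q s ** W0 = w s ** Q s" if "s \<in> I" for s
  proof -
    have "((\<lambda>s. transpose (Q s) ** w s ** Q s) has_vector_derivative 0) (at s)" if "s \<in> I" for s
    proof (rule has_vector_derivative_eq_rhs[OF has_vector_derivative_matrix_mul[OF
            has_vector_derivative_matrix_mul[OF Qt_derivative dw[OF that]] Q_derivative]])
      have "transpose (Q s) ** w s ** (\<Omega> s ** Q s) + (transpose (Q s) ** (x s ** w s + w s ** transpose (x s))
           + - (transpose (Q s) ** \<Omega> s) ** w s) ** Q s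
         = transpose (Q s) ** (w s ** \<Omega> s + x s ** w s + w s ** transpose (x s) - \<Omega> s ** w s) ** Q s"
        by (simp add: matrix_distribs matrix_mul_assoc)
      also have "w s ** \<Omega> s + x s ** w s + w s ** transpose (x s) - \<Omega> s ** w s = 0"
        using tangent_blocks.XX[OF blk[OF that]] by (simp add: om[OF that] matrix_distribs)
      finally show "transpose (Q s) ** w s ** (\<Omega> s ** Q s) + (transpose (Q s) ** (x s ** w s + w s ** transpose (x s))
           + - (transpose (Q s) ** \<Omega> s) ** w s) ** Q s = 0" by simp
    qed
    from const[OF this that] have "transpose (Q s) ** w s ** Q s = W0" by (simp add: init' initial)
    then have "Q s ** W0 = Q s ** (transpose (Q s) ** w s ** Q s)" by simp
    then show ?thesis by (simp add: matrix_mul_assoc Q_orth)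
  qed
  let ?v = "\<lambda>s. matrix_exp ((s - t0) *\<^sub>R - W0)"
  have "((\<lambda>s. transpose (Q s) ** \<gamma> s ** Q s ** ?v s) has_vector_derivative 0) (at s)" if "s \<in> I" for s
  proof (rule has_vector_derivative_eq_rhs[OF has_vector_derivative_matrix_mul[OF has_vector_derivative_matrix_mul[OF
          has_vector_derivative_matrix_mul[OF Qt_derivative psd_path.\<gamma>1[OF path that]] Q_derivative] matrix_exp_shift_derivative]])
    interpret b: tangent_blocks "\<gamma> s" "pinv (\<gamma> s)" "\<gamma>1 s" "x s" "w s" by (rule blk[OF that])
    have "\<gamma> s ** \<Omega> s + \<gamma>1 s - \<Omega> s ** \<gamma> s = \<gamma> s ** w s"
      by (subst b.a_blocks) (simp add: om[OF that] matrix_distribs b.X_block b.Xt_block)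
    then have eq: "transpose (Q s) ** (\<gamma> s ** \<Omega> s + \<gamma>1 s - \<Omega> s ** \<gamma> s) ** Q s = transpose (Q s) ** \<gamma> s ** (Q s ** W0)"
      by (simp add: w[OF that] matrix_mul_assoc)
    have "transpose (Q s) ** \<gamma> s ** Q s ** (- W0 ** ?v s)
       + (transpose (Q s) ** \<gamma> s ** (\<Omega> s ** Q s) + (transpose (Q s) ** \<gamma>1 s + - (transpose (Q s) ** \<Omega> s) ** \<gamma> s) ** Q s) ** ?v s
       = (transpose (Q s) ** (\<gamma> s ** \<Omega> s + \<gamma>1 s - \<Omega> s ** \<gamma> s) ** Q s - transpose (Q s) ** \<gamma> s ** (Q s ** W0)) ** ?v s"
      by (simp add: matrix_distribs matrix_mul_assoc)
    then show "transpose (Q s) ** \<gamma> s ** Q s ** (- W0 ** ?v s)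
       + (transpose (Q s) ** \<gamma> s ** (\<Omega> s ** Q s) + (transpose (Q s) ** \<gamma>1 s + - (transpose (Q s) ** \<Omega> s) ** \<gamma> s) ** Q s) ** ?v s = 0"
      by (simp add: eq)
  qed
  from const[OF this s] have "transpose (Q s) ** \<gamma> s ** Q s ** ?v s = A0" by (simp add: initial init)
  then have "flow s = Q s ** (transpose (Q s) ** \<gamma> s ** Q s ** ?v s ** matrix_exp ((s - t0) *\<^sub>R W0)) ** transpose (Q s)"
    by (simp add: flow_def)
  also have "?v s ** matrix_exp ((s - t0) *\<^sub>R W0) = mat 1"
    using matrix_exp_inverse[of "s - t0" "- W0"] by (simp del: minus_diff_eq)
  then have "Q s ** (transpose (Q s) ** \<gamma> s ** Q s ** ?v s ** matrix_exp ((s - t0) *\<^sub>R W0)) ** transpose (Q s)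
     = Q s ** transpose (Q s) ** \<gamma> s ** (Q s ** transpose (Q s))"
    by (simp add: matrix_mul_assoc[symmetric])
  also have "\<dots> = \<gamma> s" by (simp add: Q_orth)
  finally show ?thesis by simp
qed

end


section \<open>Geodesic completeness\<close>

text \<open>The differentials of the local parametrizations have exactly the tangent vectors as values.\<close>

lemma geodesic_psd_iff:
  fixes \<gamma> :: "real \<Rightarrow> real^'n^'n"
  assumes card: "CARD('p::finite) < CARD('n)" and k: "k > 0"
    and path: "psd_path TYPE('p) I \<gamma> \<gamma>1 \<gamma>2" and I: "is_interval I" "I \<noteq> {}" "smooth_on I \<gamma>"
  shows "geodesic TYPE(('n, 'p) psd_coord) (psd_rank CARD('p)) (psd_metric TYPE('p) k) I \<gamma> \<longleftrightarrow>
    (\<forall>t\<in>I. \<forall>b. tangent (\<gamma> t) b \<longrightarrow> euler_lagrange (psd_form k) (psd_form_deriv k) (\<gamma> t) (\<gamma>1 t) (\<gamma>2 t) b = 0)"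
    (is "?geo \<longleftrightarrow> (\<forall>t\<in>I. \<forall>b. tangent (\<gamma> t) b \<longrightarrow> ?EL t b = 0)")
proof -
  let ?M = "psd_rank CARD('p) :: (real^'n^'n) set"
  note p = psd_path.I[OF path] psd_path.mem[OF path] psd_path.\<gamma>1[OF path] psd_path.\<gamma>2[OF path]
  have sub: "\<gamma> ` I \<subseteq> ?M" using p(2) by blast
  have "?geo \<longleftrightarrow> (\<forall>(\<phi> :: real^('n, 'p) psd_coord \<Rightarrow> real^'n^'n) W. local_parametrization ?M W \<phi> \<longrightarrow>
       (\<forall>t\<in>I. \<forall>y\<in>W. \<phi> y = \<gamma> t \<longrightarrow> (\<forall>u. ?EL t (D1 \<phi> y u) = 0)))"
    by (rule extended_metric.geodesic_iff_euler_lagrange[OF extended_metric_psd[OF card k] p(1) I(1,2) sub I(3) p(3,4)])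
  also have "\<dots> \<longleftrightarrow> (\<forall>t\<in>I. \<forall>b. tangent (\<gamma> t) b \<longrightarrow> ?EL t b = 0)"
  proof (intro iffI ballI allI impI)
    fix t b
    assume el: "\<forall>(\<phi> :: real^('n, 'p) psd_coord \<Rightarrow> real^'n^'n) W. local_parametrization ?M W \<phi> \<longrightarrow>
       (\<forall>t\<in>I. \<forall>y\<in>W. \<phi> y = \<gamma> t \<longrightarrow> (\<forall>u. ?EL t (D1 \<phi> y u) = 0))"
      and t: "t \<in> I" and b: "tangent (\<gamma> t) b"
    obtain \<phi> :: "real^('n, 'p) psd_coord \<Rightarrow> real^'n^'n" and W y where
      \<phi>: "local_parametrization ?M W \<phi>" "y \<in> W" "\<phi> y = \<gamma> t" and "\<exists>u. D1 \<phi> y u = b"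
      using ex_local_parametrization[OF card p(2)[OF t]] b by metis
    then obtain u where "D1 \<phi> y u = b" by blast
    then show "?EL t b = 0" using el[rule_format, OF \<phi>(1) t \<phi>(2,3), of u] by simp
  next
    fix \<phi> :: "real^('n, 'p) psd_coord \<Rightarrow> real^'n^'n" and W t y u
    assume el: "\<forall>t\<in>I. \<forall>b. tangent (\<gamma> t) b \<longrightarrow> ?EL t b = 0"
      and \<phi>: "local_parametrization ?M W \<phi>" and t: "t \<in> I" and y: "y \<in> W" "\<phi> y = \<gamma> t"
    have W: "open W" "smooth_on W \<phi>" "\<And>z. z \<in> W \<Longrightarrow> \<phi> z \<in> ?M"
      using \<phi> by (auto simp: local_parametrization_def)
    have "tangent (\<phi> y) (D1 \<phi> y u)"
      by (rule velocity_tangent[OF W(1) y(1) W(3) smooth_on_imp_has_derivative[OF W(2) y(1)]])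
    then show "?EL t (D1 \<phi> y u) = 0" using el t y(2) by simp
  qed
  finally show ?thesis .
qed

lemma (in psd_flow) geodesic_flow:
  assumes card: "CARD('p) < CARD('n)" and k: "k > 0"
  shows "geodesic TYPE(('n, 'p) psd_coord) (psd_rank CARD('p)) (psd_metric TYPE('p) k) UNIV flow"
proof -
  obtain c where c: "\<And>s. (velocity has_vector_derivative c s) (at s)" using acceleration by metis
  have path: "psd_path TYPE('p) UNIV flow velocity c"
    by (rule psd_path.intro) (auto intro: flow_in_psd_rank flow_velocity c)
  have "\<forall>b. tangent (flow t) b \<longrightarrow> euler_lagrange (psd_form k) (psd_form_deriv k) (flow t) (velocity t) (c t) b = 0" for t
    by (rule psd_path.euler_lagrange_zero_iff[OF path UNIV_I k, THEN iffD2])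
      (simp add: turn_flow stretch_flow X_derivative W_derivative)
  then show ?thesis
    using geodesic_psd_iff[OF card k path _ _ smooth_flow] by (simp add: is_interval_univ)
qed

lemma geodesic_eq_flow:
  fixes \<gamma> :: "real \<Rightarrow> real^'n^'n"
  assumes card: "CARD('p::finite) < CARD('n)" and k: "k > 0"
    and path: "psd_path TYPE('p) I \<gamma> \<gamma>1 \<gamma>2"
    and geo: "geodesic TYPE(('n, 'p) psd_coord) (psd_rank CARD('p)) (psd_metric TYPE('p) k) I \<gamma>"
    and t0: "t0 \<in> I" and t: "t \<in> I"
  shows "\<gamma> t = psd_flow.flow k t0 (\<gamma> t0) (\<gamma>1 t0) t"
proof -
  have I: "is_interval I" "I \<noteq> {}" "smooth_on I \<gamma>" using geo by (auto simp: geodesic_def)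
  have fl: "psd_flow TYPE('p) (\<gamma> t0) (\<gamma>1 t0)"
    by (rule psd_flow.intro[OF psd_path.mem[OF path t0] psd_path.tangent_velocity[OF path t0]])
  have el: "\<forall>b. tangent (\<gamma> s) b \<longrightarrow> euler_lagrange (psd_form k) (psd_form_deriv k) (\<gamma> s) (\<gamma>1 s) (\<gamma>2 s) b = 0"
    if "s \<in> I" for s
    using geo that unfolding geodesic_psd_iff[OF card k path I] by blast
  note sys = psd_path.euler_lagrange_zero_iff[OF path _ k, THEN iffD1, OF _ el]
  show ?thesis
    by (rule psd_flow.flow_unique[OF fl path I(1) t0 refl refl _ _ t])
      (use sys in \<open>auto\<close>)
qed

text \<open>A maximal geodesic agrees with the flow through one of its points, and the flow is a geodesic on the whole
  line.\<close>

theorem psd_geodesically_complete: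
  assumes card: "CARD('p::finite) < CARD('n::finite)" and k: "k > 0"
  shows "geodesically_complete TYPE(('n, 'p) psd_coord)
    (psd_rank CARD('p) :: (real^'n^'n) set) (psd_metric TYPE('p) k)"
  unfolding geodesically_complete_def
proof (intro allI impI)
  fix I and \<gamma> :: "real \<Rightarrow> real^'n^'n"
  let ?geo = "geodesic TYPE(('n, 'p) psd_coord) (psd_rank CARD('p) :: (real^'n^'n) set) (psd_metric TYPE('p) k)"
  assume "maximal_geodesic TYPE(('n, 'p) psd_coord) (psd_rank CARD('p)) (psd_metric TYPE('p) k) I \<gamma>"
  then have geo: "?geo I \<gamma>" and max: "\<And>J \<delta>. ?geo J \<delta> \<Longrightarrow> I \<subseteq> J \<Longrightarrow> \<forall>t\<in>I. \<delta> t = \<gamma> t \<Longrightarrow> J = I"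
    unfolding maximal_geodesic_def by blast+
  then obtain t0 where t0: "t0 \<in> I" by (auto simp: geodesic_def)
  obtain \<gamma>1 \<gamma>2 where d: "\<And>t. t \<in> I \<Longrightarrow> (\<gamma> has_vector_derivative \<gamma>1 t) (at t)"
    "\<And>t. t \<in> I \<Longrightarrow> (\<gamma>1 has_vector_derivative \<gamma>2 t) (at t)"
    using smooth_on_curve_derivatives[of I \<gamma>] geo by (auto simp: geodesic_def)
  have path: "psd_path TYPE('p) I \<gamma> \<gamma>1 \<gamma>2"
    by (rule psd_path.intro) (use geo d in \<open>auto simp: geodesic_def\<close>)
  have fl: "psd_flow TYPE('p) (\<gamma> t0) (\<gamma>1 t0)"
    by (rule psd_flow.intro[OF psd_path.mem[OF path t0] psd_path.tangent_velocity[OF path t0]])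
  have "UNIV = I"
    by (rule max[OF psd_flow.geodesic_flow[OF fl card k]])
      (use geodesic_eq_flow[OF card k path geo t0] in auto)
  then show "I = UNIV" by simp
qed

theorem proposition3:
  fixes k :: real
  assumes "1 \<le> CARD('p::finite)" and "CARD('p) < CARD('n::finite)" and "k > 0"
  shows "(\<forall>(A :: real^'n^'n) (U :: real^'p^'n) (R :: real^'p^'p) \<Delta> D X s V.
            A \<in> psd_rank CARD('p) \<and> U \<in> stiefel \<and> R \<in> spd_matrices \<and>
            A = U ** (R ** R) ** transpose U \<and>
            (\<Delta>, D) \<in> horizontal U R \<and> compact_svd \<Delta> X s V \<longrightarrow>
              smooth_on UNIV (psd_curve U R D X s V) \<and>
              (\<forall>t::real. psd_curve U R D X s V t \<in> psd_rank CARD('p))) \<and>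
         geodesically_complete TYPE(('n, 'p) psd_coord)
           (psd_rank CARD('p) :: (real^'n^'n) set) (psd_metric TYPE('p) k)"
  using psd_curve_smooth psd_curve_in_psd_rank psd_geodesically_complete[OF assms(2,3)] by blast

end
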